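(* Let $R\subset\mathbb{N}$ be a set enumerated by a regular sequence $(r_n)_{n\in\mathbb{N}}$ that is congruence periodic. Then the first-order theory $\mathrm{Th}(\mathbb{Z},+,0,<,R)$ is NIP.
   Context: $\mathbb{N}$ contains $0$. A strictly increasing sequence $(r_n)_{n\in\mathbb{N}}$ of natural numbers is called regular if $r_{n+1}/r_n\to\theta$ for some $\theta\in\mathbb{R}^{>1}\cup\{\infty\}$ and, if $\theta$ is (a real number) algebraic over $\mathbb{Q}$, then $(r_n)$ satisfies a linear recurrence relation whose characteristic polynomial is the minimal polynomial of $\theta$ over $\mathbb{Q}$. Here, $(r_n)$ satisfies a linear recurrence relation if there are $a_0,\dots,a_{k-1}\in\mathbb{Q}$, with $k\ge 1$ minimal, such that $r_{n+k}=\sum_{i=0}^{k-1}a_ir_{n+i}$ for all $n\in\mathbb{N}$; its characteristic polynomial is $X^k-\sum_{i=0}^{k-1}a_iX^i$. The sequence $(r_n)$ is congruence periodic if for every integer $m>1$ it is ultimately periodic modulo $m$. In $(\mathbb{Z},+,0,<,R)$, $R$ is a unary predicate interpreted by the set $\{r_n\mid n\in\mathbb{N}\}$. *)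

theory Defs
  imports Complex_Main "HOL-Computational_Algebra.Polynomial"
begin

subsection \<open>Regular and congruence periodic sequences\<close>

definition lin_rec :: "(nat \<Rightarrow> nat) \<Rightarrow> nat \<Rightarrow> (nat \<Rightarrow> rat) \<Rightarrow> bool" where
  "lin_rec r k a \<longleftrightarrow>
     k \<ge> 1 \<and> (\<forall>n. of_nat (r (n + k)) = (\<Sum>i<k. a i * of_nat (r (n + i))))"

definition min_lin_rec :: "(nat \<Rightarrow> nat) \<Rightarrow> nat \<Rightarrow> (nat \<Rightarrow> rat) \<Rightarrow> bool" where
  "min_lin_rec r k a \<longleftrightarrow> lin_rec r k a \<and> (\<forall>k' a'. lin_rec r k' a' \<longrightarrow> k \<le> k')"

definition charpoly_rec :: "nat \<Rightarrow> (nat \<Rightarrow> rat) \<Rightarrow> rat poly" where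
  "charpoly_rec k a = monom 1 k - (\<Sum>i<k. monom (a i) i)"

definition is_min_poly :: "rat poly \<Rightarrow> real \<Rightarrow> bool" where
  "is_min_poly p \<theta> \<longleftrightarrow>
     lead_coeff p = 1 \<and> poly (map_poly of_rat p) \<theta> = 0 \<and>
     (\<forall>q. q \<noteq> 0 \<and> poly (map_poly of_rat q) \<theta> = 0 \<longrightarrow> degree p \<le> degree q)"

text \<open>
  The first disjunct is the case of an infinite limit. If \<open>r 0 = 0\<close>, the first
  quotient is \<open>0\<close> by convention, which does not affect the limit. The predicate
  \<^const>\<open>algebraic\<close> (being a root of a nonzero polynomial with integer coefficients)
  is algebraicity over the rationals.
\<close>
definition regular_seq :: "(nat \<Rightarrow> nat) \<Rightarrow> bool" where
  "regular_seq r \<longleftrightarrow> strict_mono r \<and>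
     (filterlim (\<lambda>n. real (r (Suc n)) / real (r n)) at_top sequentially \<or>
      (\<exists>\<theta>::real. \<theta> > 1 \<and> (\<lambda>n. real (r (Suc n)) / real (r n)) \<longlonglongrightarrow> \<theta> \<and>
         (algebraic \<theta> \<longrightarrow>
            (\<exists>k a. min_lin_rec r k a \<and> is_min_poly (charpoly_rec k a) \<theta>))))"

definition congruence_periodic :: "(nat \<Rightarrow> nat) \<Rightarrow> bool" where
  "congruence_periodic r \<longleftrightarrow>
     (\<forall>m>1. \<exists>p>0. \<exists>N. \<forall>n\<ge>N. r (n + p) mod m = r n mod m)"

subsection \<open>First-order logic in the language of addition, zero, order and a unary predicate\<close>

datatype tm = Var nat | Zero | Add tm tm

datatype fm =
    Eq tm tm
  | Less tm tm
  | Rel tm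
  | Neg fm
  | Conj fm fm
  | Exi nat fm

primrec fv_tm :: "tm \<Rightarrow> nat set" where
  "fv_tm (Var v) = {v}"
| "fv_tm Zero = {}"
| "fv_tm (Add s t) = fv_tm s \<union> fv_tm t"

primrec fv :: "fm \<Rightarrow> nat set" where
  "fv (Eq s t) = fv_tm s \<union> fv_tm t"
| "fv (Less s t) = fv_tm s \<union> fv_tm t"
| "fv (Rel t) = fv_tm t"
| "fv (Neg \<phi>) = fv \<phi>"
| "fv (Conj \<phi> \<psi>) = fv \<phi> \<union> fv \<psi>"
| "fv (Exi v \<phi>) = fv \<phi> - {v}"

record 'm struc =
  universe :: "'m set"
  zero_of :: 'm
  add_of :: "'m \<Rightarrow> 'm \<Rightarrow> 'm"
  less_of :: "'m \<Rightarrow> 'm \<Rightarrow> bool"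
  rel_of :: "'m \<Rightarrow> bool"

definition is_struc :: "'m struc \<Rightarrow> bool" where
  "is_struc M \<longleftrightarrow>
     zero_of M \<in> universe M \<and>
     (\<forall>x\<in>universe M. \<forall>y\<in>universe M. add_of M x y \<in> universe M)"

primrec val :: "'m struc \<Rightarrow> (nat \<Rightarrow> 'm) \<Rightarrow> tm \<Rightarrow> 'm" where
  "val M e (Var v) = e v"
| "val M e Zero = zero_of M"
| "val M e (Add s t) = add_of M (val M e s) (val M e t)"

primrec sat :: "'m struc \<Rightarrow> (nat \<Rightarrow> 'm) \<Rightarrow> fm \<Rightarrow> bool" where
  "sat M e (Eq s t) \<longleftrightarrow> val M e s = val M e t"
| "sat M e (Less s t) \<longleftrightarrow> less_of M (val M e s) (val M e t)"
| "sat M e (Rel t) \<longleftrightarrow> rel_of M (val M e t)"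
| "sat M e (Neg \<phi>) \<longleftrightarrow> \<not> sat M e \<phi>"
| "sat M e (Conj \<phi> \<psi>) \<longleftrightarrow> sat M e \<phi> \<and> sat M e \<psi>"
| "sat M e (Exi v \<phi>) \<longleftrightarrow> (\<exists>x\<in>universe M. sat M (e(v := x)) \<phi>)"

definition valuation :: "'m struc \<Rightarrow> (nat \<Rightarrow> 'm) \<Rightarrow> bool" where
  "valuation M e \<longleftrightarrow> (\<forall>v. e v \<in> universe M)"

definition Th :: "'m struc \<Rightarrow> fm set" where
  "Th M = {\<phi>. fv \<phi> = {} \<and> (\<forall>e. valuation M e \<longrightarrow> sat M e \<phi>)}"

definition is_model :: "'m struc \<Rightarrow> fm set \<Rightarrow> bool" where
  "is_model M T \<longleftrightarrow> is_struc M \<and> (\<forall>\<phi>\<in>T. \<forall>e. valuation M e \<longrightarrow> sat M e \<phi>)"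

subsection \<open>The independence property\<close>

text \<open>
  A partitioned formula \<open>\<phi>(x;y)\<close> is a formula \<open>\<phi>\<close> together with a set \<open>X\<close> of variables:
  the tuple \<open>x\<close> consists of the free variables of \<open>\<phi>\<close> in \<open>X\<close>, and \<open>y\<close> of the remaining
  ones. Values of \<open>x\<close> and of \<open>y\<close> are given by valuations, of which only the relevant
  part is used. The formula has the independence property in \<open>M\<close> if it shatters
  families of tuples of every finite size.
\<close>
definition has_IP :: "'m struc \<Rightarrow> nat set \<Rightarrow> fm \<Rightarrow> bool" where
  "has_IP M X \<phi> \<longleftrightarrow>
     (\<forall>n. \<exists>(a :: nat \<Rightarrow> nat \<Rightarrow> 'm) (b :: nat set \<Rightarrow> nat \<Rightarrow> 'm).
        (\<forall>i<n. valuation M (a i)) \<and> (\<forall>J\<subseteq>{..<n}. valuation M (b J)) \<and>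
        (\<forall>i<n. \<forall>J\<subseteq>{..<n}.
           sat M (\<lambda>v. if v \<in> X then a i v else b J v) \<phi> \<longleftrightarrow> i \<in> J))"

text \<open>
  Shattering an infinite family in \<open>M\<close> is a special case; the two notions agree in
  sufficiently saturated models.
\<close>
lemma has_IP_if_infinite:
  assumes "\<And>i. valuation M (a i)" "\<And>J. valuation M (b J)"
    and "\<And>(i::nat) J. sat M (\<lambda>v. if v \<in> X then a i v else b J v) \<phi> \<longleftrightarrow> i \<in> J"
  shows "has_IP M X \<phi>"
  unfolding has_IP_def using assms by blast

text \<open>
  HOL cannot quantify over types inside a definition, so the type in which the universes
  of the models live is a parameter. A theorem in which \<open>'m\<close> is a free type variable
  speaks about all models of \<open>T\<close>.
\<close>
definition NIP :: "'m itself \<Rightarrow> fm set \<Rightarrow> bool" where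
  "NIP _ T \<longleftrightarrow> (\<forall>M :: 'm struc. is_model M T \<longrightarrow> (\<forall>X \<phi>. \<not> has_IP M X \<phi>))"

subsection \<open>The integers with a distinguished set of natural numbers\<close>

definition int_struc :: "nat set \<Rightarrow> int struc" where
  "int_struc R =
     \<lparr>universe = UNIV, zero_of = 0, add_of = (+), less_of = (<), rel_of = (\<lambda>x. x \<in> int ` R)\<rparr>"

end

theory Submission
  imports Defs "HOL-Library.Countable_Set" "HOL-Library.Countable" "HOL-Library.Nat_Bijection"
begin

text \<open>
  Shattering \<open>n\<close> tuples by a formula is expressed by a sentence, so a formula with the independence
  property in some model of the theory has it in the integers themselves (\<open>has_IP_transfer\<close>). There
  the proof is an elimination of quantifiers, followed by a counting argument.

  The elimination uses the functions \<open>shift j\<close>, where \<open>shift j x\<close> is the member of the sequence \<open>j\<close>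
  places after the largest member that is at most \<open>x\<close>. The truth of a formula turns out to depend only on the
  signs and residues of finitely many terms built from variables, integers, addition and these
  functions (\<open>determined_sat\<close>). The arithmetic reason is a dichotomy: an integer combination
  \<open>\<Sum>i. z i * r (n + i)\<close> either vanishes for all \<open>n\<close>, or is eventually, up to sign and a bounded
  number of places, as large as \<open>r n\<close>. For a finite limit \<open>\<theta>\<close> of the ratios, its quotient by \<open>r n\<close> tends to
  \<open>\<Sum>i. z i * \<theta> ^ i\<close>; if that is zero without all \<open>z i\<close> being zero, then \<open>\<theta>\<close> is algebraic, its minimal
  polynomial divides \<open>\<Sum>i. z i * X ^ i\<close>, and the recurrence makes the combination vanish. For an
  infinite limit the last nonzero term dominates.

  The elimination is a back-and-forth argument in an ultrapower. A member of the sequence that is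
  infinitely many places away from all old elements is incomparable in size with each of them, so
  every sum of an old element and a nonvanishing combination of its shifts is governed by one of the
  two summands. Hence such a member is described by its cut among the old elements and its residues,
  and congruence periodicity makes the residues of its shifts a matter of its index. Once all
  members of the sequence that are needed have been adjoined (\<open>adjoin_position\<close>), any further element
  is described by its cut and its residues as in Presburger arithmetic (\<open>adjoin_element\<close>).

  For the counting, fix tuples \<open>a 0, \<dots>, a (n - 1)\<close> and a term \<open>t(x, y)\<close>. The tuples \<open>b\<close> fall into
  polynomially many classes such that on each class \<open>t(a i, b) = g i + h (\<chi> i) b\<close>, where \<open>\<chi>\<close> takes a
  number of values that is independent of \<open>n\<close> (\<open>splits_qval\<close>). Only \<open>shift\<close> needs an idea: if \<open>i'\<close>
  minimises \<open>\<bar>t(a i', b)\<bar>\<close> among the indices of one colour, then \<open>\<bar>t(a i, b)\<bar>\<close> is at most twice the larger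
  one of \<open>\<bar>t(a i', b)\<bar>\<close> and \<open>\<bar>g i - g i'\<bar>\<close>, and at least half of it; so its position is a bounded number of places
  from that of one of two numbers, of which the first does not depend on \<open>i\<close>, and the second depends on \<open>b\<close>
  only through \<open>i'\<close>. Comparing \<open>g i + h b\<close> with zero cuts out at most \<open>n + 1\<close> sets of indices when
  \<open>b\<close> varies. Altogether a formula cuts out only polynomially many subsets of the \<open>n\<close> indices, hence
  not all \<open>2 ^ n\<close>.
\<close>

section \<open>Integer combinations of consecutive members\<close>

definition seq_op :: "(nat \<Rightarrow> nat) \<Rightarrow> nat \<Rightarrow> (nat \<Rightarrow> int) \<Rightarrow> nat \<Rightarrow> int" where
  "seq_op r N z n = (\<Sum>i<N. z i * int (r (n + i)))"

lemma regular_seq_ratio: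
  assumes "regular_seq r"
  shows "\<exists>q>1. eventually (\<lambda>n. q * real (r n) \<le> real (r (Suc n))) sequentially"
proof -
  have sm: "strict_mono r" using assms by (simp add: regular_seq_def)
  have pos: "eventually (\<lambda>n. real (r n) > 0) sequentially"
    using eventually_gt_at_top[of 0]
    by eventually_elim (metis of_nat_0_less_iff seq_suble[OF sm] less_le_trans)
  consider (inf) "filterlim (\<lambda>n. real (r (Suc n)) / real (r n)) at_top sequentially"
    | (fin) \<theta> where "\<theta> > 1" "(\<lambda>n. real (r (Suc n)) / real (r n)) \<longlonglongrightarrow> \<theta>"
    using assms by (auto simp: regular_seq_def)
  then have "\<exists>q>1. eventually (\<lambda>n. q \<le> real (r (Suc n)) / real (r n)) sequentially"
  proof cases
    case inf
    then have "eventually (\<lambda>n. 2 \<le> real (r (Suc n)) / real (r n)) sequentially"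
      by (simp add: filterlim_at_top)
    then show ?thesis by (intro exI[of _ 2]) simp
  next
    case fin
    then have "eventually (\<lambda>n. (1 + \<theta>) / 2 < real (r (Suc n)) / real (r n)) sequentially"
      by (intro order_tendstoD) auto
    then show ?thesis using fin(1)
      by (intro exI[of _ "(1+\<theta>)/2"]) (auto elim: eventually_mono)
  qed
  then obtain q where "q > 1" and "eventually (\<lambda>n. q \<le> real (r (Suc n)) / real (r n)) sequentially"
    by blast
  then have "eventually (\<lambda>n. q * real (r n) \<le> real (r (Suc n))) sequentially"
    using pos by (auto elim: eventually_elim2 simp: pos_le_divide_eq)
  with \<open>q > 1\<close> show ?thesis by blast
qed

text \<open>Sparseness: a constant factor is absorbed by a bounded number of places.\<close>

lemma regular_seq_growth:
  assumes "regular_seq r"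
  shows "\<exists>k. \<forall>n. C * r n \<le> r (n + k)"
proof -
  obtain q N where q: "q > 1" and N: "\<And>n. n \<ge> N \<Longrightarrow> q * real (r n) \<le> real (r (Suc n))"
    using regular_seq_ratio[OF assms] unfolding eventually_sequentially by blast
  have sm: "strict_mono r" using assms by (simp add: regular_seq_def)
  have pow: "q ^ j * real (r n) \<le> real (r (n + j))" if "n \<ge> N" for j n
  proof (induction j)
    case (Suc j)
    have "q ^ Suc j * real (r n) \<le> q * real (r (n + j))" using Suc q by simp
    also have "\<dots> \<le> real (r (n + Suc j))" using N[of "n+j"] that by simp
    finally show ?case .
  qed simp
  obtain j where j: "real C < q ^ j" using real_arch_pow[OF q] by blast
  \<comment> \<open>the first \<open>N\<close> places lead to where the ratios exceed \<open>q\<close>\<close>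
  have "C * r n \<le> r (n + (N + j))" for n
  proof -
    have "real (C * r n) \<le> real C * real (r (n + N))"
      using strict_mono_less_eq[OF sm, of n "n+N"] by (simp add: mult_left_mono)
    also have "\<dots> \<le> q ^ j * real (r (n + N))" using j by (intro mult_right_mono) auto
    also have "\<dots> \<le> real (r (n + N + j))" using pow[of "n+N" j] by simp
    finally have "real (C * r n) \<le> real (r (n + (N + j)))" by (simp add: add.assoc)
    then show ?thesis by (simp only: of_nat_le_iff)
  qed
  then show ?thesis by blast
qed

text \<open>The polynomial acts on sequences, with \<open>X\<close> acting as the shift by one place.\<close>

definition poly_op :: "(nat \<Rightarrow> nat) \<Rightarrow> rat poly \<Rightarrow> nat \<Rightarrow> rat" where
  "poly_op r p n = (\<Sum>i\<le>degree p. coeff p i * of_nat (r (n + i)))"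

lemma poly_op_bound:
  "degree p \<le> d \<Longrightarrow> poly_op r p n = (\<Sum>i\<le>d. coeff p i * of_nat (r (n + i)))"
  unfolding poly_op_def by (rule sum.mono_neutral_left) (auto simp: coeff_eq_0)

lemma poly_op_add: "poly_op r (p + q) n = poly_op r p n + poly_op r q n"
proof -
  define d where "d = max (degree p) (degree q)"
  have "degree (p + q) \<le> d" "degree p \<le> d" "degree q \<le> d"
    by (auto simp: d_def intro: degree_add_le)
  then show ?thesis by (simp add: poly_op_bound algebra_simps sum.distrib)
qed

lemma poly_op_smult: "poly_op r (smult c p) n = c * poly_op r p n"
  unfolding poly_op_bound[OF degree_smult_le] poly_op_bound[OF order_refl]
  by (simp add: sum_distrib_left mult.assoc)

lemma poly_op_pCons_0: "poly_op r (pCons 0 p) n = poly_op r p (Suc n)"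
  by (subst poly_op_bound[OF degree_pCons_le], subst sum.atMost_Suc_shift) (simp add: poly_op_def)

text \<open>The polynomials that annihilate \<open>r\<close> form an ideal.\<close>

lemma poly_op_mult_eq_0:
  assumes "\<And>n. poly_op r p n = 0"
  shows "poly_op r (q * p) n = 0"
proof (induction q arbitrary: n)
  case 0
  then show ?case by (simp add: poly_op_def)
next
  case (pCons c q)
  then show ?case using assms by (simp add: poly_op_add poly_op_smult poly_op_pCons_0)
qed

lemma poly_op_charpoly_eq_0:
  assumes "lin_rec r k a"
  shows "poly_op r (charpoly_rec k a) n = 0"
proof -
  have co: "coeff (charpoly_rec k a) i = (if i = k then 1 else 0) - (if i < k then a i else 0)" for i
    by (simp add: charpoly_rec_def coeff_sum)
  have "degree (charpoly_rec k a) \<le> k" by (rule degree_le) (simp add: co)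
  then have "poly_op r (charpoly_rec k a) n
      = (\<Sum>i<Suc k. coeff (charpoly_rec k a) i * of_nat (r (n + i)))"
    by (simp add: poly_op_bound lessThan_Suc_atMost)
  also have "\<dots> = of_nat (r (n + k)) - (\<Sum>i<k. a i * of_nat (r (n + i)))"
    by (simp add: co sum_negf)
  also have "\<dots> = 0" using assms by (simp add: lin_rec_def)
  finally show ?thesis .
qed

lemma map_poly_of_rat_add:
  "map_poly of_rat (p + q) = (map_poly of_rat p + map_poly of_rat q :: real poly)"
  by (rule poly_eqI) (simp add: coeff_map_poly of_rat_add)

lemma map_poly_of_rat_mult:
  "map_poly of_rat (p * q) = (map_poly of_rat p * map_poly of_rat q :: real poly)"
  by (rule poly_eqI) (simp add: coeff_map_poly coeff_mult of_rat_sum of_rat_mult)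

text \<open>The remainder also has the root \<open>\<theta>\<close>, and its degree is too small unless it is zero.\<close>

lemma is_min_poly_dvd:
  assumes "is_min_poly p \<theta>" and "poly (map_poly of_rat q) \<theta> = 0"
  shows "p dvd q"
proof -
  have p: "p \<noteq> 0" "poly (map_poly of_rat p) \<theta> = 0" using assms(1) by (auto simp: is_min_poly_def)
  have "map_poly of_rat q = (map_poly of_rat (q div p) * map_poly of_rat p + map_poly of_rat (q mod p) :: real poly)"
    by (metis div_mult_mod_eq map_poly_of_rat_add map_poly_of_rat_mult)
  then have 0: "poly (map_poly of_rat (q mod p)) \<theta> = 0" using assms(2) p(2) by simp
  have "q mod p = 0"
  proof (rule ccontr)
    assume "q mod p \<noteq> 0"
    then have "degree p \<le> degree (q mod p)" using 0 assms(1) by (auto simp: is_min_poly_def)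
    moreover have "degree (q mod p) < degree p" using \<open>q mod p \<noteq> 0\<close> p(1) by (meson degree_mod_less')
    ultimately show False by simp
  qed
  then show ?thesis by auto
qed

lemma eventually_lower_bound_from_ratio:
  fixes f :: "nat \<Rightarrow> int" and r :: "nat \<Rightarrow> nat"
  assumes "(\<lambda>n. real_of_int (f n) / real (r n)) \<longlonglongrightarrow> L" "L \<noteq> 0" "\<And>n. n > 0 \<Longrightarrow> r n > 0"
  shows "\<exists>s\<in>{1,-1}. \<exists>C>0. \<exists>n0. \<forall>n\<ge>n0. int (r n) \<le> C * (s * f n)"
proof -
  define s :: int where "s = (if L > 0 then 1 else -1)"
  have "(\<lambda>n. real_of_int s * (real_of_int (f n) / real (r n))) \<longlonglongrightarrow> real_of_int s * L"
    by (intro tendsto_intros assms)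
  then have "(\<lambda>n. real_of_int s * (real_of_int (f n) / real (r n))) \<longlonglongrightarrow> \<bar>L\<bar>"
    using assms(2) by (simp add: s_def abs_if split: if_splits)
  then have "eventually (\<lambda>n. \<bar>L\<bar> / 2 < real_of_int s * (real_of_int (f n) / real (r n))) sequentially"
    using assms(2) by (intro order_tendstoD) auto
  then have ev: "eventually (\<lambda>n. \<bar>L\<bar> / 2 * real (r n) < real_of_int (s * f n)) sequentially"
    using eventually_gt_at_top[of 0]
  proof eventually_elim
    case (elim n)
    with assms(3)[of n] show ?case by (simp add: field_simps)
  qed
  \<comment> \<open>an integer that makes up for the factor \<open>\<bar>L\<bar> / 2\<close> in the preceding bound\<close>
  define C where "C = \<lceil>2 / \<bar>L\<bar>\<rceil>"
  have "2 / \<bar>L\<bar> \<le> C" by (simp add: C_def)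
  moreover from this have "0 \<le> real_of_int C" by (rule order_trans[rotated]) simp
  ultimately have C: "C * \<bar>L\<bar> / 2 \<ge> 1" "C \<ge> 0"
    using assms(2) by (simp_all add: pos_divide_le_eq)
  have "eventually (\<lambda>n. int (r n) \<le> C * (s * f n)) sequentially"
    using ev
  proof eventually_elim
    case (elim n)
    have "1 * real (r n) \<le> (C * \<bar>L\<bar> / 2) * real (r n)" using C by (intro mult_right_mono) auto
    also have "\<dots> = C * (\<bar>L\<bar> / 2 * real (r n))" by simp
    also have "\<dots> \<le> C * real_of_int (s * f n)" using elim C by (intro mult_left_mono) auto
    finally have "real_of_int (int (r n)) \<le> real_of_int (C * (s * f n))" by simp
    then show ?case by (simp only: of_int_le_iff)
  qed
  moreover have "C > 0" using C by (cases "C = 0") auto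
  moreover have "s \<in> {1,-1}" by (simp add: s_def)
  ultimately show ?thesis unfolding eventually_sequentially by blast
qed

text \<open>The last nonzero coefficient decides: the ratios eventually exceed twice the sum of all others.\<close>

lemma seq_op_dichotomy_infinite:
  assumes sm: "strict_mono r" and lim: "filterlim (\<lambda>n. real (r (Suc n)) / real (r n)) at_top sequentially"
  shows "(\<forall>n. seq_op r N z n = 0) \<or> 
     (\<exists>s\<in>{1,-1}. \<exists>C>0. \<exists>n0. \<forall>n\<ge>n0. int (r n) \<le> C * (s * seq_op r N z n))"
proof (induction N)
  case 0
  then show ?case by (simp add: seq_op_def)
next
  case (Suc N)
  show ?case
  proof (cases "z N = 0")
    case True
    with Suc show ?thesis by (simp add: seq_op_def)
  next
    case False
    define K where "K = (\<Sum>i<N. \<bar>z i\<bar>)"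
    have K: "K \<ge> 0" by (auto simp: K_def intro: sum_nonneg)
    have "eventually (\<lambda>n. 2 * real_of_int K \<le> real (r (Suc n)) / real (r n)) sequentially"
      using lim by (simp add: filterlim_at_top)
    then obtain n1 where n1: "\<And>n. n \<ge> n1 \<Longrightarrow> 2 * real_of_int K \<le> real (r (Suc n)) / real (r n)"
      by (auto simp: eventually_sequentially)
    have rK: "2 * K * int (r n) \<le> int (r (Suc n))" if "n \<ge> n1 + 1" for n
    proof -
      have "r n > 0" using that seq_suble[OF sm, of n] by linarith
      then have "real_of_int (2 * K * int (r n)) \<le> real_of_int (int (r (Suc n)))" using n1[of n] that by (simp add: field_simps)
      then show ?thesis by (simp only: of_int_le_iff)
    qed
    define s where "s = sgn (z N)"
    have s: "s \<in> {1,-1}" using False by (auto simp: s_def sgn_if)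
    have "int (r n) \<le> 2 * (s * seq_op r (Suc N) z n)" if n: "n \<ge> n1 + 1" for n
    proof -
      have "2 * \<bar>\<Sum>i<N. z i * int (r (n + i))\<bar> \<le> int (r (n + N))"
      proof (cases N)
        case (Suc M)
        have "\<bar>\<Sum>i<N. z i * int (r (n + i))\<bar> \<le> (\<Sum>i<N. \<bar>z i\<bar> * int (r (n + M)))"
          by (rule order_trans[OF sum_abs], rule sum_mono)
             (auto simp: abs_mult strict_mono_less_eq[OF sm] Suc intro!: mult_left_mono)
        also have "\<dots> = K * int (r (n + M))" by (simp add: K_def sum_distrib_right)
        finally show ?thesis using rK[of "n+M"] n by (simp add: Suc)
      qed simp
      moreover have "s * seq_op r (Suc N) z n = s * (\<Sum>i<N. z i * int (r (n + i))) + \<bar>z N\<bar> * int (r (n + N))"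
        using False by (simp add: seq_op_def s_def algebra_simps abs_sgn)
      moreover have "s * X \<ge> - \<bar>X\<bar>" for X :: int using s by auto
      moreover have "\<bar>z N\<bar> * int (r (n + N)) \<ge> 1 * int (r (n + N))" using False by (intro mult_right_mono) auto
      moreover have "int (r n) \<le> int (r (n + N))" by (simp add: strict_mono_less_eq[OF sm])
      ultimately show ?thesis by (smt (verit))
    qed
    moreover have "(2::int) > 0" by simp
    ultimately show ?thesis using s by blast
  qed
qed

text \<open>
  Divided by \<open>r n\<close>, the combination tends to the value at \<open>\<theta>\<close> of the polynomial \<open>q\<close> with coefficients
  \<open>z\<close>. If this limit is zero and \<open>q\<close> is not, the characteristic polynomial of the recurrence divides
  \<open>q\<close>, so \<open>q\<close> annihilates the sequence.
\<close>

lemma seq_op_dichotomy_finite: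
  assumes sm: "strict_mono r" and \<theta>: "\<theta> > 1" and lim: "(\<lambda>n. real (r (Suc n)) / real (r n)) \<longlonglongrightarrow> \<theta>"
    and alg: "algebraic \<theta> \<Longrightarrow> \<exists>k a. min_lin_rec r k a \<and> is_min_poly (charpoly_rec k a) \<theta>"
  shows "(\<forall>n. seq_op r N z n = 0) \<or> 
     (\<exists>s\<in>{1,-1}. \<exists>C>0. \<exists>n0. \<forall>n\<ge>n0. int (r n) \<le> C * (s * seq_op r N z n))"
proof -
  have pos: "r n > 0" if "n > 0" for n using that seq_suble[OF sm, of n] by linarith
  have pow: "(\<lambda>n. real (r (n + i)) / real (r n)) \<longlonglongrightarrow> \<theta> ^ i" for i
  proof (induction i)
    case 0
    have "eventually (\<lambda>n. 1 = real (r (n + 0)) / real (r n)) sequentially"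
      using eventually_gt_at_top[of 0] by eventually_elim (use pos in force)
    then show ?case by (simp add: tendsto_eventually eventually_mono)
  next
    case (Suc i)
    have "(\<lambda>n. real (r (Suc (n + i))) / real (r (n + i))) \<longlonglongrightarrow> \<theta>"
      using LIMSEQ_ignore_initial_segment[OF lim, of i] by simp
    from tendsto_mult[OF this Suc]
    have "(\<lambda>n. real (r (Suc (n + i))) / real (r (n + i)) * (real (r (n + i)) / real (r n))) \<longlonglongrightarrow> \<theta> ^ Suc i"
      by simp
    moreover have "eventually (\<lambda>n. real (r (Suc (n + i))) / real (r (n + i)) * (real (r (n + i)) / real (r n))
                         = real (r (n + Suc i)) / real (r n)) sequentially"
      using eventually_gt_at_top[of 0]
    proof eventually_elim
      case (elim n)
      with pos[of "n+i"] show ?case by simp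
    qed
    ultimately show ?case by (rule Lim_transform_eventually)
  qed
  define L where "L = (\<Sum>i<N. real_of_int (z i) * \<theta> ^ i)"
  have "(\<lambda>n. \<Sum>i<N. real_of_int (z i) * (real (r (n + i)) / real (r n))) \<longlonglongrightarrow> L"
    unfolding L_def by (intro tendsto_intros pow)
  then have tend: "(\<lambda>n. real_of_int (seq_op r N z n) / real (r n)) \<longlonglongrightarrow> L"
    by (simp add: seq_op_def sum_divide_distrib)
  show ?thesis
  proof (cases "L = 0")
    case False
    with eventually_lower_bound_from_ratio[of "seq_op r N z" r, OF tend] pos show ?thesis by blast
  next
    case True
    define q :: "rat poly" where "q = (\<Sum>i<N. monom (of_int (z i)) i)"
    have coq: "coeff q i = (if i < N then of_int (z i) else 0)" for i
      by (simp add: q_def coeff_sum)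
    have degq: "degree q \<le> N" by (rule degree_le) (simp add: coq)
    have op: "poly_op r q n = of_int (seq_op r N z n)" for n
    proof -
      have "poly_op r q n = (\<Sum>i<N. coeff q i * of_nat (r (n + i)))"
        unfolding poly_op_bound[OF degq]
        by (rule sum.mono_neutral_right) (auto simp: coq)
      then show ?thesis by (simp add: coq seq_op_def)
    qed
    have "degree (map_poly of_rat q :: real poly) \<le> N"
      by (rule degree_le) (simp add: coeff_map_poly coq)
    then have "poly (map_poly of_rat q) \<theta> = (\<Sum>i\<le>N. coeff (map_poly of_rat q) i * \<theta> ^ i)"
      unfolding poly_altdef
      by (intro sum.mono_neutral_left) (auto simp: coeff_eq_0)
    also have "\<dots> = (\<Sum>i<N. coeff (map_poly of_rat q) i * \<theta> ^ i)"
      by (rule sum.mono_neutral_right) (auto simp: coq coeff_map_poly)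
    also have "\<dots> = L" by (simp add: coq coeff_map_poly L_def)
    finally have root: "poly (map_poly of_rat q) \<theta> = 0" using True by simp
    have "seq_op r N z n = 0" for n
    proof (cases "q = 0")
      case True
      then show ?thesis using op[of n] by (simp add: poly_op_def)
    next
      case False
      have "algebraic \<theta>"
        using root False by (intro algebraicI'[of "map_poly of_rat q"])
           (auto simp: coeff_map_poly map_poly_eq_0_iff)
      with alg obtain k a where ka: "lin_rec r k a" "is_min_poly (charpoly_rec k a) \<theta>"
        by (auto simp: min_lin_rec_def)
      from is_min_poly_dvd[OF ka(2) root] obtain w where w: "q = w * charpoly_rec k a"
        by (metis dvdE mult.commute)
      have "poly_op r q n = 0"
        unfolding w by (intro poly_op_mult_eq_0 poly_op_charpoly_eq_0 ka)
      then show ?thesis by (simp add: op)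
    qed
    then show ?thesis by blast
  qed
qed

text \<open>What the rest of the proof uses of the hypotheses on the sequence.\<close>

locale sparse_sequence =
  fixes r :: "nat \<Rightarrow> nat"
  assumes mono: "strict_mono r"
    and growth: "\<And>C. \<exists>k. \<forall>n. C * r n \<le> r (n + k)"
    and dichotomy: "\<And>N z. (\<forall>n. seq_op r N z n = 0) \<or>
          (\<exists>s\<in>{1,-1}. \<exists>C>0. \<exists>n0. \<forall>n\<ge>n0. int (r n) \<le> C * (s * seq_op r N z n))"
    and periodic: "congruence_periodic r"

lemma sparse_sequence_if_regular:
  assumes "regular_seq r" "congruence_periodic r"
  shows "sparse_sequence r"
proof
  fix N z
  show "(\<forall>n. seq_op r N z n = 0) \<or>
          (\<exists>s\<in>{1,-1}. \<exists>C>0. \<exists>n0. \<forall>n\<ge>n0. int (r n) \<le> C * (s * seq_op r N z n))"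
  proof -
    have sm: "strict_mono r" using assms(1) by (simp add: regular_seq_def)
    consider "filterlim (\<lambda>n. real (r (Suc n)) / real (r n)) at_top sequentially"
      | \<theta> where "\<theta> > 1" "(\<lambda>n. real (r (Suc n)) / real (r n)) \<longlonglongrightarrow> \<theta>"
          "algebraic \<theta> \<longrightarrow> (\<exists>k a. min_lin_rec r k a \<and> is_min_poly (charpoly_rec k a) \<theta>)"
      using assms(1) unfolding regular_seq_def by blast
    then show ?thesis
    proof cases
      case 1
      from seq_op_dichotomy_infinite[OF sm this] show ?thesis .
    next
      case 2
      from seq_op_dichotomy_finite[OF sm 2(1,2)] 2(3) show ?thesis by blast
    qed
  qed
qed (use assms regular_seq_growth in \<open>auto simp: regular_seq_def\<close>)

context sparse_sequence
begin

section \<open>Positions and shifts\<close>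

text \<open>One more than the index of the largest member that is at most the argument, or \<open>0\<close> if there is none.\<close>

definition cnt :: "int \<Rightarrow> nat" where
  "cnt x = card {n. int (r n) \<le> x}"

text \<open>
  Indices that would be negative are truncated to \<open>0\<close>. In particular \<open>shift 0\<close> sends everything
  below \<open>r 0\<close> to \<open>r 0\<close>.
\<close>

definition shift :: "int \<Rightarrow> int \<Rightarrow> int" where
  "shift j x = int (r (nat (int (cnt x) - 1 + j)))"

lemma le_iff: "r m \<le> r n \<longleftrightarrow> m \<le> n"
  by (rule strict_mono_less_eq[OF mono])

lemma less_iff: "r m < r n \<longleftrightarrow> m < n"
  by (rule strict_mono_less[OF mono])

lemma less_cnt_iff: "n < cnt x \<longleftrightarrow> int (r n) \<le> x"
proof -
  define m where "m = (LEAST n. x < int (r n))"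
  have "x < int (r (nat x + 1))" using seq_suble[OF mono, of "nat x + 1"] by linarith
  then have m: "x < int (r m)" unfolding m_def by (rule LeastI)
  have "n < m \<longleftrightarrow> int (r n) \<le> x" for n
  proof
    assume "n < m" then show "int (r n) \<le> x" unfolding m_def using not_less_Least by fastforce
  next
    assume "int (r n) \<le> x" then have "r n < r m" using m by linarith
    then show "n < m" by (simp add: less_iff)
  qed
  then have "{n. int (r n) \<le> x} = {..<m}" by auto
  then have "cnt x = m" by (simp add: cnt_def)
  then show ?thesis using \<open>n < m \<longleftrightarrow> _\<close> by simp
qed

lemma cnt_le_iff: "cnt x \<le> n \<longleftrightarrow> x < int (r n)"
  using less_cnt_iff[of n x] by linarith

lemma cnt_eqI: "int (r m) \<le> x \<Longrightarrow> x < int (r (Suc m)) \<Longrightarrow> cnt x = Suc m"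
  using less_cnt_iff[of m x] cnt_le_iff[of x "Suc m"] by linarith

lemma cnt_r [simp]: "cnt (int (r m)) = Suc m"
  by (rule cnt_eqI) (auto simp: less_iff)

lemma shift_r [simp]: "shift j (int (r m)) = int (r (nat (int m + j)))"
  by (simp add: shift_def)

lemma shift_below: "x < int (r 0) \<Longrightarrow> shift j x = int (r (nat (j - 1)))"
  using cnt_le_iff[of x 0] by (simp add: shift_def algebra_simps)

lemma cnt_mono: "x \<le> y \<Longrightarrow> cnt x \<le> cnt y"
  using cnt_le_iff[of x "cnt y"] cnt_le_iff[of y "cnt y"] by linarith

lemma in_range_iff_shift: "x \<in> int ` range r \<longleftrightarrow> shift 0 x = x"
proof
  assume "shift 0 x = x"
  then have "x = int (r (nat (int (cnt x) - 1)))" by (simp add: shift_def)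
  then show "x \<in> int ` range r" by blast
qed auto

lemma growth_int: "\<exists>k. \<forall>n. C * int (r n) \<le> int (r (n + k))"
proof -
  from growth[of "nat C"] obtain k where k: "\<And>n. nat C * r n \<le> r (n + k)" by blast
  have "C * int (r n) \<le> int (r (n + k))" for n
  proof -
    have "C * int (r n) \<le> int (nat C) * int (r n)" by (intro mult_right_mono) auto
    also have "\<dots> \<le> int (r (n + k))" using k[of n] by (metis of_nat_le_iff of_nat_mult)
    finally show ?thesis .
  qed
  then show ?thesis by blast
qed

text \<open>
  Sparseness in terms of positions. This form also covers infinite ratios, for which an integer and
  the largest member up to it need not be comparable up to a constant factor.
\<close>

lemma cnt_mult_le: "\<exists>k. \<forall>x\<ge>0. cnt (C * x) \<le> cnt x + k"
proof (cases "C \<ge> 1")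
  case True
  from growth_int obtain k where k: "\<And>n. C * int (r n) \<le> int (r (n + k))" by blast
  have "cnt (C * x) \<le> cnt x + k" if "x \<ge> 0" for x
  proof -
    have "x < int (r (cnt x))" by (simp flip: cnt_le_iff)
    then have "C * x < C * int (r (cnt x))" using True by simp
    with k[of "cnt x"] show ?thesis by (simp add: cnt_le_iff)
  qed
  then show ?thesis by blast
next
  case False
  have "cnt (C * x) \<le> cnt x + 0" if "x \<ge> 0" for x
  proof -
    have "C * x \<le> 1 * x" using that False by (intro mult_right_mono) auto
    then show ?thesis using cnt_mono by simp
  qed
  then show ?thesis by blast
qed

text \<open>
  Here \<open>i\<close> is a reference index: if the position of \<open>x\<close> relative to \<open>i\<close> is known, all shifts of \<open>x\<close> are
  known relative to \<open>i\<close>.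
\<close>

lemma shift_eq:
  assumes "int (r (nat (i + (l - 1)))) \<le> x \<and> x < int (r (nat (i + l)))"
  shows "int (r (nat (i + (l - 1 + j)))) = shift j x"
proof -
  from assms have "r (nat (i + (l - 1))) < r (nat (i + l))" by linarith
  then have "nat (i + l) = Suc (nat (i + (l - 1)))" and pos: "i + l \<ge> 1" by (auto simp: less_iff)
  with assms have "cnt x = Suc (nat (i + (l - 1)))" by (intro cnt_eqI) auto
  with pos show ?thesis by (simp add: shift_def algebra_simps)
qed

text \<open>
  Combinations with displacements of either sign, as lists of pairs of a coefficient and a
  displacement. There are countably many such lists, and appending them adds the combinations.
\<close>

definition list_op :: "(int \<times> int) list \<Rightarrow> nat \<Rightarrow> int" where
  "list_op ws m = (\<Sum>(c, j)\<leftarrow>ws. c * int (r (nat (int m + j))))"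

lemma list_op_Nil [simp]: "list_op [] m = 0"
  and list_op_Cons [simp]: "list_op ((c, j) # ws) m = c * int (r (nat (int m + j))) + list_op ws m"
  and list_op_append: "list_op (ws @ ws') m = list_op ws m + list_op ws' m"
  by (simp_all add: list_op_def)

lemma list_op_scale: "list_op (map (\<lambda>(c, j). (k * c, j)) ws) m = k * list_op ws m"
  by (induction ws) (auto simp: algebra_simps)

text \<open>Seen from \<open>J\<close> places further down, all displacements are nonnegative.\<close>

lemma list_op_seq_op:
  assumes "\<forall>(c, j)\<in>set ws. \<bar>j\<bar> \<le> int J"
  shows "\<exists>z. \<forall>m\<ge>J. list_op ws m = seq_op r (2 * J + 1) z (m - J)"
  using assms
proof (induction ws)
  case Nil
  show ?case by (rule exI[of _ "\<lambda>_. 0"]) (simp add: seq_op_def)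
next
  case (Cons w ws)
  obtain c j where w: "w = (c, j)" by fastforce
  from Cons obtain z where z: "\<And>m. m \<ge> J \<Longrightarrow> list_op ws m = seq_op r (2 * J + 1) z (m - J)" by auto
  from Cons.prems w have j: "\<bar>j\<bar> \<le> int J" by auto
  define i where "i = nat (int J + j)"
  have i: "i < 2 * J + 1" "int i = int J + j" using j by (auto simp: i_def)
  define z' where "z' = (\<lambda>k. z k + (if k = i then c else 0))"
  have "list_op (w # ws) m = seq_op r (2 * J + 1) z' (m - J)" if m: "m \<ge> J" for m
  proof -
    have "nat (int m + j) = m - J + i" using i(2) m by auto
    moreover have "seq_op r (2 * J + 1) z' (m - J) = seq_op r (2 * J + 1) z (m - J) + 
        (\<Sum>k<2 * J + 1. (if k = i then c else 0) * int (r (m - J + k)))"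
      by (simp add: seq_op_def z'_def algebra_simps sum.distrib)
    moreover have "(\<Sum>k<2 * J + 1. (if k = i then c else 0) * int (r (m - J + k)))
       = (\<Sum>k<2 * J + 1. if k = i then c * int (r (m - J + i)) else 0)"
      by (rule sum.cong) auto
    moreover have "\<dots> = c * int (r (m - J + i))" using i(1) by (subst sum.delta) auto
    ultimately show ?thesis by (simp add: w z m)
  qed
  then show ?case by blast
qed

lemma list_op_upper: "\<exists>k. \<forall>m\<ge>k. \<bar>list_op ws m\<bar> \<le> int (r (m + k))"
proof (induction ws)
  case Nil
  show ?case by auto
next
  case (Cons w ws)
  obtain c j where w: "w = (c, j)" by fastforce
  from Cons obtain k where k: "\<And>m. m \<ge> k \<Longrightarrow> \<bar>list_op ws m\<bar> \<le> int (r (m + k))" by blast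
  obtain k' where k': "\<And>n. (\<bar>c\<bar> + 1) * int (r n) \<le> int (r (n + k'))" using growth_int by blast
  define K where "K = max k (nat \<bar>j\<bar>)"
  have "\<bar>list_op (w # ws) m\<bar> \<le> int (r (m + (K + k')))" if "m \<ge> K + k'" for m
  proof -
    have "\<bar>list_op (w # ws) m\<bar> \<le> \<bar>c\<bar> * int (r (nat (int m + j))) + \<bar>list_op ws m\<bar>"
      by (simp add: w order_trans[OF abs_triangle_ineq] abs_mult)
    also have "\<dots> \<le> \<bar>c\<bar> * int (r (m + K)) + int (r (m + K))"
    proof (intro add_mono mult_left_mono)
      show "\<bar>list_op ws m\<bar> \<le> int (r (m + K))"
        using that by (intro order_trans[OF k[of m]]) (auto simp: K_def le_iff)
    qed (auto simp: le_iff K_def)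
    also have "\<dots> \<le> int (r (m + K + k'))" using k'[of "m+K"] by (simp add: algebra_simps)
    finally show ?thesis by (simp add: add.assoc)
  qed
  then show ?case by blast
qed

text \<open>
  The dichotomy in terms of positions: by the growth of the sequence the constant factors are
  absorbed into the displacement \<open>k\<close>.
\<close>

lemma list_op_size:
  "\<exists>s\<in>{-1,0,1}. \<exists>k. \<forall>m\<ge>k. 
     if s = 0 then list_op ws m = 0
     else int (r (m - k)) \<le> s * list_op ws m \<and> s * list_op ws m \<le> int (r (m + k))"
proof -
  define J where "J = nat (\<Sum>(c, j)\<leftarrow>ws. \<bar>j\<bar>)"
  have "\<bar>j\<bar> \<le> (\<Sum>(c, j)\<leftarrow>ws. \<bar>j\<bar>)" if "(c, j) \<in> set ws" for c j
  proof -
    have "(\<lambda>(c, j). \<bar>j\<bar>) (c, j) \<le> sum_list (map (\<lambda>(c, j). \<bar>j\<bar>) ws)"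
      by (rule member_le_sum_list) (use that in force)+
    then show ?thesis by simp
  qed
  then have "\<forall>(c, j)\<in>set ws. \<bar>j\<bar> \<le> int J" by (force simp: J_def)
  from list_op_seq_op[OF this] obtain z where
    z: "\<And>m. m \<ge> J \<Longrightarrow> list_op ws m = seq_op r (2 * J + 1) z (m - J)" by blast
  obtain u where u: "\<And>m. m \<ge> u \<Longrightarrow> \<bar>list_op ws m\<bar> \<le> int (r (m + u))" using list_op_upper by blast
  consider (zero) "\<And>n. seq_op r (2 * J + 1) z n = 0"
    | (nz) s C n0 where "s \<in> {1,-1}" "C > 0" "\<And>n. n \<ge> n0 \<Longrightarrow> int (r n) \<le> C * (s * seq_op r (2 * J + 1) z n)"
    using dichotomy[of "2 * J + 1" z] by blast
  then show ?thesis
  proof cases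
    case zero
    then show ?thesis using z by (intro bexI[of _ 0]) auto
  next
    case nz
    obtain l where l: "\<And>n. \<bar>C\<bar> * int (r n) \<le> int (r (n + l))" using growth_int by blast
    define k where "k = J + n0 + l + u + 1"
    have "int (r (m - k)) \<le> s * list_op ws m" "s * list_op ws m \<le> int (r (m + k))" if m: "m \<ge> k" for m
    proof -
      have "int (r (m - k + l)) \<le> int (r (m - J))" using m by (simp add: le_iff k_def)
      also have "\<dots> \<le> C * (s * list_op ws m)"
        using nz(3)[of "m - J"] m z[of m] by (simp add: k_def)
      finally have low: "int (r (m - k + l)) \<le> C * (s * list_op ws m)" .
      show "int (r (m - k)) \<le> s * list_op ws m"
      proof (rule ccontr)
        assume neg: "\<not> ?thesis"
        then have "C * (s * list_op ws m) < C * int (r (m - k))" using nz(2) by simp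
        with l[of "m - k"] low nz(2) show False by simp
      qed
      show "s * list_op ws m \<le> int (r (m + k))"
      proof -
        have "s * list_op ws m \<le> \<bar>list_op ws m\<bar>" using nz(1) by auto
        also have "\<dots> \<le> int (r (m + u))" using u m by (simp add: k_def)
        also have "\<dots> \<le> int (r (m + k))" by (simp add: le_iff k_def)
        finally show ?thesis .
      qed
    qed
    with nz(1) show ?thesis by (intro bexI[of _ s] exI[of _ k]) auto
  qed
qed

end

section \<open>Free ultrafilters and saturation\<close>

locale free_ultrafilter =
  fixes U :: "nat filter"
  assumes proper: "U \<noteq> bot"
    and decides: "eventually P U \<or> eventually (\<lambda>n. \<not> P n) U"
    and free: "U \<le> sequentially"

text \<open>
  Consider a maximal family of sets all of whose finite intersections are infinite. If it contained
  neither \<open>S\<close> nor its complement, there would be finite intersections that meet \<open>S\<close> and its complement,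
  respectively, in finite sets, and their intersection would be finite. That intersections are
  infinite, rather than just nonempty, makes the filter free.
\<close>

lemma free_ultrafilter_exists: "\<exists>U. free_ultrafilter U"
proof -
  define fip :: "nat set set \<Rightarrow> bool" where "fip M \<longleftrightarrow> (\<forall>F\<subseteq>M. finite F \<longrightarrow> infinite (\<Inter>F))" for M
  have "\<exists>M\<in>Collect fip. \<forall>X\<in>Collect fip. M \<subseteq> X \<longrightarrow> X = M"
  proof (rule subset_Zorn')
    fix C assume C: "subset.chain (Collect fip) C"
    have "infinite (\<Inter>F)" if F: "F \<subseteq> \<Union>C" "finite F" for F
    proof (cases "F = {}")
      case False
      with F(1) have "C \<noteq> {}" by auto
      from finite_subset_Union_chain[OF F(2,1) this C] obtain X where "X \<in> C" "F \<subseteq> X" by blast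
      with C F(2) show ?thesis by (auto simp: subset.chain_def fip_def)
    qed simp
    then show "\<Union>C \<in> Collect fip" by (simp add: fip_def)
  qed
  then obtain M where M: "fip M" and max: "\<And>X. fip X \<Longrightarrow> M \<subseteq> X \<Longrightarrow> X = M" by auto
  have fin: "\<exists>F\<subseteq>M. finite F \<and> finite (\<Inter>F \<inter> S)" if "S \<notin> M" for S
  proof -
    have "\<not> fip (insert S M)" using max[of "insert S M"] that by auto
    then obtain F where F: "F \<subseteq> insert S M" "finite F" "finite (\<Inter>F)" by (auto simp: fip_def)
    have "\<Inter>(F - {S}) \<inter> S \<subseteq> \<Inter>F" by auto
    with F(3) have "finite (\<Inter>(F - {S}) \<inter> S)" by (rule finite_subset[rotated])
    with F show ?thesis by (intro exI[of _ "F - {S}"]) auto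
  qed
  have dec: "S \<in> M \<or> - S \<in> M" for S
  proof (rule ccontr)
    assume "\<not> ?thesis"
    with fin[of S] fin[of "- S"] obtain F F' where
      "F \<subseteq> M" "finite F" "finite (\<Inter>F \<inter> S)" "F' \<subseteq> M" "finite F'" "finite (\<Inter>F' \<inter> - S)" by blast
    moreover have "\<Inter>(F \<union> F') \<subseteq> (\<Inter>F \<inter> S) \<union> (\<Inter>F' \<inter> - S)" by auto
    ultimately have "finite (\<Inter>(F \<union> F'))" by (meson finite_UnI finite_subset)
    moreover have "infinite (\<Inter>(F \<union> F'))"
      using M \<open>F \<subseteq> M\<close> \<open>F' \<subseteq> M\<close> \<open>finite F\<close> \<open>finite F'\<close> unfolding fip_def by (metis Un_least finite_UnI)
    ultimately show False by simp
  qed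
  define U where "U = (INF S\<in>M. principal S)"
  have ev: "eventually (\<lambda>n. n \<in> S) U" if "S \<in> M" for S
    using that by (auto simp: U_def intro: eventually_INF1 simp: eventually_principal)
  have "free_ultrafilter U"
  proof
    show "U \<noteq> bot"
    proof
      assume "U = bot"
      then have "eventually (\<lambda>_. False) U" by simp
      then obtain F where F: "F \<subseteq> M" "finite F" "eventually (\<lambda>_. False) (INF S\<in>F. principal S)"
        unfolding U_def eventually_INF[of _ _ M] by blast
      then have "\<Inter>F = {}"
        by (simp add: INF_principal_finite eventually_principal) blast
      with M F show False unfolding fip_def by (metis finite.emptyI)
    qed
    show "eventually P U \<or> eventually (\<lambda>n. \<not> P n) U" for P
      using dec[of "Collect P"] ev[of "Collect P"] ev[of "- Collect P"] by auto
    have "{n..} \<in> M" for n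
    proof (rule ccontr)
      assume "{n..} \<notin> M"
      with dec[of "{n..}"] have "{..<n} \<in> M" by (simp add: Compl_atLeast)
      with M have "infinite (\<Inter>{{..<n}})" unfolding fip_def by blast
      then show False by simp
    qed
    from ev[OF this] show "U \<le> sequentially" by (simp add: le_sequentially)
  qed
  then show ?thesis by blast
qed

context free_ultrafilter
begin

lemma ev_not: "eventually (\<lambda>n. \<not> P n) U \<longleftrightarrow> \<not> eventually P U"
proof
  assume "eventually (\<lambda>n. \<not> P n) U"
  show "\<not> eventually P U"
  proof
    assume "eventually P U"
    with \<open>eventually (\<lambda>n. \<not> P n) U\<close> have "eventually (\<lambda>n. False) U" by eventually_elim simp
    with proper show False by (simp add: trivial_limit_def)
  qed
qed (use decides[of P] in blast)

lemma ev_pigeonhole: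
  assumes "finite S" "eventually (\<lambda>n. f n \<in> S) U"
  shows "\<exists>c\<in>S. eventually (\<lambda>n. f n = c) U"
proof (rule ccontr)
  assume "\<not> ?thesis"
  then have "\<forall>c\<in>S. eventually (\<lambda>n. f n \<noteq> c) U" by (simp add: ev_not)
  with assms(1) have "eventually (\<lambda>n. \<forall>c\<in>S. f n \<noteq> c) U" by (rule eventually_ball_finite)
  with assms(2) have "eventually (\<lambda>n. False) U" by eventually_elim auto
  with proper show False by (simp add: trivial_limit_def)
qed

lemma ev_cong: "eventually (\<lambda>n. P n \<longleftrightarrow> Q n) U \<Longrightarrow> eventually P U \<longleftrightarrow> eventually Q U"
  by (auto elim: eventually_elim2)

text \<open>
  At coordinate \<open>n\<close> take the solution for the longest initial segment of conditions, of length at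
  most \<open>n\<close>, that is met there by its solution. Freeness makes these lengths exceed any bound.
\<close>

lemma saturation_nat:
  fixes P :: "nat \<Rightarrow> nat \<Rightarrow> 'b \<Rightarrow> bool"
  assumes "\<And>k. \<exists>y. eventually (\<lambda>n. \<forall>j\<le>k. P j n (y n)) U"
  shows "\<exists>y. \<forall>k. eventually (\<lambda>n. P k n (y n)) U"
proof -
  obtain Y where Y: "\<And>k. eventually (\<lambda>n. \<forall>j\<le>k. P j n (Y k n)) U" using assms by metis
  define good where "good n = {k. k \<le> n \<and> (\<forall>j\<le>k. P j n (Y k n))}" for n
  have fin: "finite (good n)" for n by (rule finite_subset[of _ "{..n}"]) (auto simp: good_def)
  define y where "y n = Y (Max (good n)) n" for n
  have "eventually (\<lambda>n. P k n (y n)) U" for k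
  proof -
    have "eventually (\<lambda>n. k \<le> n) U" using free by (simp add: le_sequentially)
    with Y[of k] show ?thesis
    proof eventually_elim
      case (elim n)
      then have k: "k \<in> good n" by (auto simp: good_def)
      then have "Max (good n) \<in> good n" "k \<le> Max (good n)" using fin[of n] by (auto intro: Max_in)
      then show ?case by (auto simp: good_def y_def)
    qed
  qed
  then show ?thesis by blast
qed

lemma saturation:
  fixes P :: "'c \<Rightarrow> nat \<Rightarrow> 'b \<Rightarrow> bool"
  assumes "countable C"
    and fin: "\<And>F. F \<subseteq> C \<Longrightarrow> finite F \<Longrightarrow> \<exists>y. eventually (\<lambda>n. \<forall>p\<in>F. P p n (y n)) U"
  shows "\<exists>y. \<forall>p\<in>C. eventually (\<lambda>n. P p n (y n)) U"
proof (cases "C = {}")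
  case False
  define p where "p = from_nat_into C"
  have ran: "range p = C" using False assms(1) by (simp add: p_def range_from_nat_into)
  have "\<exists>y. eventually (\<lambda>n. \<forall>j\<le>k. P (p j) n (y n)) U" for k
  proof -
    obtain y where "eventually (\<lambda>n. \<forall>q\<in>p ` {..k}. P q n (y n)) U"
      using fin[of "p ` {..k}"] ran by blast
    then show ?thesis by (intro exI[of _ y]) (auto elim: eventually_mono)
  qed
  from saturation_nat[of "\<lambda>j. P (p j)", OF this] ran show ?thesis by blast
qed simp

end

section \<open>Partial isomorphisms of the ultrapower\<close>

text \<open>
  In a gap longer than \<open>N * M\<close> there is a multiple \<open>N * d\<close> with \<open>d\<close> in a prescribed residue class
  modulo \<open>M\<close>. This is what makes finitely many conditions on a cut and on residues solvable.
\<close>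

lemma int_between:
  fixes L H :: "int set"
  assumes fin: "finite L" "finite H" and N: "N > 0" and M: "M > 0"
    and gap: "\<And>l h. l \<in> L \<Longrightarrow> h \<in> H \<Longrightarrow> l + N * M < h"
  shows "\<exists>d. M dvd d - c \<and> (\<forall>l\<in>L. l < N * d) \<and> (\<forall>h\<in>H. N * d < h)"
proof -
  have mod: "0 \<le> x mod M" "x mod M \<le> M - 1" for x using M by simp_all
  consider "L \<noteq> {}" | "L = {}" "H \<noteq> {}" | "L = {}" "H = {}" by blast
  then show ?thesis
  proof cases
    case 1
    define l where "l = Max L"
    have l: "l \<in> L" "\<And>l'. l' \<in> L \<Longrightarrow> l' \<le> l" using 1 fin by (auto simp: l_def)
    define t where "t = l div N + 1"
    have "N * (l div N) + l mod N = l" by simp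
    then have "N * t = l - l mod N + N" by (simp add: t_def algebra_simps)
    moreover have "0 \<le> l mod N" "l mod N < N" using N by simp_all
    ultimately have t: "l < N * t" "N * t \<le> l + N" by linarith+
    define d where "d = t + (c - t) mod M"
    have "M dvd d - c"
      by (simp add: d_def mod_eq_dvd_iff[symmetric] mod_simps)
    moreover have "N * t \<le> N * d" using N mod[of "c - t"] by (simp add: d_def)
    moreover have "N * d \<le> N * (t + (M - 1))" using N mod[of "c - t"] by (simp add: d_def)
    then have "N * d \<le> l + N * M" using t by (simp add: algebra_simps)
    ultimately show ?thesis using l(2) t(1) gap[OF l(1)]
      by (intro exI[of _ d]) (meson le_less_trans less_le_trans)
  next
    case 2
    define h where "h = Min H"
    have h: "h \<in> H" "\<And>h'. h' \<in> H \<Longrightarrow> h \<le> h'" using 2 fin by (auto simp: h_def)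
    define t where "t = (h - 1) div N"
    have "N * t + (h - 1) mod N = h - 1" by (simp add: t_def)
    moreover have "0 \<le> (h - 1) mod N" using N by simp
    ultimately have t: "N * t < h" by linarith
    define d where "d = t - (t - c) mod M"
    have "M dvd d - c"
      by (simp add: d_def mod_eq_dvd_iff[symmetric] mod_simps)
    moreover have "N * d \<le> N * t" using N mod[of "t - c"] by (simp add: d_def)
    ultimately show ?thesis using h(2) t 2(1)
      by (intro exI[of _ d]) (metis empty_iff le_less_trans less_le_trans)
  qed (auto intro: exI[of _ c])
qed

locale ultrapower = sparse_sequence r + free_ultrafilter U for r U
begin

definition equ :: "(nat \<Rightarrow> int) \<Rightarrow> (nat \<Rightarrow> int) \<Rightarrow> bool" where
  "equ x y \<longleftrightarrow> eventually (\<lambda>n. x n = y n) U"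

lemma equ_refl [simp]: "equ x x"
  and equ_sym: "equ x y \<Longrightarrow> equ y x"
  and equ_trans: "equ x y \<Longrightarrow> equ y z \<Longrightarrow> equ x z"
  by (auto simp: equ_def elim: eventually_mono eventually_elim2)

end

text \<open>
  Sequences stand for their classes modulo \<open>equ\<close>. The relation \<open>H\<close> is the graph of a map between two
  subgroups of the ultrapower that contain the integers; the map preserves signs and residues.
\<close>

locale pre_iso = ultrapower r U for r U +
  fixes H :: "((nat \<Rightarrow> int) \<times> (nat \<Rightarrow> int)) set"
  assumes resp: "(x, y) \<in> H \<Longrightarrow> equ x x' \<Longrightarrow> equ y y' \<Longrightarrow> (x', y') \<in> H"
    and add: "(x, y) \<in> H \<Longrightarrow> (x', y') \<in> H \<Longrightarrow> (\<lambda>n. x n + x' n, \<lambda>n. y n + y' n) \<in> H"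
    and scale: "(x, y) \<in> H \<Longrightarrow> (\<lambda>n. k * x n, \<lambda>n. k * y n) \<in> H"
    and const: "(\<lambda>_. k, \<lambda>_. k) \<in> H"
    and pos: "(x, y) \<in> H \<Longrightarrow> (\<forall>\<^sub>F n in U. 0 < x n) \<longleftrightarrow> (\<forall>\<^sub>F n in U. 0 < y n)"
    and cong: "(x, y) \<in> H \<Longrightarrow> m > 0 \<Longrightarrow> \<forall>\<^sub>F n in U. m dvd x n - y n"
begin

lemma sub: "(x, y) \<in> H \<Longrightarrow> (x', y') \<in> H \<Longrightarrow> (\<lambda>n. x n - x' n, \<lambda>n. y n - y' n) \<in> H"
  using add[of x y "\<lambda>n. -1 * x' n" "\<lambda>n. -1 * y' n"] scale[of x' y' "-1"] by simp

lemma less_transfer: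
  assumes "(x, y) \<in> H" "(x', y') \<in> H"
  shows "(\<forall>\<^sub>F n in U. x n < x' n) \<longleftrightarrow> (\<forall>\<^sub>F n in U. y n < y' n)"
  using pos[OF sub[OF assms(2,1)]] by simp

lemma le_transfer:
  assumes "(x, y) \<in> H" "(x', y') \<in> H"
  shows "(\<forall>\<^sub>F n in U. x n \<le> x' n) \<longleftrightarrow> (\<forall>\<^sub>F n in U. y n \<le> y' n)"
  using less_transfer[OF assms(2,1)] ev_not[of "\<lambda>n. x' n < x n"] ev_not[of "\<lambda>n. y' n < y n"]
  by (simp add: not_less)

lemma equ_transfer:
  assumes "(x, y) \<in> H" "(x', y') \<in> H"
  shows "equ x x' \<longleftrightarrow> equ y y'"
  using le_transfer[OF assms] le_transfer[OF assms(2,1)]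
  by (simp add: equ_def order_eq_iff eventually_conj_iff)

text \<open>
  If the position of \<open>u\<close> is within a bounded distance of \<open>i\<close>, its distance from \<open>i\<close> is constant, by
  the pigeonhole principle for ultrafilters. That \<open>u\<close> lies between two particular members is a
  statement about signs, which \<open>H\<close> preserves.
\<close>

lemma shift_mem:
  assumes uv: "(u, v) \<in> H"
    and i: "\<And>l. (\<lambda>n. int (r (nat (int (i n) + l))), \<lambda>n. int (r (nat (int (i' n) + l)))) \<in> H"
    and close: "\<forall>\<^sub>F n in U. \<bar>int (cnt (u n)) - int (i n)\<bar> \<le> K"
  shows "(\<lambda>n. shift j (u n), \<lambda>n. shift j (v n)) \<in> H"
proof (cases "\<forall>\<^sub>F n in U. u n < int (r 0)")
  case True
  then have "\<forall>\<^sub>F n in U. v n < int (r 0)" using less_transfer[OF uv const] by simp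
  then have "equ (\<lambda>_. int (r (nat (j - 1)))) (\<lambda>n. shift j (v n))"
    unfolding equ_def by eventually_elim (simp add: shift_below)
  moreover from True have "equ (\<lambda>_. int (r (nat (j - 1)))) (\<lambda>n. shift j (u n))"
    unfolding equ_def by eventually_elim (simp add: shift_below)
  ultimately show ?thesis using resp[OF const] by blast
next
  case False
  have "\<forall>\<^sub>F n in U. int (cnt (u n)) - int (i n) \<in> {-K..K}"
    using close by eventually_elim auto
  from ev_pigeonhole[OF _ this] obtain l where
    l: "\<forall>\<^sub>F n in U. int (cnt (u n)) - int (i n) = l" by auto
  have "\<forall>\<^sub>F n in U. int (r 0) \<le> u n"
    using False unfolding ev_not[symmetric] by (simp add: not_less)
  with l have *: "\<forall>\<^sub>F n in U. int (r (nat (int (i n) + (l - 1)))) \<le> u n \<and> u n < int (r (nat (int (i n) + l)))"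
  proof eventually_elim
    case (elim n)
    then have "cnt (u n) > 0" by (simp add: less_cnt_iff)
    moreover have "nat (int (i n) + l) = cnt (u n)" "nat (int (i n) + (l - 1)) = cnt (u n) - 1"
      using elim by auto
    ultimately show ?case by (simp flip: cnt_le_iff less_cnt_iff)
  qed
  then have **: "\<forall>\<^sub>F n in U. int (r (nat (int (i' n) + (l - 1)))) \<le> v n \<and> v n < int (r (nat (int (i' n) + l)))"
    using le_transfer[OF i uv, of "l - 1"] less_transfer[OF uv i, of l] by (simp add: eventually_conj_iff)
  have "equ (\<lambda>n. int (r (nat (int (i n) + (l - 1 + j))))) (\<lambda>n. shift j (u n))"
    using * unfolding equ_def
    by eventually_elim (rule shift_eq)
  moreover have "equ (\<lambda>n. int (r (nat (int (i' n) + (l - 1 + j))))) (\<lambda>n. shift j (v n))"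
    using ** unfolding equ_def
    by eventually_elim (rule shift_eq)
  ultimately show ?thesis using resp[OF i] by blast
qed

end

text \<open>Countable generation leaves countably many conditions on the image of a new element.\<close>

locale partial_iso = pre_iso r U H for r U H +
  assumes shift_closed: "(x, y) \<in> H \<Longrightarrow> (\<lambda>n. shift j (x n), \<lambda>n. shift j (y n)) \<in> H"
    and generated: "\<exists>G. countable G \<and> G \<subseteq> H \<and> (\<forall>x y. (x, y) \<in> H \<longrightarrow> (\<exists>x' y'. (x', y') \<in> G \<and> equ x x' \<and> equ y y'))"

context sparse_sequence
begin

section \<open>Adjoining a member of the sequence\<close>

text \<open>A sufficient distance of positions beats any constant factor and any displacement.\<close>

lemma position_below: "\<exists>k. \<forall>x\<ge>0. \<forall>m. cnt x + k < m \<longrightarrow> K * x < int (r (m - L))"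
proof -
  obtain k where k: "\<And>n. (\<bar>K\<bar> + 1) * int (r n) \<le> int (r (n + k))" using growth_int by blast
  have "K * x < int (r (m - L))" if x: "x \<ge> 0" and m: "cnt x + (k + L) < m" for x m
  proof -
    have lt: "x < int (r (cnt x))" by (simp flip: cnt_le_iff)
    have "K * x \<le> \<bar>K\<bar> * x" using x by (intro mult_right_mono) auto
    also have "\<dots> \<le> \<bar>K\<bar> * int (r (cnt x))" using lt by (intro mult_left_mono) auto
    also have "\<dots> < (\<bar>K\<bar> + 1) * int (r (cnt x))" using lt x by (simp add: algebra_simps)
    also have "\<dots> \<le> int (r (cnt x + k))" by (rule k)
    also have "\<dots> \<le> int (r (m - L))" using m by (simp add: le_iff)
    finally show ?thesis .
  qed
  then show ?thesis by blast
qed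

lemma position_above: "\<exists>k. \<forall>x m. m + k < cnt x \<longrightarrow> K * int (r (m + L)) < x"
proof -
  obtain k where k: "\<And>n. K * int (r n) \<le> int (r (n + k))" using growth_int by blast
  have "K * int (r (m + L)) < x" if "m + (L + k + 1) < cnt x" for x m
  proof -
    have "K * int (r (m + L)) \<le> int (r (m + L + k))" by (rule k)
    also have "\<dots> < int (r (m + (L + k + 1)))" by (simp add: less_iff)
    also have "\<dots> \<le> x" using that by (simp flip: less_cnt_iff)
    finally show ?thesis .
  qed
  then show ?thesis by blast
qed

lemma periodic_cong:
  assumes "m > 0"
  shows "\<exists>p>0. \<exists>N. \<forall>a\<ge>N. \<forall>b\<ge>N. int p dvd int a - int b \<longrightarrow> int m dvd int (r a) - int (r b)"
proof (cases "m = 1")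
  case False
  with assms have "m > 1" by simp
  with periodic obtain p N where p: "p > 0" "\<And>n. n \<ge> N \<Longrightarrow> r (n + p) mod m = r n mod m"
    unfolding congruence_periodic_def by blast
  have step: "r (n + t * p) mod m = r n mod m" if "n \<ge> N" for n t
  proof (induction t)
    case (Suc t)
    have "r (n + t * p + p) mod m = r (n + t * p) mod m" using that by (intro p(2)) auto
    then show ?case using Suc by (simp add: algebra_simps)
  qed simp
  have *: "r a mod m = r b mod m" if "a \<ge> N" "a \<le> b" "int p dvd int b - int a" for a b
  proof -
    from that have "p dvd b - a" by (metis int_dvd_int_iff of_nat_diff)
    then obtain t where "b - a = t * p" by (metis dvdE mult.commute)
    then show ?thesis using step[OF that(1), of t] that(2) by (metis le_add_diff_inverse)
  qed
  have "int m dvd int (r a) - int (r b)" if "a \<ge> N" "b \<ge> N" "int p dvd int a - int b" for a b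
  proof -
    have "r a mod m = r b mod m"
      using *[of a b] *[of b a] that by (metis dvd_diff_commute nle_le)
    then show ?thesis by (metis mod_eq_dvd_iff of_nat_mod)
  qed
  then show ?thesis using p(1) by blast
qed (auto intro: exI[of _ 1])

end

text \<open>
  The index \<open>\<nu>\<close> is infinitely far from the positions of all old elements, and \<open>\<mu>\<close> has the same cut
  among the images and the same residues.
\<close>

locale generic_position = partial_iso r U H for r U H +
  fixes \<nu> \<mu> :: "nat \<Rightarrow> nat"
  assumes far: "(x, y) \<in> H \<Longrightarrow>
        (\<forall>k. \<forall>\<^sub>F n in U. cnt (x n) + k < \<nu> n \<and> cnt (y n) + k < \<mu> n) \<or>
        (\<forall>k. \<forall>\<^sub>F n in U. \<nu> n + k < cnt (x n) \<and> \<mu> n + k < cnt (y n))"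
    and residues: "m > 0 \<Longrightarrow> \<forall>\<^sub>F n in U. int m dvd int (\<nu> n) - int (\<mu> n)"
begin

lemma infinite_position: "\<forall>\<^sub>F n in U. k \<le> \<nu> n \<and> k \<le> \<mu> n"
proof -
  have "cnt (-1) = 0" using less_cnt_iff[of 0 "-1"] by simp
  with far[OF const[of "-1"]] have "\<forall>k. \<forall>\<^sub>F n in U. k < \<nu> n \<and> k < \<mu> n"
    using proper by simp
  from this[rule_format, of k] show ?thesis by eventually_elim auto
qed

lemma far_abs:
  assumes "(x, y) \<in> H"
  shows "(\<forall>K L. \<forall>\<^sub>F n in U. K * \<bar>x n\<bar> < int (r (\<nu> n - L)) \<and> K * \<bar>y n\<bar> < int (r (\<mu> n - L))) \<or>
         (\<forall>K L. \<forall>\<^sub>F n in U. K * int (r (\<nu> n + L)) < \<bar>x n\<bar> \<and> K * int (r (\<mu> n + L)) < \<bar>y n\<bar>)"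
proof -
  have "(\<lambda>n. \<bar>x n\<bar>, \<lambda>n. \<bar>y n\<bar>) \<in> H"
  proof (cases "\<forall>\<^sub>F n in U. 0 < x n")
    case True
    with pos[OF assms] have "\<forall>\<^sub>F n in U. 0 < x n" "\<forall>\<^sub>F n in U. 0 < y n" by simp_all
    then have "equ x (\<lambda>n. \<bar>x n\<bar>)" "equ y (\<lambda>n. \<bar>y n\<bar>)"
      unfolding equ_def by (eventually_elim; simp)+
    with resp[OF assms] show ?thesis by blast
  next
    case False
    with pos[OF assms] have "\<forall>\<^sub>F n in U. \<not> 0 < x n" "\<forall>\<^sub>F n in U. \<not> 0 < y n" by (simp_all add: ev_not)
    then have "equ (\<lambda>n. -1 * x n) (\<lambda>n. \<bar>x n\<bar>)" "equ (\<lambda>n. -1 * y n) (\<lambda>n. \<bar>y n\<bar>)"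
      unfolding equ_def by (eventually_elim; simp)+
    with resp[OF scale[OF assms, of "-1"]] show ?thesis by blast
  qed
  from far[OF this] show ?thesis
  proof (elim disjE)
    assume *: "\<forall>k. \<forall>\<^sub>F n in U. cnt \<bar>x n\<bar> + k < \<nu> n \<and> cnt \<bar>y n\<bar> + k < \<mu> n"
    have "\<forall>\<^sub>F n in U. K * \<bar>x n\<bar> < int (r (\<nu> n - L)) \<and> K * \<bar>y n\<bar> < int (r (\<mu> n - L))" for K L
    proof -
      obtain k where k: "\<forall>x\<ge>0. \<forall>m. cnt x + k < m \<longrightarrow> K * x < int (r (m - L))" using position_below by blast
      from *[rule_format, of k] show ?thesis by eventually_elim (use k in simp)
    qed
    then show ?thesis by blast
  next
    assume *: "\<forall>k. \<forall>\<^sub>F n in U. \<nu> n + k < cnt \<bar>x n\<bar> \<and> \<mu> n + k < cnt \<bar>y n\<bar>"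
    have "\<forall>\<^sub>F n in U. K * int (r (\<nu> n + L)) < \<bar>x n\<bar> \<and> K * int (r (\<mu> n + L)) < \<bar>y n\<bar>" for K L
    proof -
      obtain k where k: "\<forall>x m. m + k < cnt x \<longrightarrow> K * int (r (m + L)) < x" using position_above by blast
      from *[rule_format, of k] show ?thesis by eventually_elim (use k in simp)
    qed
    then show ?thesis by blast
  qed
qed

text \<open>
  The old map, extended so that it sends every shift of the member with index \<open>\<nu>\<close> to the same shift
  of the member with index \<open>\<mu>\<close>.
\<close>

definition extended :: "((nat \<Rightarrow> int) \<times> (nat \<Rightarrow> int)) set" where
  "extended = {(u, v). \<exists>x y ws. (x, y) \<in> H \<and> equ u (\<lambda>n. x n + list_op ws (\<nu> n)) \<and>
                     equ v (\<lambda>n. y n + list_op ws (\<mu> n))}"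

lemma extendedI: "(x, y) \<in> H \<Longrightarrow> equ u (\<lambda>n. x n + list_op ws (\<nu> n)) \<Longrightarrow>
     equ v (\<lambda>n. y n + list_op ws (\<mu> n)) \<Longrightarrow> (u, v) \<in> extended"
  by (auto simp: extended_def)

lemma sub_extended: "H \<subseteq> extended"
  by (auto intro!: extendedI[where ws = "[]"])

text \<open>By congruence periodicity the residues of the members depend on the residues of the indices.\<close>

lemma list_op_cong:
  assumes "m > 0"
  shows "\<forall>\<^sub>F n in U. m dvd list_op ws (\<nu> n) - list_op ws (\<mu> n)"
proof (induction ws)
  case (Cons w ws)
  obtain c j where w: "w = (c, j)" by fastforce
  obtain p N where p: "p > 0" "\<And>a b. a \<ge> N \<Longrightarrow> b \<ge> N \<Longrightarrow> int p dvd int a - int b \<Longrightarrow> m dvd int (r a) - int (r b)"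
    using periodic_cong[of "nat m"] assms by auto
  from Cons residues[OF p(1)] infinite_position[of "N + nat \<bar>j\<bar>"] show ?case
  proof eventually_elim
    case (elim n)
    then have "m dvd int (r (nat (int (\<nu> n) + j))) - int (r (nat (int (\<mu> n) + j)))"
      by (intro p(2)) auto
    then have "m dvd c * (int (r (nat (int (\<nu> n) + j))) - int (r (nat (int (\<mu> n) + j)))) +
       (list_op ws (\<nu> n) - list_op ws (\<mu> n))" using elim by (intro dvd_add dvd_mult) auto
    then show ?case by (simp add: w algebra_simps)
  qed
qed simp

text \<open>
  A nonvanishing combination stays within a bounded number of places of the new index, and the
  positions of old elements are infinitely far from it. So sign and size of the sum of an old element
  and a combination are those of one summand, and the same summand on both sides.
\<close>

lemma domination:
  assumes "(x, y) \<in> H"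
  obtains (vanishes) "\<forall>\<^sub>F n in U. list_op ws (\<nu> n) = 0 \<and> list_op ws (\<mu> n) = 0"
  | (dominates) s k where "s \<in> {-1,1}" 
      "\<forall>\<^sub>F n in U. 2 * \<bar>x n\<bar> < s * list_op ws (\<nu> n) \<and> 2 * \<bar>y n\<bar> < s * list_op ws (\<mu> n)"
      "\<forall>\<^sub>F n in U. k \<le> \<nu> n \<and> int (r (\<nu> n - k)) \<le> s * list_op ws (\<nu> n) \<and> s * list_op ws (\<nu> n) \<le> int (r (\<nu> n + k))"
  | (dominated) "\<forall>\<^sub>F n in U. 2 * \<bar>list_op ws (\<nu> n)\<bar> < \<bar>x n\<bar> \<and> 2 * \<bar>list_op ws (\<mu> n)\<bar> < \<bar>y n\<bar>"
proof -
  obtain s k where s: "s \<in> {-1,0,1}" and k: "\<And>m. m \<ge> k \<Longrightarrow>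
     if s = 0 then list_op ws m = 0
     else int (r (m - k)) \<le> s * list_op ws m \<and> s * list_op ws m \<le> int (r (m + k))"
    using list_op_size by blast
  show ?thesis
  proof (cases "s = 0")
    case True
    have "\<forall>\<^sub>F n in U. list_op ws (\<nu> n) = 0 \<and> list_op ws (\<mu> n) = 0"
      using infinite_position[of k] by eventually_elim (use k True in auto)
    then show ?thesis by (rule vanishes)
  next
    case False
    have bd: "\<forall>\<^sub>F n in U. k \<le> \<nu> n \<and> int (r (\<nu> n - k)) \<le> s * list_op ws (\<nu> n) \<and> s * list_op ws (\<nu> n) \<le> int (r (\<nu> n + k))"
      "\<forall>\<^sub>F n in U. int (r (\<mu> n - k)) \<le> s * list_op ws (\<mu> n) \<and> s * list_op ws (\<mu> n) \<le> int (r (\<mu> n + k))"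
      using infinite_position[of k] by (eventually_elim; use k False in auto)+
    from far_abs[OF assms] show ?thesis
    proof (elim disjE)
      assume *: "\<forall>K L. \<forall>\<^sub>F n in U. K * \<bar>x n\<bar> < int (r (\<nu> n - L)) \<and> K * \<bar>y n\<bar> < int (r (\<mu> n - L))"
      show ?thesis
      proof (rule dominates)
        show "s \<in> {-1,1}" using s False by auto
        show "\<forall>\<^sub>F n in U. 2 * \<bar>x n\<bar> < s * list_op ws (\<nu> n) \<and> 2 * \<bar>y n\<bar> < s * list_op ws (\<mu> n)"
          using bd *[rule_format, of 2 k] by eventually_elim linarith
      qed (rule bd)
    next
      assume *: "\<forall>K L. \<forall>\<^sub>F n in U. K * int (r (\<nu> n + L)) < \<bar>x n\<bar> \<and> K * int (r (\<mu> n + L)) < \<bar>y n\<bar>"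
      have abs: "2 * \<bar>a\<bar> < b"
        if "int (r i) \<le> s * a \<and> s * a \<le> int (r j)" "2 * int (r j) < b" for a b i j
      proof -
        have "0 \<le> s * a" using that(1) by linarith
        then have "\<bar>a\<bar> = s * a" using s False by auto
        then show ?thesis using that by linarith
      qed
      have "\<forall>\<^sub>F n in U. 2 * \<bar>list_op ws (\<nu> n)\<bar> < \<bar>x n\<bar> \<and> 2 * \<bar>list_op ws (\<mu> n)\<bar> < \<bar>y n\<bar>"
        using bd *[rule_format, of 2 k] by eventually_elim (blast intro: abs)
      then show ?thesis by (rule dominated)
    qed
  qed
qed

lemma pos_extended:
  assumes "(u, v) \<in> extended"
  shows "(\<forall>\<^sub>F n in U. 0 < u n) \<longleftrightarrow> (\<forall>\<^sub>F n in U. 0 < v n)"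
proof -
  from assms obtain x y ws where xy: "(x, y) \<in> H"
    and uv: "\<forall>\<^sub>F n in U. u n = x n + list_op ws (\<nu> n)" "\<forall>\<^sub>F n in U. v n = y n + list_op ws (\<mu> n)"
    by (auto simp: extended_def equ_def)
  from xy show ?thesis
  proof (cases rule: domination[of x y ws])
    case vanishes
    with uv have "\<forall>\<^sub>F n in U. 0 < u n \<longleftrightarrow> 0 < x n" "\<forall>\<^sub>F n in U. 0 < v n \<longleftrightarrow> 0 < y n"
      by (eventually_elim; simp)+
    from this[THEN ev_cong] pos[OF xy] show ?thesis by simp
  next
    case (dominates s k)
    from uv dominates(2) have "\<forall>\<^sub>F n in U. 0 < u n \<longleftrightarrow> s = 1" "\<forall>\<^sub>F n in U. 0 < v n \<longleftrightarrow> s = 1"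
      by (eventually_elim; use dominates(1) in auto)+
    from this[THEN ev_cong] show ?thesis by simp
  next
    case dominated
    with uv have "\<forall>\<^sub>F n in U. 0 < u n \<longleftrightarrow> 0 < x n" "\<forall>\<^sub>F n in U. 0 < v n \<longleftrightarrow> 0 < y n"
      by (eventually_elim; linarith)+
    from this[THEN ev_cong] pos[OF xy] show ?thesis by simp
  qed
qed

lemma pre_iso_extended: "pre_iso r U extended"
proof unfold_locales
  fix x y x' y' assume "(x, y) \<in> extended" "equ x x'" "equ y y'"
  then show "(x', y') \<in> extended"
    unfolding extended_def by (auto intro: equ_trans[OF equ_sym])
next
  fix u v u' v' assume "(u, v) \<in> extended" "(u', v') \<in> extended"
  then obtain x y ws x' y' ws' where *: "(x, y) \<in> H" "(x', y') \<in> H"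
    "\<forall>\<^sub>F n in U. u n = x n + list_op ws (\<nu> n)" "\<forall>\<^sub>F n in U. v n = y n + list_op ws (\<mu> n)"
    "\<forall>\<^sub>F n in U. u' n = x' n + list_op ws' (\<nu> n)" "\<forall>\<^sub>F n in U. v' n = y' n + list_op ws' (\<mu> n)"
    by (auto simp: extended_def equ_def)
  show "(\<lambda>n. u n + u' n, \<lambda>n. v n + v' n) \<in> extended"
  proof (rule extendedI[OF add[OF *(1,2)], where ws = "ws @ ws'"])
    show "equ (\<lambda>n. u n + u' n) (\<lambda>n. x n + x' n + list_op (ws @ ws') (\<nu> n))"
      unfolding equ_def using *(3,5) by eventually_elim (simp add: list_op_append)
    show "equ (\<lambda>n. v n + v' n) (\<lambda>n. y n + y' n + list_op (ws @ ws') (\<mu> n))"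
      unfolding equ_def using *(4,6) by eventually_elim (simp add: list_op_append)
  qed
next
  fix u v k assume "(u, v) \<in> extended"
  then obtain x y ws where *: "(x, y) \<in> H"
    "\<forall>\<^sub>F n in U. u n = x n + list_op ws (\<nu> n)" "\<forall>\<^sub>F n in U. v n = y n + list_op ws (\<mu> n)"
    by (auto simp: extended_def equ_def)
  show "(\<lambda>n. k * u n, \<lambda>n. k * v n) \<in> extended"
  proof (rule extendedI[OF scale[OF *(1), of k], where ws = "map (\<lambda>(c, j). (k * c, j)) ws"])
    show "equ (\<lambda>n. k * u n) (\<lambda>n. k * x n + list_op (map (\<lambda>(c, j). (k * c, j)) ws) (\<nu> n))"
      unfolding equ_def list_op_scale using *(2) by eventually_elim (simp add: algebra_simps)
    show "equ (\<lambda>n. k * v n) (\<lambda>n. k * y n + list_op (map (\<lambda>(c, j). (k * c, j)) ws) (\<mu> n))"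
      unfolding equ_def list_op_scale using *(3) by eventually_elim (simp add: algebra_simps)
  qed
next
  show "(\<lambda>_. k, \<lambda>_. k) \<in> extended" for k by (rule subsetD[OF sub_extended const])
next
  fix u v m assume "(u, v) \<in> extended" "(m :: int) > 0"
  then obtain x y ws where *: "(x, y) \<in> H"
    "\<forall>\<^sub>F n in U. u n = x n + list_op ws (\<nu> n)" "\<forall>\<^sub>F n in U. v n = y n + list_op ws (\<mu> n)"
    by (auto simp: extended_def equ_def)
  from *(2,3) cong[OF *(1) \<open>m > 0\<close>] list_op_cong[OF \<open>m > 0\<close>, of ws]
  show "\<forall>\<^sub>F n in U. m dvd u n - v n"
  proof eventually_elim
    case (elim n)
    have "m dvd (x n - y n) + (list_op ws (\<nu> n) - list_op ws (\<mu> n))" using elim by (intro dvd_add)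
    then show ?case using elim by (simp add: algebra_simps)
  qed
qed (rule pos_extended)

lemma seq_mem_extended: "(\<lambda>n. int (r (nat (int (\<nu> n) + l))), \<lambda>n. int (r (nat (int (\<mu> n) + l)))) \<in> extended"
  by (rule extendedI[OF const[of 0], where ws = "[(1, l)]"]) simp_all

lemma comparable_cnt:
  assumes "\<forall>\<^sub>F n in U. 0 < a n \<and> 0 < b n \<and> a n \<le> C * b n \<and> b n \<le> C * a n"
  shows "\<exists>K. \<forall>\<^sub>F n in U. \<bar>int (cnt (a n)) - int (cnt (b n))\<bar> \<le> K"
proof -
  obtain k where k: "\<And>x. x \<ge> 0 \<Longrightarrow> cnt (C * x) \<le> cnt x + k" using cnt_mult_le by blast
  have "\<forall>\<^sub>F n in U. \<bar>int (cnt (a n)) - int (cnt (b n))\<bar> \<le> int k"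
    using assms
  proof eventually_elim
    case (elim n)
    then have "cnt (a n) \<le> cnt (b n) + k" "cnt (b n) \<le> cnt (a n) + k"
      using k[of "a n"] k[of "b n"] cnt_mono[of "a n" "C * b n"] cnt_mono[of "b n" "C * a n"] by auto
    then show ?case by linarith
  qed
  then show ?thesis by blast
qed

text \<open>
  The position of a positive sum is within a bounded distance of that of the dominating summand, so
  \<open>shift_mem\<close> applies.
\<close>

lemma shift_extended:
  assumes "(u, v) \<in> extended"
  shows "(\<lambda>n. shift j (u n), \<lambda>n. shift j (v n)) \<in> extended"
proof -
  interpret E: pre_iso r U extended by (rule pre_iso_extended)
  from assms obtain x y ws where xy: "(x, y) \<in> H"
    and uv: "\<forall>\<^sub>F n in U. u n = x n + list_op ws (\<nu> n)" "\<forall>\<^sub>F n in U. v n = y n + list_op ws (\<mu> n)"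
    by (auto simp: extended_def equ_def)
  show ?thesis
  proof (cases "\<forall>\<^sub>F n in U. 0 < u n")
    case False
    then have "\<forall>\<^sub>F n in U. u n \<le> 0" unfolding ev_not[symmetric] by (simp add: not_less)
    then have "\<forall>\<^sub>F n in U. \<bar>int (cnt (u n)) - int 0\<bar> \<le> int (cnt 0)"
      by eventually_elim (use cnt_mono in simp)
    from E.shift_mem[OF assms _ this, of "\<lambda>_. 0"] E.const show ?thesis by simp
  next
    case up: True
    from xy show ?thesis
    proof (cases rule: domination[of x y ws])
      case vanishes
      with uv have "equ x u" "equ y v" unfolding equ_def by (eventually_elim; simp)+
      then have "equ (\<lambda>n. shift j (x n)) (\<lambda>n. shift j (u n))" "equ (\<lambda>n. shift j (y n)) (\<lambda>n. shift j (v n))"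
        unfolding equ_def by (eventually_elim; simp)+
      with resp[OF shift_closed[OF xy, of j]] sub_extended show ?thesis by blast
    next
      case (dominates s k)
      let ?a = "\<lambda>n. s * list_op ws (\<nu> n)"
      have "\<forall>\<^sub>F n in U. 0 < u n \<and> 0 < ?a n \<and> u n \<le> 2 * ?a n \<and> ?a n \<le> 2 * u n"
        using dominates(2) uv up by eventually_elim (use dominates(1) in auto)
      from comparable_cnt[OF this] obtain K where
        K: "\<forall>\<^sub>F n in U. \<bar>int (cnt (u n)) - int (cnt (?a n))\<bar> \<le> K" by blast
      have "\<forall>\<^sub>F n in U. \<bar>int (cnt (u n)) - int (\<nu> n)\<bar> \<le> K + int k + 1"
        using K dominates(3)
      proof eventually_elim
        case (elim n)
        then have "cnt (int (r (\<nu> n - k))) \<le> cnt (?a n)" "cnt (?a n) \<le> cnt (int (r (\<nu> n + k)))"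
          by (intro cnt_mono; simp)+
        with elim show ?case by simp
      qed
      from E.shift_mem[OF assms seq_mem_extended this] show ?thesis .
    next
      case dominated
      have "\<forall>\<^sub>F n in U. 0 < u n \<and> 0 < x n \<and> u n \<le> 2 * x n \<and> x n \<le> 2 * u n"
        using dominated uv up by eventually_elim linarith
      from comparable_cnt[OF this] obtain K where
        K: "\<forall>\<^sub>F n in U. \<bar>int (cnt (u n)) - int (cnt (x n))\<bar> \<le> K" by blast
      have "(\<lambda>n. int (r (nat (int (cnt (x n)) + l))), \<lambda>n. int (r (nat (int (cnt (y n)) + l)))) \<in> extended" for l
        using shift_closed[OF xy, of "l + 1"] sub_extended by (auto simp: shift_def algebra_simps)
      from E.shift_mem[OF assms this K] show ?thesis .
    qed
  qed
qed

lemma partial_iso_extended: "partial_iso r U extended"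
proof -
  interpret E: pre_iso r U extended by (rule pre_iso_extended)
  obtain G where G: "countable G" "G \<subseteq> H" "\<And>x y. (x, y) \<in> H \<Longrightarrow> \<exists>x' y'. (x', y') \<in> G \<and> equ x x' \<and> equ y y'"
    using generated by blast
  define G' where "G' = (\<lambda>((x, y), ws). (\<lambda>n. x n + list_op ws (\<nu> n), \<lambda>n. y n + list_op ws (\<mu> n))) ` (G \<times> UNIV)"
  show ?thesis
  proof unfold_locales
    show "\<exists>G. countable G \<and> G \<subseteq> extended \<and> (\<forall>x y. (x, y) \<in> extended \<longrightarrow> (\<exists>x' y'. (x', y') \<in> G \<and> equ x x' \<and> equ y y'))"
    proof (intro exI[of _ G'] conjI)
      show "countable G'" using G(1) by (auto simp: G'_def)
      show "G' \<subseteq> extended" using G(2) by (auto simp: G'_def intro!: extendedI[OF _ equ_refl equ_refl])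
      have "\<exists>x' y'. (x', y') \<in> G' \<and> equ u x' \<and> equ v y'" if "(u, v) \<in> extended" for u v
      proof -
        from that obtain x y ws where xy: "(x, y) \<in> H"
          and uv: "\<forall>\<^sub>F n in U. u n = x n + list_op ws (\<nu> n)" "\<forall>\<^sub>F n in U. v n = y n + list_op ws (\<mu> n)"
          by (auto simp: extended_def equ_def)
        from G(3)[OF xy] obtain x' y' where g: "(x', y') \<in> G" 
          "\<forall>\<^sub>F n in U. x n = x' n" "\<forall>\<^sub>F n in U. y n = y' n" by (auto simp: equ_def)
        have "equ u (\<lambda>n. x' n + list_op ws (\<nu> n))" "equ v (\<lambda>n. y' n + list_op ws (\<mu> n))"
          unfolding equ_def using uv g(2,3) by (eventually_elim; simp)+
        moreover have "(\<lambda>n. x' n + list_op ws (\<nu> n), \<lambda>n. y' n + list_op ws (\<mu> n)) \<in> G'"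
          unfolding G'_def using g(1) by (intro image_eqI[of _ _ "((x', y'), ws)"]) auto
        ultimately show ?thesis by blast
      qed
      then show "\<forall>x y. (x, y) \<in> extended \<longrightarrow> (\<exists>x' y'. (x', y') \<in> G' \<and> equ x x' \<and> equ y y')" by blast
    qed
  qed (rule shift_extended)
qed

end

context partial_iso
begin

lemma cnt_less_transfer:
  assumes "(x, y) \<in> H" "(x', y') \<in> H"
  shows "(\<forall>\<^sub>F n in U. cnt (x n) + K < cnt (x' n)) \<longleftrightarrow> (\<forall>\<^sub>F n in U. cnt (y n) + K < cnt (y' n))"
proof -
  have "cnt a + K < cnt b \<longleftrightarrow> shift (int K + 1) a \<le> b" for a b
    by (simp add: shift_def less_cnt_iff nat_add_distrib flip: of_nat_add)
  then show ?thesis using le_transfer[OF shift_closed[OF assms(1)] assms(2)] by simp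
qed

text \<open>A member within a bounded distance of an old element is a shift of it, hence old itself.\<close>

lemma new_position_far:
  assumes new: "\<And>y. (\<lambda>n. int (r (\<nu> n)), y) \<notin> H" and xy: "(x, y) \<in> H"
  shows "(\<forall>k. \<forall>\<^sub>F n in U. cnt (x n) + k < \<nu> n) \<or> (\<forall>k. \<forall>\<^sub>F n in U. \<nu> n + k < cnt (x n))"
proof -
  have far: "\<not> (\<forall>\<^sub>F n in U. \<bar>int (\<nu> n) - int (cnt (x n))\<bar> \<le> int k)" for k
  proof
    assume "\<forall>\<^sub>F n in U. \<bar>int (\<nu> n) - int (cnt (x n))\<bar> \<le> int k"
    then have "\<forall>\<^sub>F n in U. int (\<nu> n) - int (cnt (x n)) \<in> {- int k..int k}"
      by eventually_elim auto
    from ev_pigeonhole[OF _ this] obtain l where "\<forall>\<^sub>F n in U. int (\<nu> n) - int (cnt (x n)) = l" by auto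
    then have "equ (\<lambda>n. shift (l + 1) (x n)) (\<lambda>n. int (r (\<nu> n)))"
      unfolding equ_def by eventually_elim (auto simp: shift_def)
    from resp[OF shift_closed[OF xy] this equ_refl] new show False by blast
  qed
  have dec: "(\<forall>\<^sub>F n in U. cnt (x n) + k < \<nu> n) \<or> (\<forall>\<^sub>F n in U. \<nu> n + k < cnt (x n))" for k
  proof (rule ccontr)
    assume "\<not> ?thesis"
    then have "\<forall>\<^sub>F n in U. \<not> cnt (x n) + k < \<nu> n" "\<forall>\<^sub>F n in U. \<not> \<nu> n + k < cnt (x n)" by (simp_all add: ev_not)
    then have "\<forall>\<^sub>F n in U. \<bar>int (\<nu> n) - int (cnt (x n))\<bar> \<le> int k" by eventually_elim linarith
    with far show False by blast
  qed
  have excl: "\<not> ((\<forall>\<^sub>F n in U. cnt (x n) + k < \<nu> n) \<and> (\<forall>\<^sub>F n in U. \<nu> n + k' < cnt (x n)))" for k k'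
  proof
    assume "(\<forall>\<^sub>F n in U. cnt (x n) + k < \<nu> n) \<and> (\<forall>\<^sub>F n in U. \<nu> n + k' < cnt (x n))"
    then have "\<forall>\<^sub>F n in U. False" by (auto elim: eventually_elim2)
    with proper show False by simp
  qed
  show ?thesis using dec excl by blast
qed

text \<open>
  The image of a new index has to lie in a cut whose gap is infinite, because the new index itself
  lies infinitely far inside the corresponding gap. So \<open>int_between\<close> meets any finite number of the
  conditions, and saturation meets them all.
\<close>

lemma adjoin_position:
  "\<exists>H'. partial_iso r U H' \<and> H \<subseteq> H' \<and> (\<exists>y. (\<lambda>n. int (r (\<nu> n)), y) \<in> H')"
proof (cases "\<exists>y. (\<lambda>n. int (r (\<nu> n)), y) \<in> H")
  case True
  then show ?thesis using partial_iso_axioms by blast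
next
  case False
  then have new: "(\<lambda>n. int (r (\<nu> n)), y) \<notin> H" for y by blast
  define low where "low x \<longleftrightarrow> (\<forall>\<^sub>F n in U. cnt (x n) < \<nu> n)" for x
  have lowD: "low x \<Longrightarrow> \<forall>\<^sub>F n in U. cnt (x n) + k < \<nu> n" 
    and highD: "\<not> low x \<Longrightarrow> \<forall>\<^sub>F n in U. \<nu> n + k < cnt (x n)" if "(x, y) \<in> H" for x y k
  proof -
    show "\<forall>\<^sub>F n in U. cnt (x n) + k < \<nu> n" if "low x"
    proof (rule ccontr)
      assume "\<not> ?thesis"
      with new_position_far[OF new \<open>(x, y) \<in> H\<close>] have "\<forall>\<^sub>F n in U. \<nu> n + 0 < cnt (x n)" by blast
      with that have "\<forall>\<^sub>F n in U. False" unfolding low_def by eventually_elim simp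
      with proper show False by simp
    qed
    show "\<forall>\<^sub>F n in U. \<nu> n + k < cnt (x n)" if "\<not> low x"
    proof -
      have "\<not> (\<forall>k. \<forall>\<^sub>F n in U. cnt (x n) + k < \<nu> n)"
      proof
        assume "\<forall>k. \<forall>\<^sub>F n in U. cnt (x n) + k < \<nu> n"
        from this[rule_format, of 0] that show False by (simp add: low_def)
      qed
      with new_position_far[OF new \<open>(x, y) \<in> H\<close>] show ?thesis by blast
    qed
  qed
  obtain G where G: "countable G" "G \<subseteq> H" "\<And>x y. (x, y) \<in> H \<Longrightarrow> \<exists>x' y'. (x', y') \<in> G \<and> equ x x' \<and> equ y y'"
    using generated by blast
  \<comment> \<open>\<open>fact k\<close> as modulus covers all moduli, and the conditions become stronger with \<open>k\<close>\<close>
  define P where "P = (\<lambda>((x, y), k) n m. (if low x then int (cnt (y n)) + int k < m else m + int k < int (cnt (y n)))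
       \<and> fact k dvd m - int (\<nu> n))"
  have "\<exists>m. \<forall>p\<in>G \<times> UNIV. \<forall>\<^sub>F n in U. P p n (m n)"
  proof (rule saturation)
    show "countable (G \<times> (UNIV :: nat set))" using G(1) by auto
    fix F assume F: "F \<subseteq> G \<times> (UNIV :: nat set)" "finite F"
    define K where "K = Max (insert 0 (snd ` F))"
    have K: "k \<le> K" if "(g, k) \<in> F" for g k
      unfolding K_def using F(2) that by (intro Max_ge) force+
    define M :: int where "M = fact K"
    define A where "A n = (\<lambda>((x, y), k). int (cnt (y n)) + int k) ` {p\<in>F. low (fst (fst p))}" for n
    define B where "B n = (\<lambda>((x, y), k). int (cnt (y n)) - int k) ` {p\<in>F. \<not> low (fst (fst p))}" for n
    have gap1: "\<forall>\<^sub>F n in U. int (cnt (y n)) + int k + M < int (cnt (y' n)) - int k'"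
      if "((x, y), k) \<in> F" "low x" "((x', y'), k') \<in> F" "\<not> low x'" for x y k x' y' k'
    proof -
      have xy: "(x, y) \<in> H" "(x', y') \<in> H" using that F(1) G(2) by auto
      from lowD[OF xy(1) that(2), of "k + k' + nat M"] highD[OF xy(2) that(4), of 0]
      have "\<forall>\<^sub>F n in U. cnt (x n) + (k + k' + nat M) < cnt (x' n)" by eventually_elim linarith
      then have "\<forall>\<^sub>F n in U. cnt (y n) + (k + k' + nat M) < cnt (y' n)"
        using cnt_less_transfer[OF xy] by simp
      then show ?thesis by eventually_elim (simp add: M_def)
    qed
    have "\<forall>\<^sub>F n in U. \<forall>p\<in>F. \<forall>q\<in>F. low (fst (fst p)) \<longrightarrow> \<not> low (fst (fst q)) \<longrightarrow>
       int (cnt (snd (fst p) n)) + int (snd p) + M < int (cnt (snd (fst q) n)) - int (snd q)"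
      using gap1 by (intro eventually_ball_finite F(2) ballI) force
    then have gap: "\<forall>\<^sub>F n in U. \<forall>a\<in>A n. \<forall>b\<in>B n. a + 1 * M < b"
      by eventually_elim (force simp: A_def B_def)
    define good where "good n m \<longleftrightarrow> M dvd m - int (\<nu> n) \<and> (\<forall>a\<in>A n. a < 1 * m) \<and> (\<forall>b\<in>B n. 1 * m < b)" for n m
    define m where "m n = (SOME m. good n m)" for n
    have "\<forall>\<^sub>F n in U. good n (m n)"
      using gap
    proof eventually_elim
      case (elim n)
      have "\<exists>m. good n m" unfolding good_def
        by (rule int_between) (use F(2) elim in \<open>auto simp: A_def B_def M_def\<close>)
      then show ?case unfolding m_def by (rule someI_ex)
    qed
    then have "\<forall>\<^sub>F n in U. \<forall>p\<in>F. P p n (m n)"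
    proof eventually_elim
      case (elim n)
      have "P ((x, y), k) n (m n)" if p: "((x, y), k) \<in> F" for x y k
      proof -
        have "fact k dvd M" unfolding M_def using K[OF p] by (rule fact_dvd)
        with elim have "fact k dvd m n - int (\<nu> n)" by (auto simp: good_def intro: dvd_trans)
        moreover have "low x \<Longrightarrow> int (cnt (y n)) + int k \<in> A n" "\<not> low x \<Longrightarrow> int (cnt (y n)) - int k \<in> B n"
          using p by (force simp: A_def B_def)+
        ultimately show ?thesis using elim by (force simp: P_def good_def)
      qed
      then show ?case by force
    qed
    then show "\<exists>m. \<forall>\<^sub>F n in U. \<forall>p\<in>F. P p n (m n)" by blast
  qed
  then obtain m where m: "\<And>x y k. (x, y) \<in> G \<Longrightarrow> \<forall>\<^sub>F n in U. P ((x, y), k) n (m n)" by blast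
  have m': "\<forall>\<^sub>F n in U. P ((x, y), k) n (m n)" if xy: "(x, y) \<in> H" for x y k
  proof -
    from G(3)[OF xy] obtain x' y' where g: "(x', y') \<in> G" "\<forall>\<^sub>F n in U. x n = x' n" "\<forall>\<^sub>F n in U. y n = y' n"
      by (auto simp: equ_def)
    have "low x \<longleftrightarrow> low x'" unfolding low_def 
      by (rule ev_cong) (use g(2) in eventually_elim, simp)
    with m[OF g(1), of k] g(3) show ?thesis by (auto simp: P_def elim: eventually_elim2)
  qed
  \<comment> \<open>The old element \<open>-1\<close> has position \<open>0\<close>, so it keeps the image of \<open>\<nu>\<close> from being negative.\<close>
  have "cnt (-1) = 0" using less_cnt_iff[of 0 "-1"] by simp
  then have low1: "low (\<lambda>_. -1)" using highD[OF const[of "-1"], of 0] proper by fastforce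
  have pos: "\<forall>\<^sub>F n in U. 0 \<le> m n"
    using m'[OF const[of "-1"], of 0] by eventually_elim (simp add: low1 P_def)
  define \<mu> where "\<mu> n = nat (m n)" for n
  have Q: "\<forall>\<^sub>F n in U. P ((x, y), k) n (int (\<mu> n))" if "(x, y) \<in> H" for x y k
    using m'[OF that, of k] pos by eventually_elim (simp add: \<mu>_def)
  interpret E: generic_position r U H \<nu> \<mu>
  proof
    fix x y assume xy: "(x, y) \<in> H"
    show "(\<forall>k. \<forall>\<^sub>F n in U. cnt (x n) + k < \<nu> n \<and> cnt (y n) + k < \<mu> n) \<or>
        (\<forall>k. \<forall>\<^sub>F n in U. \<nu> n + k < cnt (x n) \<and> \<mu> n + k < cnt (y n))"
    proof (cases "low x")
      case True
      have "\<forall>\<^sub>F n in U. cnt (x n) + k < \<nu> n \<and> cnt (y n) + k < \<mu> n" for k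
        using lowD[OF xy True, of k] Q[OF xy, of k] 
        by eventually_elim (use True in \<open>auto simp: P_def\<close>)
      then show ?thesis by blast
    next
      case False
      have "\<forall>\<^sub>F n in U. \<nu> n + k < cnt (x n) \<and> \<mu> n + k < cnt (y n)" for k
        using highD[OF xy False, of k] Q[OF xy, of k] 
        by eventually_elim (use False in \<open>auto simp: P_def\<close>)
      then show ?thesis by blast
    qed
  next
    fix k :: nat assume "k > 0"
    then have "int k dvd fact k" by (metis dvd_fact of_nat_fact of_nat_dvd_iff One_nat_def Suc_leI order_refl)
    with Q[OF const[of 0], of k] show "\<forall>\<^sub>F n in U. int k dvd int (\<nu> n) - int (\<mu> n)"
      by (auto simp: P_def elim!: eventually_mono) (metis dvd_diff_commute dvd_trans)+
  qed
  show ?thesis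
    using E.partial_iso_extended E.sub_extended E.seq_mem_extended[of 0] by auto
qed

lemma adjoin_positions:
  assumes "finite N"
  shows "\<exists>H'. partial_iso r U H' \<and> H \<subseteq> H' \<and> (\<forall>\<nu>\<in>N. \<exists>y. (\<lambda>n. int (r (\<nu> n)), y) \<in> H')"
  using assms
proof (induction N)
  case empty
  then show ?case using partial_iso_axioms by auto
next
  case (insert \<nu> N)
  then obtain H' where H': "partial_iso r U H'" "H \<subseteq> H'" "\<forall>\<nu>\<in>N. \<exists>y. (\<lambda>n. int (r (\<nu> n)), y) \<in> H'" by blast
  from partial_iso.adjoin_position[OF H'(1), of \<nu>] H'(2,3) show ?case by (metis insertE subset_iff)
qed

section \<open>Adjoining an arbitrary element\<close>

definition adjoin :: "(nat \<Rightarrow> int) \<Rightarrow> (nat \<Rightarrow> int) \<Rightarrow> ((nat \<Rightarrow> int) \<times> (nat \<Rightarrow> int)) set" where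
  "adjoin c d = {(u, v). \<exists>x y k. (x, y) \<in> H \<and> equ u (\<lambda>n. k * c n + x n) \<and> equ v (\<lambda>n. k * d n + y n)}"

lemma adjoinI: "(x, y) \<in> H \<Longrightarrow> equ u (\<lambda>n. k * c n + x n) \<Longrightarrow> equ v (\<lambda>n. k * d n + y n) \<Longrightarrow> (u, v) \<in> adjoin c d"
  by (auto simp: adjoin_def)

lemma sub_adjoin: "H \<subseteq> adjoin c d"
  by (auto intro!: adjoinI[where k = 0])

lemma mem_adjoin: "(c, d) \<in> adjoin c d"
  by (rule adjoinI[OF const[of 0], of _ 1]) auto

lemma pre_iso_adjoin:
  assumes pos_cd: "\<And>k x y. (x, y) \<in> H \<Longrightarrow> (\<forall>\<^sub>F n in U. 0 < k * c n + x n) \<longleftrightarrow> (\<forall>\<^sub>F n in U. 0 < k * d n + y n)"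
    and cong_cd: "\<And>m. m > 0 \<Longrightarrow> \<forall>\<^sub>F n in U. m dvd c n - d n"
  shows "pre_iso r U (adjoin c d)"
proof unfold_locales
  fix x y x' y' assume "(x, y) \<in> adjoin c d" "equ x x'" "equ y y'"
  then show "(x', y') \<in> adjoin c d"
    unfolding adjoin_def by (auto intro: equ_trans[OF equ_sym])
next
  fix u v u' v' assume "(u, v) \<in> adjoin c d" "(u', v') \<in> adjoin c d"
  then obtain x y k x' y' k' where *: "(x, y) \<in> H" "(x', y') \<in> H"
    "\<forall>\<^sub>F n in U. u n = k * c n + x n" "\<forall>\<^sub>F n in U. v n = k * d n + y n"
    "\<forall>\<^sub>F n in U. u' n = k' * c n + x' n" "\<forall>\<^sub>F n in U. v' n = k' * d n + y' n"
    by (auto simp: adjoin_def equ_def)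
  show "(\<lambda>n. u n + u' n, \<lambda>n. v n + v' n) \<in> adjoin c d"
  proof (rule adjoinI[OF add[OF *(1,2)], where k = "k + k'"])
    show "equ (\<lambda>n. u n + u' n) (\<lambda>n. (k + k') * c n + (x n + x' n))"
      unfolding equ_def using *(3,5) by eventually_elim (simp add: algebra_simps)
    show "equ (\<lambda>n. v n + v' n) (\<lambda>n. (k + k') * d n + (y n + y' n))"
      unfolding equ_def using *(4,6) by eventually_elim (simp add: algebra_simps)
  qed
next
  fix u v l assume "(u, v) \<in> adjoin c d"
  then obtain x y k where *: "(x, y) \<in> H"
    "\<forall>\<^sub>F n in U. u n = k * c n + x n" "\<forall>\<^sub>F n in U. v n = k * d n + y n"
    by (auto simp: adjoin_def equ_def)
  show "(\<lambda>n. l * u n, \<lambda>n. l * v n) \<in> adjoin c d"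
  proof (rule adjoinI[OF scale[OF *(1), of l], where k = "l * k"])
    show "equ (\<lambda>n. l * u n) (\<lambda>n. l * k * c n + l * x n)"
      unfolding equ_def using *(2) by eventually_elim (simp add: algebra_simps)
    show "equ (\<lambda>n. l * v n) (\<lambda>n. l * k * d n + l * y n)"
      unfolding equ_def using *(3) by eventually_elim (simp add: algebra_simps)
  qed
next
  show "(\<lambda>_. k, \<lambda>_. k) \<in> adjoin c d" for k by (rule subsetD[OF sub_adjoin const])
next
  fix u v assume "(u, v) \<in> adjoin c d"
  then obtain x y k where *: "(x, y) \<in> H"
    "\<forall>\<^sub>F n in U. u n = k * c n + x n" "\<forall>\<^sub>F n in U. v n = k * d n + y n"
    by (auto simp: adjoin_def equ_def)
  have "(\<forall>\<^sub>F n in U. 0 < u n) \<longleftrightarrow> (\<forall>\<^sub>F n in U. 0 < k * c n + x n)"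
    by (rule ev_cong) (use *(2) in eventually_elim, simp)
  moreover have "(\<forall>\<^sub>F n in U. 0 < v n) \<longleftrightarrow> (\<forall>\<^sub>F n in U. 0 < k * d n + y n)"
    by (rule ev_cong) (use *(3) in eventually_elim, simp)
  ultimately show "(\<forall>\<^sub>F n in U. 0 < u n) \<longleftrightarrow> (\<forall>\<^sub>F n in U. 0 < v n)" using pos_cd[OF *(1)] by simp
next
  fix u v m assume "(u, v) \<in> adjoin c d" and m: "(m :: int) > 0"
  then obtain x y k where *: "(x, y) \<in> H"
    "\<forall>\<^sub>F n in U. u n = k * c n + x n" "\<forall>\<^sub>F n in U. v n = k * d n + y n"
    by (auto simp: adjoin_def equ_def)
  from *(2,3) cong[OF *(1) m] cong_cd[OF m] show "\<forall>\<^sub>F n in U. m dvd u n - v n"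
  proof eventually_elim
    case (elim n)
    have "m dvd k * (c n - d n) + (x n - y n)" using elim by (intro dvd_add dvd_mult)
    then show ?case using elim by (simp add: algebra_simps)
  qed
qed

text \<open>
  If \<open>k * c\<close> is old, then its image is again divisible by \<open>k\<close>, because residues modulo \<open>k\<close> are
  preserved, and the quotient is the image of \<open>c\<close>.
\<close>

lemma pre_iso_adjoin_algebraic:
  assumes k: "k > 0" and xy: "(x, y) \<in> H" and kc: "equ (\<lambda>n. k * c n) x"
  shows "pre_iso r U (adjoin c (\<lambda>n. y n div k))"
proof (rule pre_iso_adjoin)
  from cong[OF xy k] kc[unfolded equ_def]
  have kd: "\<forall>\<^sub>F n in U. k * (y n div k) = y n"
  proof eventually_elim
    case (elim n)
    then have "k dvd y n" by (metis dvd_diff_commute dvd_triv_left dvd_diff_left_iff)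
    then show ?case by simp
  qed
  show "\<forall>\<^sub>F n in U. m dvd c n - y n div k" if "m > 0" for m
  proof -
    have "m * k > 0" using that k by simp
    from cong[OF xy this] kd kc[unfolded equ_def] show ?thesis
    proof eventually_elim
      case (elim n)
      then have "m * k dvd (c n - y n div k) * k" by (simp add: algebra_simps)
      with k show ?case by simp
    qed
  qed
  fix l x' y' assume xy': "(x', y') \<in> H"
  have 1: "(\<forall>\<^sub>F n in U. 0 < l * c n + x' n) \<longleftrightarrow> (\<forall>\<^sub>F n in U. 0 < l * x n + k * x' n)"
  proof (rule ev_cong)
    from kc[unfolded equ_def] show "\<forall>\<^sub>F n in U. (0 < l * c n + x' n) = (0 < l * x n + k * x' n)"
    proof eventually_elim
      case (elim n)
      have "l * x n + k * x' n = k * (l * c n + x' n)" by (simp add: algebra_simps flip: elim)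
      with k show ?case by (simp add: zero_less_mult_iff)
    qed
  qed
  have 2: "(\<forall>\<^sub>F n in U. 0 < l * (y n div k) + y' n) \<longleftrightarrow> (\<forall>\<^sub>F n in U. 0 < l * y n + k * y' n)"
  proof (rule ev_cong)
    from kd show "\<forall>\<^sub>F n in U. (0 < l * (y n div k) + y' n) = (0 < l * y n + k * y' n)"
    proof eventually_elim
      case (elim n)
      have "l * y n + k * y' n = k * (l * (y n div k) + y' n)"
        using elim by (metis (no_types, opaque_lifting) distrib_left mult.left_commute)
      with k show ?case by (simp add: zero_less_mult_iff)
    qed
  qed
  show "(\<forall>\<^sub>F n in U. 0 < l * c n + x' n) \<longleftrightarrow> (\<forall>\<^sub>F n in U. 0 < l * (y n div k) + y' n)"
    using 1 2 pos[OF add[OF scale[OF xy, of l] scale[OF xy', of k]]] by simp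
qed

text \<open>
  If no multiple of \<open>c\<close> is old, every multiple is infinitely far from all old elements. All conditions
  on the image are brought to a common multiple \<open>N * d\<close>, and \<open>int_between\<close> applies again. The extension
  need not respect shifts: the members next to a new element may be new themselves.
\<close>

lemma adjoin_element: "\<exists>d. pre_iso r U (adjoin c d)"
proof (cases "\<exists>k x y. k > 0 \<and> (x, y) \<in> H \<and> equ (\<lambda>n. k * c n) x")
  case True
  then show ?thesis using pre_iso_adjoin_algebraic by blast
next
  case False
  then have new: "\<not> (\<forall>\<^sub>F n in U. k * c n = x n)" if "k > 0" "(x, y) \<in> H" for k x y
    using that by (auto simp: equ_def)
  define low where "low q x \<longleftrightarrow> (\<forall>\<^sub>F n in U. x n < q * c n)" for q :: int and x
  have highD: "\<forall>\<^sub>F n in U. q * c n < x n" if "\<not> low q x" "q > 0" "(x, y) \<in> H" for q x y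
  proof -
    have "\<forall>\<^sub>F n in U. \<not> x n < q * c n" "\<forall>\<^sub>F n in U. \<not> q * c n = x n"
      using that new by (simp_all add: ev_not low_def)
    then show ?thesis by eventually_elim simp
  qed
  have farD: "\<forall>\<^sub>F n in U. x n + b < q * c n" if "low q x" "q > 0" "(x, y) \<in> H" for q x y b
  proof (rule ccontr)
    assume "\<not> ?thesis"
    then have "\<forall>\<^sub>F n in U. \<not> x n + b < q * c n" by (simp add: ev_not)
    with that(1) have "\<forall>\<^sub>F n in U. q * c n - x n \<in> {0..b}" unfolding low_def by eventually_elim simp
    from ev_pigeonhole[OF _ this] obtain j where "\<forall>\<^sub>F n in U. q * c n - x n = j" by auto
    then have "\<forall>\<^sub>F n in U. q * c n = x n + j" by eventually_elim simp
    with new[OF that(2) add[OF that(3) const[of j]]] show False by simp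
  qed
  obtain G where G: "countable G" "G \<subseteq> H" "\<And>x y. (x, y) \<in> H \<Longrightarrow> \<exists>x' y'. (x', y') \<in> G \<and> equ x x' \<and> equ y y'"
    using generated by blast
  define P where "P = (\<lambda>((x, y), k) n d. (if low (int (Suc k)) x then y n < int (Suc k) * d else int (Suc k) * d < y n)
       \<and> fact k dvd d - c n)"
  have "\<exists>d. \<forall>p\<in>G \<times> UNIV. \<forall>\<^sub>F n in U. P p n (d n)"
  proof (rule saturation)
    show "countable (G \<times> (UNIV :: nat set))" using G(1) by auto
    fix F assume F: "F \<subseteq> G \<times> (UNIV :: nat set)" "finite F"
    define K where "K = Max (insert 0 (snd ` F))"
    have K: "k \<le> K" if "(g, k) \<in> F" for g k
      unfolding K_def using F(2) that by (intro Max_ge) force+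
    \<comment> \<open>a common multiple of the coefficients \<open>Suc k\<close> and the moduli \<open>fact k\<close>\<close>
    define N :: int where "N = fact (Suc K)"
    have N: "N > 0" by (simp add: N_def)
    have N': "int (Suc k) * (N div int (Suc k)) = N" "N div int (Suc k) > 0" if "(g, k) \<in> F" for g k
    proof -
      have "Suc k dvd fact (Suc K)" using K[OF that] by (intro dvd_fact) auto
      then have "int (Suc k) dvd N" unfolding N_def by (metis of_nat_dvd_iff of_nat_fact)
      then show *: "int (Suc k) * (N div int (Suc k)) = N" by simp
      then show "N div int (Suc k) > 0" using N by (metis of_nat_0_less_iff zero_less_Suc zero_less_mult_pos)
    qed
    define A where "A n = (\<lambda>((x, y), k). N div int (Suc k) * y n) ` {p\<in>F. low (int (Suc (snd p))) (fst (fst p))}" for n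
    define B where "B n = (\<lambda>((x, y), k). N div int (Suc k) * y n) ` {p\<in>F. \<not> low (int (Suc (snd p))) (fst (fst p))}" for n
    have gap1: "\<forall>\<^sub>F n in U. N div int (Suc k) * y n + N * N < N div int (Suc k') * y' n"
      if F1: "((x, y), k) \<in> F" and "low (int (Suc k)) x" and F2: "((x', y'), k') \<in> F" and "\<not> low (int (Suc k')) x'" for x y k x' y' k'
    proof -
      let ?a = "N div int (Suc k)" and ?b = "N div int (Suc k')"
      have xy: "(x, y) \<in> H" "(x', y') \<in> H" using that F(1) G(2) by auto
      have "\<forall>\<^sub>F n in U. ?a * x n < N * c n"
        using that(2) unfolding low_def
      proof eventually_elim
        case (elim n)
        then have "?a * x n < ?a * (int (Suc k) * c n)" using N'[OF F1] by simp
        then show ?case using N'(1)[OF F1] by (metis mult.assoc mult.commute)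
      qed
      then have "low N (\<lambda>n. ?a * x n)" by (simp add: low_def)
      from farD[OF this N scale[OF xy(1)], of "N * N"] highD[OF that(4) _ xy(2)]
      have "\<forall>\<^sub>F n in U. ?a * x n + N * N < ?b * x' n"
      proof (rule eventually_elim2)
        fix n assume 1: "?a * x n + N * N < N * c n" and "int (Suc k') * c n < x' n"
        then have "?b * (int (Suc k') * c n) < ?b * x' n" using N'[OF F2] by simp
        moreover have "?b * (int (Suc k') * c n) = N * c n" using N'(1)[OF F2] by (metis mult.assoc mult.commute)
        ultimately show "?a * x n + N * N < ?b * x' n" using 1 by linarith
      qed simp
      then show ?thesis
        using less_transfer[OF add[OF scale[OF xy(1)] const[of "N * N"]] scale[OF xy(2)]] by simp
    qed
    have "\<forall>\<^sub>F n in U. \<forall>p\<in>F. \<forall>q\<in>F. low (int (Suc (snd p))) (fst (fst p)) \<longrightarrow> \<not> low (int (Suc (snd q))) (fst (fst q)) \<longrightarrow>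
       N div int (Suc (snd p)) * snd (fst p) n + N * N < N div int (Suc (snd q)) * snd (fst q) n"
      using gap1 by (intro eventually_ball_finite F(2) ballI) force
    then have gap: "\<forall>\<^sub>F n in U. \<forall>a\<in>A n. \<forall>b\<in>B n. a + N * N < b"
      by eventually_elim (force simp: A_def B_def)
    define good where "good n d \<longleftrightarrow> N dvd d - c n \<and> (\<forall>a\<in>A n. a < N * d) \<and> (\<forall>b\<in>B n. N * d < b)" for n d
    define d where "d n = (SOME d. good n d)" for n
    have "\<forall>\<^sub>F n in U. good n (d n)"
      using gap
    proof eventually_elim
      case (elim n)
      have "\<exists>d. good n d" unfolding good_def
        by (rule int_between) (use F(2) N elim in \<open>auto simp: A_def B_def\<close>)
      then show ?case unfolding d_def by (rule someI_ex)
    qed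
    then have "\<forall>\<^sub>F n in U. \<forall>p\<in>F. P p n (d n)"
    proof eventually_elim
      case (elim n)
      have "P ((x, y), k) n (d n)" if p: "((x, y), k) \<in> F" for x y k
      proof -
        let ?a = "N div int (Suc k)"
        have "fact k dvd N" unfolding N_def using K[OF p] by (intro fact_dvd) simp
        with elim have "fact k dvd d n - c n" by (auto simp: good_def intro: dvd_trans)
        moreover have "low (int (Suc k)) x \<Longrightarrow> ?a * y n \<in> A n" "\<not> low (int (Suc k)) x \<Longrightarrow> ?a * y n \<in> B n"
          using p by (force simp: A_def B_def)+
        moreover have Nd: "N * d n = ?a * (int (Suc k) * d n)"
          using N'(1)[OF p] by (metis mult.assoc mult.commute)
        have "?a * y n < N * d n \<longleftrightarrow> y n < int (Suc k) * d n" "N * d n < ?a * y n \<longleftrightarrow> int (Suc k) * d n < y n"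
          unfolding Nd using N'(2)[OF p] by (simp_all only: mult_less_cancel_left_pos)
        ultimately show ?thesis using elim by (auto simp: P_def good_def simp del: of_nat_Suc)
      qed
      then show ?case by force
    qed
    then show "\<exists>d. \<forall>\<^sub>F n in U. \<forall>p\<in>F. P p n (d n)" by blast
  qed
  then obtain d where d: "\<And>x y k. (x, y) \<in> G \<Longrightarrow> \<forall>\<^sub>F n in U. P ((x, y), k) n (d n)" by blast
  have d': "\<forall>\<^sub>F n in U. P ((x, y), k) n (d n)" if xy: "(x, y) \<in> H" for x y k
  proof -
    from G(3)[OF xy] obtain x' y' where g: "(x', y') \<in> G" "\<forall>\<^sub>F n in U. x n = x' n" "\<forall>\<^sub>F n in U. y n = y' n"
      by (auto simp: equ_def)
    have "low (int (Suc k)) x \<longleftrightarrow> low (int (Suc k)) x'" unfolding low_def 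
      by (rule ev_cong) (use g(2) in eventually_elim, simp)
    with d[OF g(1), of k] g(3) show ?thesis by (auto simp: P_def elim: eventually_elim2)
  qed
  have tri: "((\<forall>\<^sub>F n in U. x n < q * c n) \<and> (\<forall>\<^sub>F n in U. y n < q * d n)) \<or>
     ((\<forall>\<^sub>F n in U. q * c n < x n) \<and> (\<forall>\<^sub>F n in U. q * d n < y n))" if xy: "(x, y) \<in> H" and q: "q > 0" for x y q
  proof -
    have q': "int (Suc (nat (q - 1))) = q" using q by simp
    show ?thesis
    proof (cases "low q x")
      case True
      then have "\<forall>\<^sub>F n in U. y n < q * d n"
        using d'[OF xy, of "nat (q - 1)"] unfolding P_def by (simp add: q' del: of_nat_Suc) (auto elim: eventually_mono)
      with True show ?thesis by (simp add: low_def)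
    next
      case False
      then have "\<forall>\<^sub>F n in U. q * d n < y n"
        using d'[OF xy, of "nat (q - 1)"] unfolding P_def by (simp add: q' del: of_nat_Suc) (auto elim: eventually_mono)
      with highD[OF False q xy] show ?thesis by simp
    qed
  qed
  have ev_asym: "\<not> (\<forall>\<^sub>F n in U. f n < g n)" if "\<forall>\<^sub>F n in U. g n < f n" for f g :: "nat \<Rightarrow> int"
  proof
    assume "\<forall>\<^sub>F n in U. f n < g n"
    with that have "\<forall>\<^sub>F n in U. False" by eventually_elim simp
    with proper show False by simp
  qed
  have "pre_iso r U (adjoin c d)"
  proof (rule pre_iso_adjoin)
    fix m :: int assume "m > 0"
    then have "m dvd fact (nat m)" using dvd_fact[of "nat m" "nat m"]
      by (metis Suc_leI One_nat_def int_nat_eq less_le of_nat_dvd_iff of_nat_fact order_refl zero_less_nat_eq)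
    with d'[OF const[of 0], of "nat m"] show "\<forall>\<^sub>F n in U. m dvd c n - d n"
      by (auto simp: P_def elim!: eventually_mono) (metis dvd_diff_commute dvd_trans)+
  next
    fix k :: int and x y assume xy: "(x, y) \<in> H"
    have n: "(\<lambda>n. - x n, \<lambda>n. - y n) \<in> H" using scale[OF xy, of "-1"] by simp
    consider "k = 0" | "k > 0" | "k < 0" by linarith
    then show "(\<forall>\<^sub>F n in U. 0 < k * c n + x n) \<longleftrightarrow> (\<forall>\<^sub>F n in U. 0 < k * d n + y n)"
    proof cases
      case 1
      then show ?thesis using pos[OF xy] by simp
    next
      case 2
      have "0 < k * a + b \<longleftrightarrow> - b < k * a" for a b by linarith
      then show ?thesis using tri[OF n 2] ev_asym[of "\<lambda>n. - x n"] ev_asym[of "\<lambda>n. - y n"] by auto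
    next
      case 3
      have eq: "0 < k * a + b \<longleftrightarrow> (-k) * a < b" for a b by (simp add: minus_less_iff) linarith
      have "- k > 0" using 3 by simp
      from tri[OF xy this] show ?thesis unfolding eq using ev_asym[of "\<lambda>n. (-k) * c n" x] ev_asym[of "\<lambda>n. (-k) * d n" y] by blast
    qed
  qed
  then show ?thesis by blast
qed

end

section \<open>Elimination of quantifiers\<close>

datatype qterm = QVar nat | QConst int | QAdd qterm qterm | QScale int qterm | QShift int qterm

instance qterm :: countable by countable_datatype

primrec shift_args :: "qterm \<Rightarrow> qterm set" where
  "shift_args (QVar v) = {}"
| "shift_args (QConst k) = {}"
| "shift_args (QAdd s t) = shift_args s \<union> shift_args t"
| "shift_args (QScale k t) = shift_args t"
| "shift_args (QShift j t) = insert t (shift_args t)"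

lemma finite_shift_args: "finite (shift_args t)"
  by (induction t) auto

context sparse_sequence
begin

primrec qval :: "(nat \<Rightarrow> int) \<Rightarrow> qterm \<Rightarrow> int" where
  "qval e (QVar v) = e v"
| "qval e (QConst k) = k"
| "qval e (QAdd s t) = qval e s + qval e t"
| "qval e (QScale k t) = k * qval e t"
| "qval e (QShift j t) = shift j (qval e t)"

text \<open>A pair \<open>(t, k)\<close> stands for the modulus \<open>Suc k\<close>, which is positive.\<close>

definition agree :: "(qterm \<times> nat) set \<Rightarrow> (nat \<Rightarrow> int) \<Rightarrow> (nat \<Rightarrow> int) \<Rightarrow> bool" where
  "agree \<Phi> e e' \<longleftrightarrow> (\<forall>(t, k)\<in>\<Phi>. (0 < qval e t \<longleftrightarrow> 0 < qval e' t) \<and> int (Suc k) dvd qval e t - qval e' t)"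

lemma agree_sym: "agree \<Phi> e e' \<Longrightarrow> agree \<Phi> e' e"
  by (auto simp: agree_def dvd_diff_commute)

lemma agree_mono: "agree \<Phi> e e' \<Longrightarrow> \<Psi> \<subseteq> \<Phi> \<Longrightarrow> agree \<Psi> e e'"
  by (auto simp: agree_def)

end

context ultrapower
begin

text \<open>
  The members next to the finitely many arguments of shifts in \<open>\<Phi>\<close> are adjoined first. After adjoining
  \<open>c\<close> itself, the images of these arguments have positions that correspond to them, so the values of
  all terms of \<open>\<Phi>\<close> correspond by \<open>shift_mem\<close>.
\<close>

lemma iso_extends_to_new_variable:
  assumes iso: "partial_iso r U H"
    and vars: "\<And>w. (\<lambda>n. e n w, \<lambda>n. e' n w) \<in> H"
    and fin: "finite \<Phi>"
  shows "\<exists>d. \<forall>\<^sub>F n in U. agree \<Phi> ((e n)(v := c n)) ((e' n)(v := d n))"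
proof -
  define \<nu> where "\<nu> t n = cnt (qval ((e n)(v := c n)) t)" for t n
  define S where "S = (\<Union>t\<in>fst ` \<Phi>. shift_args t)"
  have "finite S" using fin by (auto simp: S_def finite_shift_args)
  then have "finite (\<nu> ` S)" by simp
  from partial_iso.adjoin_positions[OF iso this] obtain H' where
    H': "partial_iso r U H'" "H \<subseteq> H'" "\<forall>t\<in>S. \<exists>y. (\<lambda>n. int (r (\<nu> t n)), y) \<in> H'" by auto
  interpret H': partial_iso r U H' by (rule H'(1))
  from H'.adjoin_element[of c] obtain d where d: "pre_iso r U (H'.adjoin c d)" by blast
  interpret E: pre_iso r U "H'.adjoin c d" by (rule d)
  have mem: "(\<lambda>n. qval ((e n)(v := c n)) t, \<lambda>n. qval ((e' n)(v := d n)) t) \<in> H'.adjoin c d"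
    if "shift_args t \<subseteq> S" for t
    using that
  proof (induction t)
    case (QVar w)
    show ?case
    proof (cases "w = v")
      case True
      then show ?thesis using H'.mem_adjoin[of c d] by simp
    next
      case False
      then show ?thesis using vars[of w] H'(2) H'.sub_adjoin[of c d] by auto
    qed
  next
    case (QConst k)
    then show ?case using E.const by simp
  next
    case (QAdd s t)
    then show ?case using E.add by simp
  next
    case (QScale k t)
    then show ?case using E.scale by simp
  next
    case (QShift j t)
    let ?u = "\<lambda>n. qval ((e n)(v := c n)) t" and ?v = "\<lambda>n. qval ((e' n)(v := d n)) t"
    from QShift.prems have "shift_args t \<subseteq> S" by simp
    from QShift.IH[OF this] have uv: "(?u, ?v) \<in> H'.adjoin c d" .
    from QShift.prems H'(3) obtain y where y: "(\<lambda>n. int (r (\<nu> t n)), y) \<in> H'" by auto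
    have "(\<lambda>n. int (r (\<nu> t n)), \<lambda>n. shift 0 (y n)) \<in> H'"
      using H'.shift_closed[OF y, of 0] by simp
    from H'.equ_transfer[OF y this] have "equ y (\<lambda>n. shift 0 (y n))" by simp
    then have eq: "\<forall>\<^sub>F n in U. shift 0 (y n) = y n" unfolding equ_def by eventually_elim simp
    have "(\<lambda>n. int (r (nat (int (\<nu> t n) + l))), \<lambda>n. int (r (nat (int (cnt (y n) - 1) + l)))) \<in> H'.adjoin c d" for l
    proof -
      have "equ (\<lambda>n. shift l (y n)) (\<lambda>n. int (r (nat (int (cnt (y n) - 1) + l))))"
        unfolding equ_def using eq
      proof eventually_elim
        case (elim n)
        then have "y n \<in> int ` range r" by (simp add: in_range_iff_shift)
        then show ?case by auto
      qed
      moreover have "equ (\<lambda>n. shift l (int (r (\<nu> t n)))) (\<lambda>n. int (r (nat (int (\<nu> t n) + l))))" by simp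
      ultimately show ?thesis
        using H'.resp[OF H'.shift_closed[OF y, of l]] H'.sub_adjoin[of c d] by blast
    qed
    from E.shift_mem[OF uv this, of 0] show ?case by (simp add: \<nu>_def del: fun_upd_apply)
  qed
  have "\<forall>\<^sub>F n in U. \<forall>p\<in>\<Phi>. (0 < qval ((e n)(v := c n)) (fst p) \<longleftrightarrow> 0 < qval ((e' n)(v := d n)) (fst p)) \<and>
     int (Suc (snd p)) dvd qval ((e n)(v := c n)) (fst p) - qval ((e' n)(v := d n)) (fst p)"
  proof (rule eventually_ball_finite[OF fin], rule ballI)
    fix p assume p: "p \<in> \<Phi>"
    then have "shift_args (fst p) \<subseteq> S" by (auto simp: S_def)
    note m = mem[OF this]
    have "\<forall>\<^sub>F n in U. (0 < qval ((e n)(v := c n)) (fst p) \<longleftrightarrow> 0 < qval ((e' n)(v := d n)) (fst p))"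
    proof (cases "\<forall>\<^sub>F n in U. 0 < qval ((e n)(v := c n)) (fst p)")
      case True
      with E.pos[OF m] have "\<forall>\<^sub>F n in U. 0 < qval ((e' n)(v := d n)) (fst p)" by simp
      with True show ?thesis by eventually_elim simp
    next
      case False
      with E.pos[OF m] have "\<forall>\<^sub>F n in U. \<not> 0 < qval ((e n)(v := c n)) (fst p)"
        "\<forall>\<^sub>F n in U. \<not> 0 < qval ((e' n)(v := d n)) (fst p)" unfolding ev_not by simp_all
      then show ?thesis by eventually_elim simp
    qed
    moreover have "\<forall>\<^sub>F n in U. int (Suc (snd p)) dvd qval ((e n)(v := c n)) (fst p) - qval ((e' n)(v := d n)) (fst p)"
      by (rule E.cong[OF m]) simp
    ultimately show "\<forall>\<^sub>F n in U. (0 < qval ((e n)(v := c n)) (fst p) \<longleftrightarrow> 0 < qval ((e' n)(v := d n)) (fst p)) \<and>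
     int (Suc (snd p)) dvd qval ((e n)(v := c n)) (fst p) - qval ((e' n)(v := d n)) (fst p)"
      by (rule eventually_conj)
  qed
  then show ?thesis unfolding agree_def by (auto simp: case_prod_beta)
qed

lemma partial_iso_generated_by_variables:
  assumes agr: "\<And>t k. \<forall>\<^sub>F n in U. agree {(t, k)} (e n) (e' n)"
  defines "H \<equiv> {(x, y). \<exists>t. equ x (\<lambda>n. qval (e n) t) \<and> equ y (\<lambda>n. qval (e' n) t)}"
  shows "partial_iso r U H"
proof unfold_locales
  fix x y x' y' assume "(x, y) \<in> H" "equ x x'" "equ y y'"
  then show "(x', y') \<in> H" unfolding H_def by (auto intro: equ_trans[OF equ_sym])
next
  fix x y x' y' assume "(x, y) \<in> H" "(x', y') \<in> H"
  then obtain s t where "\<forall>\<^sub>F n in U. x n = qval (e n) s" "\<forall>\<^sub>F n in U. y n = qval (e' n) s"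
     "\<forall>\<^sub>F n in U. x' n = qval (e n) t" "\<forall>\<^sub>F n in U. y' n = qval (e' n) t"
    by (auto simp: H_def equ_def)
  then have "equ (\<lambda>n. x n + x' n) (\<lambda>n. qval (e n) (QAdd s t))" "equ (\<lambda>n. y n + y' n) (\<lambda>n. qval (e' n) (QAdd s t))"
    unfolding equ_def by (eventually_elim; simp)+
  then show "(\<lambda>n. x n + x' n, \<lambda>n. y n + y' n) \<in> H" unfolding H_def by blast
next
  fix x y k assume "(x, y) \<in> H"
  then obtain t where "\<forall>\<^sub>F n in U. x n = qval (e n) t" "\<forall>\<^sub>F n in U. y n = qval (e' n) t"
    by (auto simp: H_def equ_def)
  then have "equ (\<lambda>n. k * x n) (\<lambda>n. qval (e n) (QScale k t))" "equ (\<lambda>n. k * y n) (\<lambda>n. qval (e' n) (QScale k t))"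
    unfolding equ_def by (eventually_elim; simp)+
  then show "(\<lambda>n. k * x n, \<lambda>n. k * y n) \<in> H" unfolding H_def by blast
next
  show "(\<lambda>_. k, \<lambda>_. k) \<in> H" for k
    unfolding H_def by (auto intro!: exI[of _ "QConst k"])
next
  fix x y assume "(x, y) \<in> H"
  then obtain t where t: "\<forall>\<^sub>F n in U. x n = qval (e n) t" "\<forall>\<^sub>F n in U. y n = qval (e' n) t"
    by (auto simp: H_def equ_def)
  with agr[of t 0] have "\<forall>\<^sub>F n in U. 0 < x n \<longleftrightarrow> 0 < y n"
    by eventually_elim (simp add: agree_def)
  then show "(\<forall>\<^sub>F n in U. 0 < x n) \<longleftrightarrow> (\<forall>\<^sub>F n in U. 0 < y n)" by (rule ev_cong)
next
  fix x y and m :: int assume "(x, y) \<in> H" and m: "m > 0"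
  then obtain t where t: "\<forall>\<^sub>F n in U. x n = qval (e n) t" "\<forall>\<^sub>F n in U. y n = qval (e' n) t"
    by (auto simp: H_def equ_def)
  from m have "int (Suc (nat (m - 1))) = m" by simp
  then have agr': "agree {(t, nat (m - 1))} f f' \<Longrightarrow> m dvd qval f t - qval f' t" for f f'
    by (simp add: agree_def del: of_nat_Suc)
  from t agr[of t "nat (m - 1)"] show "\<forall>\<^sub>F n in U. m dvd x n - y n"
    by eventually_elim (simp add: agr')
next
  fix x y j assume "(x, y) \<in> H"
  then obtain t where "\<forall>\<^sub>F n in U. x n = qval (e n) t" "\<forall>\<^sub>F n in U. y n = qval (e' n) t"
    by (auto simp: H_def equ_def)
  then have "equ (\<lambda>n. shift j (x n)) (\<lambda>n. qval (e n) (QShift j t))" "equ (\<lambda>n. shift j (y n)) (\<lambda>n. qval (e' n) (QShift j t))"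
    unfolding equ_def by (eventually_elim; simp)+
  then show "(\<lambda>n. shift j (x n), \<lambda>n. shift j (y n)) \<in> H" unfolding H_def by blast
next
  let ?G = "range (\<lambda>t. (\<lambda>n. qval (e n) t, \<lambda>n. qval (e' n) t))"
  have "(\<lambda>n. qval (e n) t, \<lambda>n. qval (e' n) t) \<in> H" for t
    unfolding H_def using equ_refl by blast
  then have "?G \<subseteq> H" by blast
  moreover have "\<exists>x' y'. (x', y') \<in> ?G \<and> equ x x' \<and> equ y y'" if "(x, y) \<in> H" for x y
  proof -
    from that obtain t where "equ x (\<lambda>n. qval (e n) t)" "equ y (\<lambda>n. qval (e' n) t)"
      by (auto simp: H_def)
    moreover have "(\<lambda>n. qval (e n) t, \<lambda>n. qval (e' n) t) \<in> ?G" by (rule rangeI)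
    ultimately show ?thesis by blast
  qed
  ultimately show "\<exists>G. countable G \<and> G \<subseteq> H \<and> (\<forall>x y. (x, y) \<in> H \<longrightarrow> (\<exists>x' y'. (x', y') \<in> G \<and> equ x x' \<and> equ y y'))"
    by (intro exI[of _ ?G]) auto
qed

end

context sparse_sequence
begin

text \<open>
  If no finite \<open>\<Psi>\<close> works, take counterexamples for longer and longer finite sets. In an ultrapower they
  form two tuples that agree on all terms, and the partial isomorphism between them extends to
  the new value.
\<close>

lemma back_and_forth:
  assumes "finite \<Phi>"
  shows "\<exists>\<Psi>. finite \<Psi> \<and> (\<forall>e e'. agree \<Psi> e e' \<longrightarrow> (\<forall>c. \<exists>d. agree \<Phi> (e(v := c)) (e'(v := d))))"
proof (rule ccontr)
  assume neg: "\<not> ?thesis"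
  define p :: "nat \<Rightarrow> qterm \<times> nat" where "p = from_nat"
  have "\<exists>e e' c. agree (p ` {..n}) e e' \<and> (\<forall>d. \<not> agree \<Phi> (e(v := c)) (e'(v := d)))" for n
  proof (rule ccontr)
    assume "\<not> ?thesis"
    then have *: "\<forall>e e'. agree (p ` {..n}) e e' \<longrightarrow> (\<forall>c. \<exists>d. agree \<Phi> (e(v := c)) (e'(v := d)))" by simp
    show False by (rule notE[OF neg]) (rule exI[of _ "p ` {..n}"], rule conjI[OF _ *], simp)
  qed
  then obtain e e' c where e: "\<And>n. agree (p ` {..n}) (e n) (e' n)"
    and no: "\<And>n d. \<not> agree \<Phi> ((e n)(v := c n)) ((e' n)(v := d))" by metis
  obtain U where U: "free_ultrafilter U" using free_ultrafilter_exists by blast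
  interpret free_ultrafilter U by (rule U)
  interpret ultrapower r U by unfold_locales
  have "\<forall>\<^sub>F n in U. agree {(t, k)} (e n) (e' n)" for t k
  proof -
    have "p (to_nat (t, k)) = (t, k)" by (simp add: p_def)
    moreover have "\<forall>\<^sub>F n in U. to_nat (t, k) \<le> n" using free by (simp add: le_sequentially)
    ultimately show ?thesis
      by (auto elim!: eventually_mono intro!: agree_mono[OF e] image_eqI[of _ _ "to_nat (t, k)"])
  qed
  from partial_iso_generated_by_variables[OF this]
  have "\<exists>d. \<forall>\<^sub>F n in U. agree \<Phi> ((e n)(v := c n)) ((e' n)(v := d n))"
  proof (rule iso_extends_to_new_variable)
    show "(\<lambda>n. e n w, \<lambda>n. e' n w) \<in> {(x, y). \<exists>t. equ x (\<lambda>n. qval (e n) t) \<and> equ y (\<lambda>n. qval (e' n) t)}" for w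
      by (auto intro!: exI[of _ "QVar w"])
  qed (rule assms)
  then show False using no proper by simp
qed

definition determined :: "((nat \<Rightarrow> int) \<Rightarrow> bool) \<Rightarrow> bool" where
  "determined Q \<longleftrightarrow> (\<exists>\<Phi>. finite \<Phi> \<and> (\<forall>e e'. agree \<Phi> e e' \<longrightarrow> (Q e \<longleftrightarrow> Q e')))"

lemma determinedI: "finite \<Phi> \<Longrightarrow> (\<And>e e'. agree \<Phi> e e' \<Longrightarrow> Q e \<longleftrightarrow> Q e') \<Longrightarrow> determined Q"
  by (auto simp: determined_def)

lemma determined_conj:
  assumes "determined P" "determined Q"
  shows "determined (\<lambda>e. P e \<and> Q e)"
proof -
  from assms obtain \<Phi> \<Psi> where "finite \<Phi>" "finite \<Psi>"
    "\<And>e e'. agree \<Phi> e e' \<Longrightarrow> P e \<longleftrightarrow> P e'" "\<And>e e'. agree \<Psi> e e' \<Longrightarrow> Q e \<longleftrightarrow> Q e'"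
    unfolding determined_def by blast
  then show ?thesis by (intro determinedI[of "\<Phi> \<union> \<Psi>"]) (auto dest: agree_mono)
qed

lemma determined_not: "determined P \<Longrightarrow> determined (\<lambda>e. \<not> P e)"
  by (simp add: determined_def)

lemma determined_pos: "determined (\<lambda>e. 0 < qval e t)"
  by (rule determinedI[of "{(t, 0)}"]) (auto simp: agree_def)

lemma determined_less: "determined (\<lambda>e. qval e s < qval e t)"
  using determined_pos[of "QAdd t (QScale (-1) s)"] by simp

lemma determined_eq: "determined (\<lambda>e. qval e s = qval e t)"
proof -
  have "(\<lambda>e. qval e s = qval e t) = (\<lambda>e. \<not> qval e s < qval e t \<and> \<not> qval e t < qval e s)" by auto
  then show ?thesis by (simp only: determined_conj determined_not determined_less)
qed

lemma determined_ex:
  assumes "determined Q"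
  shows "determined (\<lambda>e. \<exists>x. Q (e(v := x)))"
proof -
  from assms obtain \<Phi> where \<Phi>: "finite \<Phi>" "\<And>e e'. agree \<Phi> e e' \<Longrightarrow> Q e \<longleftrightarrow> Q e'"
    unfolding determined_def by blast
  obtain \<Psi> where \<Psi>: "finite \<Psi>"
    "\<forall>e e'. agree \<Psi> e e' \<longrightarrow> (\<forall>c. \<exists>d. agree \<Phi> (e(v := c)) (e'(v := d)))"
    using back_and_forth[OF \<Phi>(1), of v] by (elim exE conjE)
  show ?thesis
  proof (rule determinedI[OF \<Psi>(1)])
    show "(\<exists>x. Q (e(v := x))) \<longleftrightarrow> (\<exists>x. Q (e'(v := x)))" if "agree \<Psi> e e'" for e e'
    proof -
      from \<Psi>(2) that have 1: "\<exists>d. agree \<Phi> (e(v := c)) (e'(v := d))" for c by simp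
      from \<Psi>(2) agree_sym[OF that] have 2: "\<exists>d. agree \<Phi> (e'(v := c)) (e(v := d))" for c by simp
      show ?thesis
      proof
        assume "\<exists>x. Q (e(v := x))"
        then obtain c where c: "Q (e(v := c))" by (elim exE)
        from 1[of c] obtain d where "agree \<Phi> (e(v := c)) (e'(v := d))" by (elim exE)
        from \<Phi>(2)[OF this] c show "\<exists>x. Q (e'(v := x))" by (intro exI[of _ d]) simp
      next
        assume "\<exists>x. Q (e'(v := x))"
        then obtain c where c: "Q (e'(v := c))" by (elim exE)
        from 2[of c] obtain d where "agree \<Phi> (e'(v := c)) (e(v := d))" by (elim exE)
        from \<Phi>(2)[OF this] c show "\<exists>x. Q (e(v := x))" by (intro exI[of _ d]) simp
      qed
    qed
  qed
qed

primrec qterm_of :: "tm \<Rightarrow> qterm" where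
  "qterm_of (Var v) = QVar v"
| "qterm_of Zero = QConst 0"
| "qterm_of (Add s t) = QAdd (qterm_of s) (qterm_of t)"

lemma val_int_struc: "val (int_struc R) e t = qval e (qterm_of t)"
  by (induction t) (auto simp: int_struc_def)

theorem determined_sat: "determined (\<lambda>e. sat (int_struc (range r)) e \<phi>)"
proof (induction \<phi>)
  case (Eq s t)
  then show ?case by (simp add: val_int_struc determined_eq)
next
  case (Less s t)
  then show ?case using determined_less by (simp add: val_int_struc) (simp add: int_struc_def)
next
  case (Rel t)
  have "sat (int_struc (range r)) e (Rel t) \<longleftrightarrow> qval e (QShift 0 (qterm_of t)) = qval e (qterm_of t)" for e
    using in_range_iff_shift by (simp add: val_int_struc) (simp add: int_struc_def)
  then show ?case by (simp only: determined_eq)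
next
  case (Neg \<phi>)
  then show ?case by (simp add: determined_not)
next
  case (Conj \<phi> \<psi>)
  then show ?case by (simp add: determined_conj)
next
  case (Exi v \<phi>)
  have "sat (int_struc (range r)) e (Exi v \<phi>) \<longleftrightarrow> (\<exists>x. sat (int_struc (range r)) (e(v := x)) \<phi>)" for e
    by (simp add: int_struc_def)
  then show ?case by (simp only:) (rule determined_ex[OF Exi])
qed

end

section \<open>Counting classes\<close>

text \<open>
  As \<open>b\<close> varies, the number of values is polynomial in \<open>n\<close>, uniformly in \<open>a\<close>. Powers of \<open>n + 2\<close>
  bound all polynomials, constants included, also at \<open>n = 0\<close>.
\<close>

definition few :: "(nat \<Rightarrow> 'a \<Rightarrow> 'b \<Rightarrow> 'c) \<Rightarrow> bool" where
  "few c \<longleftrightarrow> (\<exists>d. \<forall>n a. finite (range (c n a)) \<and> card (range (c n a)) \<le> (n + 2) ^ d)"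

lemma fewI: "(\<And>n a. finite (range (c n a))) \<Longrightarrow> (\<And>n a. card (range (c n a)) \<le> (n + 2) ^ d) \<Longrightarrow> few c"
  by (auto simp: few_def)

lemma few_factor:
  assumes "few c" and eq: "\<And>n a b b'. c n a b = c n a b' \<Longrightarrow> s n a b = s n a b'"
  shows "few s"
proof -
  obtain d where d: "\<And>n a. finite (range (c n a))" "\<And>n a. card (range (c n a)) \<le> (n + 2) ^ d"
    using assms(1) by (auto simp: few_def)
  have sub: "range (s n a) \<subseteq> (\<lambda>\<gamma>. s n a (SOME b. c n a b = \<gamma>)) ` range (c n a)" for n a
  proof
    fix x assume "x \<in> range (s n a)"
    then obtain b where x: "x = s n a b" by blast
    have "c n a (SOME b'. c n a b' = c n a b) = c n a b" by (rule someI) simp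
    then show "x \<in> (\<lambda>\<gamma>. s n a (SOME b. c n a b = \<gamma>)) ` range (c n a)"
      unfolding x by (intro image_eqI[of _ _ "c n a b"]) (auto intro: eq[symmetric])
  qed
  show ?thesis
  proof (rule fewI)
    fix n a
    show "finite (range (s n a))" using finite_subset[OF sub] d(1) by blast
    have "card (range (s n a)) \<le> card (range (c n a))"
      using surj_card_le[OF d(1) sub] .
    then show "card (range (s n a)) \<le> (n + 2) ^ d" using d(2) by (rule order_trans)
  qed
qed

lemma few_pair:
  assumes "few c" "few c'"
  shows "few (\<lambda>n a b. (c n a b, c' n a b))"
proof -
  obtain d where d: "\<And>n a. finite (range (c n a))" "\<And>n a. card (range (c n a)) \<le> (n + 2) ^ d"
    using assms(1) by (auto simp: few_def)
  obtain d' where d': "\<And>n a. finite (range (c' n a))" "\<And>n a. card (range (c' n a)) \<le> (n + 2) ^ d'"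
    using assms(2) by (auto simp: few_def)
  show ?thesis
  proof (rule fewI)
    fix n a
    have sub: "range (\<lambda>b. (c n a b, c' n a b)) \<subseteq> range (c n a) \<times> range (c' n a)" by auto
    show "finite (range (\<lambda>b. (c n a b, c' n a b)))" using finite_subset[OF sub] d(1) d'(1) by blast
    have "card (range (\<lambda>b. (c n a b, c' n a b))) \<le> card (range (c n a)) * card (range (c' n a))"
      using card_mono[OF _ sub] d(1) d'(1) by (simp add: card_cartesian_product)
    also have "\<dots> \<le> (n + 2) ^ d * (n + 2) ^ d'" by (intro mult_mono d d') auto
    finally show "card (range (\<lambda>b. (c n a b, c' n a b))) \<le> (n + 2) ^ (d + d')" by (simp add: power_add)
  qed
qed

lemma few_bounded:
  assumes "finite S" "\<And>n a b. c n a b \<in> S"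
  shows "few c"
proof (rule fewI)
  fix n a
  have sub: "range (c n a) \<subseteq> S" using assms(2) by auto
  show "finite (range (c n a))" using finite_subset[OF sub assms(1)] .
  have "card (range (c n a)) \<le> card S" using card_mono[OF assms(1) sub] .
  also have "\<dots> \<le> 2 ^ card S" by (rule less_imp_le[OF less_exp])
  also have "\<dots> \<le> (n + 2) ^ card S" by (intro power_mono) auto
  finally show "card (range (c n a)) \<le> (n + 2) ^ card S" .
qed

lemma few_index:
  assumes "\<And>n a b. c n a b \<le> n"
  shows "few c"
proof (rule fewI[where d = 1])
  fix n a
  have sub: "range (c n a) \<subseteq> {..n}" using assms by auto
  show "finite (range (c n a))" using finite_subset[OF sub] by simp
  show "card (range (c n a)) \<le> (n + 2) ^ 1" using card_mono[OF _ sub] by simp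
qed

lemma few_fun:
  assumes "finite I" "\<And>k. k \<in> I \<Longrightarrow> few (c k)"
  shows "few (\<lambda>n a b k. if k \<in> I then c k n a b else undefined)"
  using assms
proof (induction I)
  case empty
  show ?case by (rule few_bounded[of "{\<lambda>k. undefined}"]) auto
next
  case (insert x I)
  have "few (\<lambda>n a b. (\<lambda>k. if k \<in> I then c k n a b else undefined, c x n a b))"
    using insert by (intro few_pair) auto
  then show ?case
  proof (rule few_factor)
    fix n a b b'
    assume eq: "(\<lambda>k. if k \<in> I then c k n a b else undefined, c x n a b) =
      (\<lambda>k. if k \<in> I then c k n a b' else undefined, c x n a b')"
    have "c k n a b = c k n a b'" if "k \<in> I" for k
      using eq that by (auto dest: fun_cong[of _ _ k])
    with eq show "(\<lambda>k. if k \<in> insert x I then c k n a b else undefined) =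
      (\<lambda>k. if k \<in> insert x I then c k n a b' else undefined)" by auto
  qed
qed

text \<open>
  For each value of \<open>c\<close> the sets form a chain of subsets of \<open>{..<n}\<close>, so there are at most \<open>n + 1\<close>
  of them.
\<close>

lemma few_threshold:
  fixes G :: "nat \<Rightarrow> 'a \<Rightarrow> 'c \<Rightarrow> nat \<Rightarrow> int"
  assumes "few c"
  shows "few (\<lambda>n a b. {i. i < n \<and> G n a (c n a b) i \<le> H n a b})"
proof -
  obtain d where d: "\<And>n a. finite (range (c n a))" "\<And>n a. card (range (c n a)) \<le> (n + 2) ^ d"
    using assms by (auto simp: few_def)
  show ?thesis
  proof (rule fewI)
    fix n a
    define T where "T \<gamma> x = {i. i < n \<and> G n a \<gamma> i \<le> x}" for \<gamma> x
    have fin: "finite (T \<gamma> x)" for \<gamma> x by (simp add: T_def)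
    have inj: "inj_on card (range (T \<gamma>))" for \<gamma>
    proof (rule inj_onI)
      fix A B assume "A \<in> range (T \<gamma>)" "B \<in> range (T \<gamma>)" and eq: "card A = card B"
      then obtain x y where xy: "A = T \<gamma> x" "B = T \<gamma> y" by blast
      then have "A \<subseteq> B \<or> B \<subseteq> A" using linear[of x y] by (auto simp: T_def)
      with eq show "A = B" using fin xy by (metis card_subset_eq)
    qed
    have im: "card ` range (T \<gamma>) \<subseteq> {..n}" for \<gamma>
    proof -
      have "T \<gamma> x \<subseteq> {..<n}" for x by (auto simp: T_def)
      then have "card (T \<gamma> x) \<le> n" for x by (metis card_lessThan card_mono finite_lessThan)
      then show ?thesis by auto
    qed
    have fT: "finite (range (T \<gamma>))" for \<gamma>
      using inj_on_finite[OF inj im] by simp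
    have cT: "card (range (T \<gamma>)) \<le> n + 1" for \<gamma>
      using card_inj_on_le[OF inj im] by simp
    have sub: "range (\<lambda>b. {i. i < n \<and> G n a (c n a b) i \<le> H n a b}) \<subseteq> (\<Union>\<gamma>\<in>range (c n a). range (T \<gamma>))"
      by (auto simp: T_def)
    have fU: "finite (\<Union>\<gamma>\<in>range (c n a). range (T \<gamma>))" using d(1) fT by blast
    show "finite (range (\<lambda>b. {i. i < n \<and> G n a (c n a b) i \<le> H n a b}))"
      using finite_subset[OF sub fU] .
    have "card (range (\<lambda>b. {i. i < n \<and> G n a (c n a b) i \<le> H n a b})) \<le> card (\<Union>\<gamma>\<in>range (c n a). range (T \<gamma>))"
      using card_mono[OF fU sub] .
    also have "\<dots> \<le> (\<Sum>\<gamma>\<in>range (c n a). card (range (T \<gamma>)))" by (rule card_UN_le[OF d(1)])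
    also have "\<dots> \<le> card (range (c n a)) * (n + 1)"
      using sum_bounded_above[of "range (c n a)" "\<lambda>\<gamma>. card (range (T \<gamma>))" "n + 1"] cT by simp
    also have "\<dots> \<le> (n + 2) ^ d * (n + 2)" by (intro mult_mono d) auto
    finally show "card (range (\<lambda>b. {i. i < n \<and> G n a (c n a b) i \<le> H n a b})) \<le> (n + 2) ^ (d + 1)"
      by (simp add: algebra_simps)
  qed
qed

text \<open>
  The code \<open>c\<close> tells the class of \<open>b\<close>. On each class, \<open>\<chi>\<close> colours the indices \<open>i\<close> with \<open>N\<close> colours,
  and among indices of one colour \<open>f\<close> is the sum of a function of \<open>i\<close> and a function of \<open>b\<close>.
\<close>

definition splits :: "(nat \<Rightarrow> 'a \<Rightarrow> nat \<Rightarrow> 'b \<Rightarrow> int) \<Rightarrow> bool" where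
  "splits f \<longleftrightarrow> (\<exists>(c :: nat \<Rightarrow> 'a \<Rightarrow> 'b \<Rightarrow> nat) (N :: nat) \<chi> g h. few c \<and>
     (\<forall>n a b i. i < n \<longrightarrow> \<chi> n a (c n a b) i < N \<and> 
        f n a i b = g n a (c n a b) i + h n a (\<chi> n a (c n a b) i) b))"

text \<open>Codes and colours may come from any types, since only their equality matters.\<close>

lemma splitsI:
  fixes c :: "nat \<Rightarrow> 'a \<Rightarrow> 'b \<Rightarrow> 'c" and \<chi> :: "nat \<Rightarrow> 'a \<Rightarrow> 'c \<Rightarrow> nat \<Rightarrow> 'k"
  assumes c: "few c" and S: "finite S"
    and col: "\<And>n a b i. i < n \<Longrightarrow> \<chi> n a (c n a b) i \<in> S"
    and f: "\<And>n a b i. i < n \<Longrightarrow> f n a i b = g n a (c n a b) i + h n a (\<chi> n a (c n a b) i) b"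
  shows "splits f"
proof -
  define c' where "c' n a b = to_nat_on (range (c n a)) (c n a b)" for n a b
  define \<chi>' where "\<chi>' n a m i = to_nat_on S (\<chi> n a (from_nat_into (range (c n a)) m) i)" for n a m i
  define g' where "g' n a m i = g n a (from_nat_into (range (c n a)) m) i" for n a m i
  define h' where "h' n a m b = h n a (from_nat_into S m) b" for n a m b
  have fin: "countable (range (c n a))" for n a
    using c by (auto simp: few_def intro: countable_finite)
  have dec: "from_nat_into (range (c n a)) (c' n a b) = c n a b" for n a b
    unfolding c'_def using fin by (intro from_nat_into_to_nat_on) auto
  have "few c'" by (rule few_factor[OF c]) (simp add: c'_def)
  moreover have "\<chi>' n a (c' n a b) i < card S \<and> f n a i b = g' n a (c' n a b) i + h' n a (\<chi>' n a (c' n a b) i) b"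
    if "i < n" for n a b i
  proof
    show "\<chi>' n a (c' n a b) i < card S"
      unfolding \<chi>'_def dec using to_nat_on_finite[OF S] col[OF that] by (auto simp: bij_betw_def)
    have "from_nat_into S (to_nat_on S (\<chi> n a (c n a b) i)) = \<chi> n a (c n a b) i"
      using countable_finite[OF S] col[OF that] by (intro from_nat_into_to_nat_on)
    then show "f n a i b = g' n a (c' n a b) i + h' n a (\<chi>' n a (c' n a b) i) b"
      unfolding g'_def h'_def \<chi>'_def dec using f[OF that] by simp
  qed
  ultimately show ?thesis unfolding splits_def by blast
qed

lemma splitsE:
  fixes f :: "nat \<Rightarrow> 'a \<Rightarrow> nat \<Rightarrow> 'b \<Rightarrow> int"
  assumes "splits f"
  obtains c :: "nat \<Rightarrow> 'a \<Rightarrow> 'b \<Rightarrow> nat" and \<chi> and N :: nat and g h where "few c"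
    "\<And>n a b i. i < n \<Longrightarrow> \<chi> n a (c n a b) i < N"
    "\<And>n a b i. i < n \<Longrightarrow> f n a i b = g n a (c n a b) i + h n a (\<chi> n a (c n a b) i) b"
proof -
  from assms obtain c :: "nat \<Rightarrow> 'a \<Rightarrow> 'b \<Rightarrow> nat" and N :: nat and \<chi> g h where "few c"
    "\<forall>n a b i. i < n \<longrightarrow> \<chi> n a (c n a b) i < N \<and>
        f n a i b = g n a (c n a b) i + h n a (\<chi> n a (c n a b) i) b"
    unfolding splits_def by (elim exE conjE)
  then show thesis by (intro that[of c \<chi> N g h]) simp_all
qed

lemma splits_left: "splits (\<lambda>n a i b. g n a i)"
  by (rule splitsI[of "\<lambda>_ _ _. ()" "{()}" "\<lambda>_ _ _ _. ()" _ "\<lambda>n a _. g n a" "\<lambda>_ _ _ _. 0"])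
     (auto intro: few_bounded[of "{()}"])

lemma splits_right: "splits (\<lambda>n a i b. h n a b)"
  by (rule splitsI[of "\<lambda>_ _ _. ()" "{()}" "\<lambda>_ _ _ _. ()" _ "\<lambda>_ _ _ _. 0" "\<lambda>n a _. h n a"])
     (auto intro: few_bounded[of "{()}"])

lemma splits_add:
  assumes "splits f" "splits f'"
  shows "splits (\<lambda>n a i b. f n a i b + f' n a i b)"
proof -
  obtain c :: "nat \<Rightarrow> 'a \<Rightarrow> 'b \<Rightarrow> nat" and \<chi> and N :: nat and g h where 1: "few c"
    "\<And>n a b i. i < n \<Longrightarrow> \<chi> n a (c n a b) i < N"
    "\<And>n a b i. i < n \<Longrightarrow> f n a i b = g n a (c n a b) i + h n a (\<chi> n a (c n a b) i) b"
    by (rule splitsE[OF assms(1)]) (rule that)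
  obtain c' :: "nat \<Rightarrow> 'a \<Rightarrow> 'b \<Rightarrow> nat" and \<chi>' and N' :: nat and g' h' where 2: "few c'"
    "\<And>n a b i. i < n \<Longrightarrow> \<chi>' n a (c' n a b) i < N'"
    "\<And>n a b i. i < n \<Longrightarrow> f' n a i b = g' n a (c' n a b) i + h' n a (\<chi>' n a (c' n a b) i) b"
    by (rule splitsE[OF assms(2)]) (rule that)
  show ?thesis
    by (rule splitsI[OF few_pair[OF 1(1) 2(1)], of "{..<N} \<times> {..<N'}" 
          "\<lambda>n a (m, m') i. (\<chi> n a m i, \<chi>' n a m' i)" _
          "\<lambda>n a (m, m') i. g n a m i + g' n a m' i" "\<lambda>n a (k, k') b. h n a k b + h' n a k' b"])
       (simp_all add: 1 2)
qed

lemma splits_scale: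
  assumes "splits f"
  shows "splits (\<lambda>n a i b. k * f n a i b)"
proof -
  obtain c :: "nat \<Rightarrow> 'a \<Rightarrow> 'b \<Rightarrow> nat" and \<chi> and N :: nat and g h where 1: "few c"
    "\<And>n a b i. i < n \<Longrightarrow> \<chi> n a (c n a b) i < N"
    "\<And>n a b i. i < n \<Longrightarrow> f n a i b = g n a (c n a b) i + h n a (\<chi> n a (c n a b) i) b"
    by (rule splitsE[OF assms(1)]) (rule that)
  show ?thesis
    by (rule splitsI[OF 1(1), of "{..<N}" \<chi> _ "\<lambda>n a m i. k * g n a m i" "\<lambda>n a m b. k * h n a m b"])
       (simp_all add: 1 algebra_simps)
qed

lemma few_positive:
  assumes "splits f"
  shows "few (\<lambda>n a b. {i. i < n \<and> 0 < f n a i b})"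
proof -
  obtain c :: "nat \<Rightarrow> 'a \<Rightarrow> 'b \<Rightarrow> nat" and \<chi> and N :: nat and g h where 1: "few c"
    "\<And>n a b i. i < n \<Longrightarrow> \<chi> n a (c n a b) i < N"
    "\<And>n a b i. i < n \<Longrightarrow> f n a i b = g n a (c n a b) i + h n a (\<chi> n a (c n a b) i) b"
    by (rule splitsE[OF assms(1)]) (rule that)
  define T where "T \<kappa> n a b = {i. i < n \<and> 1 - g n a (c n a b) i \<le> h n a \<kappa> b}" for \<kappa> n a b
  have "few (\<lambda>n a b. (c n a b, \<lambda>\<kappa>. if \<kappa> \<in> {..<N} then T \<kappa> n a b else undefined))"
    unfolding T_def by (intro few_pair few_fun 1 few_threshold) auto
  then show ?thesis
  proof (rule few_factor)
    fix n a b b'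
    assume eq: "(c n a b, \<lambda>\<kappa>. if \<kappa> \<in> {..<N} then T \<kappa> n a b else undefined) =
       (c n a b', \<lambda>\<kappa>. if \<kappa> \<in> {..<N} then T \<kappa> n a b' else undefined)"
    then have "T \<kappa> n a b = T \<kappa> n a b'" if "\<kappa> < N" for \<kappa> using that by (auto dest: fun_cong[of _ _ \<kappa>])
    moreover have "{i. i < n \<and> 0 < f n a i b} = {i. i < n \<and> i \<in> T (\<chi> n a (c n a b) i) n a b}" for b
      using 1(3) by (auto simp: T_def)
    ultimately show "{i. i < n \<and> 0 < f n a i b} = {i. i < n \<and> 0 < f n a i b'}"
      using 1(2) eq by auto
  qed
qed

lemma few_mod:
  assumes "splits f" and m: "m > 0"
  shows "few (\<lambda>n a b i. if i < n then f n a i b mod m else undefined)"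
proof -
  obtain c :: "nat \<Rightarrow> 'a \<Rightarrow> 'b \<Rightarrow> nat" and \<chi> and N :: nat and g h where 1: "few c"
    "\<And>n a b i. i < n \<Longrightarrow> \<chi> n a (c n a b) i < N"
    "\<And>n a b i. i < n \<Longrightarrow> f n a i b = g n a (c n a b) i + h n a (\<chi> n a (c n a b) i) b"
    by (rule splitsE[OF assms(1)]) (rule that)
  have "few (\<lambda>n a b. h n a \<kappa> b mod m)" for \<kappa>
    by (rule few_bounded[of "{0..<m}"]) (use m in auto)
  then have "few (\<lambda>n a b. (c n a b, \<lambda>\<kappa>. if \<kappa> \<in> {..<N} then h n a \<kappa> b mod m else undefined))"
    by (intro few_pair few_fun 1) auto
  then show ?thesis
  proof (rule few_factor)
    fix n a b b'
    assume eq: "(c n a b, \<lambda>\<kappa>. if \<kappa> \<in> {..<N} then h n a \<kappa> b mod m else undefined) =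
       (c n a b', \<lambda>\<kappa>. if \<kappa> \<in> {..<N} then h n a \<kappa> b' mod m else undefined)"
    then have h: "h n a \<kappa> b mod m = h n a \<kappa> b' mod m" if "\<kappa> < N" for \<kappa> 
      using that by (auto dest: fun_cong[of _ _ \<kappa>])
    have "f n a i b mod m = f n a i b' mod m" if "i < n" for i
      using 1(3)[OF that, of a b] 1(3)[OF that, of a b'] h[OF 1(2)[OF that]] eq by (auto intro: mod_add_cong)
    then show "(\<lambda>i. if i < n then f n a i b mod m else undefined) = (\<lambda>i. if i < n then f n a i b' mod m else undefined)"
      by auto
  qed
qed

context sparse_sequence
begin

text \<open>The larger one of \<open>A\<close> and \<open>B\<close> is comparable with \<open>u\<close> up to a factor of \<open>2\<close>.\<close>

lemma cnt_sum_close: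
  "\<exists>K. \<forall>u A B. 0 \<le> u \<longrightarrow> 0 \<le> A \<longrightarrow> A \<le> u \<longrightarrow> 0 \<le> B \<longrightarrow> u \<le> A + B \<longrightarrow> B \<le> u + A \<longrightarrow>
     \<bar>int (cnt u) - int (cnt A)\<bar> \<le> int K \<or> \<bar>int (cnt u) - int (cnt B)\<bar> \<le> int K"
proof -
  obtain K where K: "\<And>x. x \<ge> 0 \<Longrightarrow> cnt (2 * x) \<le> cnt x + K" using cnt_mult_le by blast
  show ?thesis
  proof (intro exI[of _ K] allI impI)
    fix u A B :: int
    assume *: "0 \<le> u" "0 \<le> A" "A \<le> u" "0 \<le> B" "u \<le> A + B" "B \<le> u + A"
    show "\<bar>int (cnt u) - int (cnt A)\<bar> \<le> int K \<or> \<bar>int (cnt u) - int (cnt B)\<bar> \<le> int K"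
    proof (cases "B \<le> A")
      case True
      with * have "cnt u \<le> cnt (2 * A)" "cnt A \<le> cnt u" by (auto intro: cnt_mono)
      with K[of A] * show ?thesis by linarith
    next
      case False
      with * have "cnt u \<le> cnt (2 * B)" "cnt B \<le> cnt (2 * u)" by (auto intro: cnt_mono)
      with K[of B] K[of u] * show ?thesis by linarith
    qed
  qed
qed

lemma cnt_eq_iff:
  assumes "l = int e - x" "e > 0"
  shows "cnt u = e \<longleftrightarrow> u < int (r (nat (x + l))) \<and> \<not> u < int (r (nat (x + (l - 1))))"
proof -
  have "nat (x + l) = e" "nat (x + (l - 1)) = e - 1" using assms by auto
  then show ?thesis using assms(2) by (auto simp flip: cnt_le_iff)
qed

lemma cnt_eq_from_bounds:
  assumes "u < int (r (nat (x + l)))" "\<not> u < int (r (nat (x + (l - 1))))"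
  shows "cnt u = nat (x + l)"
proof -
  have "cnt u \<le> nat (x + l)" "nat (x + (l - 1)) < cnt u"
    using assms by (simp_all add: cnt_le_iff less_cnt_iff)
  then show ?thesis by linarith
qed

text \<open>
  For each colour, the code is refined by an index \<open>best\<close> that minimises the absolute value of \<open>f\<close>
  among the indices of this colour. By \<open>cnt_sum_close\<close>, the position of \<open>f\<close> at any other such index
  differs by a bounded number \<open>l\<close> from that of \<open>A\<close>, the minimal value, or from that of \<open>B\<close>, the
  difference of the two values of \<open>g\<close>. The sets \<open>S\<close> and \<open>W\<close> of indices record which case occurs for
  which \<open>l\<close>. Both are given by thresholds, because \<open>A\<close> does not depend on \<open>i\<close>, and \<open>B\<close> depends on \<open>b\<close>
  only through the code.
\<close>

lemma splits_shift:
  fixes f :: "nat \<Rightarrow> 'a \<Rightarrow> nat \<Rightarrow> 'b \<Rightarrow> int"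
  assumes "splits f"
  shows "splits (\<lambda>n a i b. shift j (f n a i b))"
proof -
  obtain c :: "nat \<Rightarrow> 'a \<Rightarrow> 'b \<Rightarrow> nat" and \<chi> and N :: nat and g h where c: "few c"
    and \<chi>: "\<And>n a b i. i < n \<Longrightarrow> \<chi> n a (c n a b) i < N"
    and f: "\<And>n a b i. i < n \<Longrightarrow> f n a i b = g n a (c n a b) i + h n a (\<chi> n a (c n a b) i) b"
    by (rule splitsE[OF assms(1)]) (rule that)
  obtain K where K: "\<And>u A B. 0 \<le> u \<Longrightarrow> 0 \<le> A \<Longrightarrow> A \<le> u \<Longrightarrow> 0 \<le> B \<Longrightarrow> u \<le> A + B \<Longrightarrow> B \<le> u + A \<Longrightarrow>
     \<bar>int (cnt u) - int (cnt A)\<bar> \<le> int K \<or> \<bar>int (cnt u) - int (cnt B)\<bar> \<le> int K"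
    using cnt_sum_close by blast
  define colour_class where "colour_class n a b \<kappa> = {i. i < n \<and> \<chi> n a (c n a b) i = \<kappa>}" for n a b \<kappa>
  define best where "best \<kappa> n a b = (if colour_class n a b \<kappa> = {} then n else
      (SOME i. i \<in> colour_class n a b \<kappa> \<and> (\<forall>k\<in>colour_class n a b \<kappa>. \<bar>f n a i b\<bar> \<le> \<bar>f n a k b\<bar>)))" for \<kappa> n a b
  have best: "best \<kappa> n a b \<in> colour_class n a b \<kappa>" "\<And>k. k \<in> colour_class n a b \<kappa> \<Longrightarrow> \<bar>f n a (best \<kappa> n a b) b\<bar> \<le> \<bar>f n a k b\<bar>"
    if "colour_class n a b \<kappa> \<noteq> {}" for n a b \<kappa>
  proof -
    have fin: "finite (colour_class n a b \<kappa>)" by (simp add: colour_class_def)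
    have "\<exists>i. i \<in> colour_class n a b \<kappa> \<and> (\<forall>k\<in>colour_class n a b \<kappa>. \<bar>f n a i b\<bar> \<le> \<bar>f n a k b\<bar>)"
      using ex_is_arg_min_if_finite[OF fin that, of "\<lambda>i. \<bar>f n a i b\<bar>"]
      by (auto simp: is_arg_min_def not_less)
    then have "best \<kappa> n a b \<in> colour_class n a b \<kappa> \<and> (\<forall>k\<in>colour_class n a b \<kappa>. \<bar>f n a (best \<kappa> n a b) b\<bar> \<le> \<bar>f n a k b\<bar>)"
      unfolding best_def using that by (simp only: if_False) (rule someI_ex)
    then show "best \<kappa> n a b \<in> colour_class n a b \<kappa>" "\<And>k. k \<in> colour_class n a b \<kappa> \<Longrightarrow> \<bar>f n a (best \<kappa> n a b) b\<bar> \<le> \<bar>f n a k b\<bar>"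
      by blast+
  qed
  have "best \<kappa> n a b \<le> n" for \<kappa> n a b
    using best(1)[of n a b \<kappa>] by (cases "colour_class n a b \<kappa> = {}") (auto simp: best_def colour_class_def)
  then have few_best: "few (best \<kappa>)" for \<kappa> by (rule few_index)
  define A where "A \<kappa> n a b = \<bar>f n a (best \<kappa> n a b) b\<bar>" for \<kappa> n a b
  define S where "S = (\<lambda>(\<kappa>, l) n a b. {i. i < n \<and> g n a (c n a b) i \<le> int (r (nat (int (cnt (A \<kappa> n a b)) + l))) - 1 - h n a \<kappa> b})"
  define B where "B n a m k i = \<bar>g n a m i - g n a m k\<bar>" for n a m k i
  define W where "W = (\<lambda>(\<kappa>, l) n a b. {i. i < n \<and> 
     g n a (c n a b) i + 1 - int (r (nat (int (cnt (B n a (c n a b) (best \<kappa> n a b) i)) + l))) \<le> - h n a \<kappa> b})"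
  have few_S: "few (S p)" for p
  proof (cases p)
    case (Pair \<kappa> l)
    show ?thesis unfolding S_def Pair prod.case
      by (rule few_threshold[OF c, of "\<lambda>n a m i. g n a m i"])
  qed
  have few_W: "few (W p)" for p
  proof (cases p)
    case (Pair \<kappa> l)
    show ?thesis unfolding W_def Pair prod.case
      using few_threshold[OF few_pair[OF c few_best[of \<kappa>]], of 
        "\<lambda>n a (m, k) i. g n a m i + 1 - int (r (nat (int (cnt (B n a m k i)) + l)))" "\<lambda>n a b. - h n a \<kappa> b"]
      by simp
  qed
  \<comment> \<open>\<open>I\<close> has one displacement more than \<open>L\<close>, since \<open>l\<close> will be compared with \<open>l - 1\<close>\<close>
  define L where "L = {- int K..int K}"
  define I where "I = {..<N} \<times> {- int K - 1..int K}"
  define code where "code n a b = (c n a b, (\<lambda>\<kappa>. if \<kappa> \<in> {..<N} then best \<kappa> n a b else undefined),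
     (\<lambda>p. if p \<in> I then S p n a b else undefined), (\<lambda>p. if p \<in> I then W p n a b else undefined))" for n a b
  have "finite I" by (simp add: I_def)
  then have few_code: "few code" unfolding code_def
    by (intro few_pair few_fun c few_best few_S few_W finite_lessThan)
  \<comment> \<open>membership at \<open>l\<close> but not at \<open>l - 1\<close> pins down the position exactly\<close>
  define lA where "lA s \<kappa> i = (SOME l. l \<in> L \<and> i \<in> s (\<kappa>, l) \<and> i \<notin> s (\<kappa>, l - 1))" 
    for s :: "nat \<times> int \<Rightarrow> nat set" and \<kappa> i
  define okA where "okA s \<kappa> i \<longleftrightarrow> (\<exists>l. l \<in> L \<and> i \<in> s (\<kappa>, l) \<and> i \<notin> s (\<kappa>, l - 1))" 
    for s :: "nat \<times> int \<Rightarrow> nat set" and \<kappa> i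
  have lA: "lA s \<kappa> i \<in> L \<and> i \<in> s (\<kappa>, lA s \<kappa> i) \<and> i \<notin> s (\<kappa>, lA s \<kappa> i - 1)" if "okA s \<kappa> i" for s \<kappa> i
    using that unfolding okA_def lA_def by (rule someI_ex)
  \<comment> \<open>With colour \<open>Some (\<kappa>, l)\<close> the value is a function of \<open>b\<close>, with colour \<open>None\<close> a function of \<open>i\<close>.\<close>
  define \<chi>' where "\<chi>' n a = (\<lambda>(m, bs :: nat \<Rightarrow> nat, s, w :: nat \<times> int \<Rightarrow> nat set) i. let \<kappa> = \<chi> n a m i in if okA s \<kappa> i then Some (\<kappa>, lA s \<kappa> i) else None)"
    for n :: nat and a :: 'a
  define g' where "g' n a = (\<lambda>(m, bs, s, w) i. let \<kappa> = \<chi> n a m i in if okA s \<kappa> i then 0 else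
      if okA w \<kappa> i then int (r (nat (int (nat (int (cnt (B n a m (bs \<kappa>) i)) + lA w \<kappa> i)) - 1 + j))) 
      else int (r (nat (j - 1))))" for n :: nat and a :: 'a
  define h' where "h' n a k b = (case k of None \<Rightarrow> 0 | Some (\<kappa>, l) \<Rightarrow>
      int (r (nat (int (nat (int (cnt (A \<kappa> n a b)) + l)) - 1 + j))))" for n :: nat and a k b
  show ?thesis
  proof (rule splitsI[OF few_code, of "insert None (Some ` ({..<N} \<times> L))" \<chi>' _ g' h'])
    show "finite (insert None (Some ` ({..<N} \<times> L)))" by (simp add: L_def)
    fix n a b i assume i: "i < (n::nat)"
    define \<kappa> where "\<kappa> = \<chi> n a (c n a b) i"
    have \<kappa>: "\<kappa> < N" using \<chi>[OF i] by (simp add: \<kappa>_def)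
    define u where "u = f n a i b"
    have u: "u = g n a (c n a b) i + h n a \<kappa> b" by (simp add: u_def \<kappa>_def f[OF i])
    define s where "s = (\<lambda>p. if p \<in> I then S p n a b else undefined)"
    define w where "w = (\<lambda>p. if p \<in> I then W p n a b else undefined)"
    define k where "k = best \<kappa> n a b"
    have i_mem: "i \<in> colour_class n a b \<kappa>" using i by (simp add: colour_class_def \<kappa>_def)
    have k: "k \<in> colour_class n a b \<kappa>" "\<bar>f n a k b\<bar> \<le> \<bar>u\<bar>"
      unfolding k_def u_def using best[of n a b \<kappa>] i_mem by blast+
    have k_eq: "f n a k b = g n a (c n a b) k + h n a \<kappa> b"
      using k(1) f[of k n a b] by (simp add: colour_class_def)
    define X where "X = int (cnt (A \<kappa> n a b))"
    define Y where "Y = int (cnt (B n a (c n a b) k i))"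
    have s_iff: "i \<in> s (\<kappa>, l) \<longleftrightarrow> u < int (r (nat (X + l)))" if "(\<kappa>, l) \<in> I" for l
      using that i by (auto simp: s_def S_def u X_def)
    have w_iff: "i \<in> w (\<kappa>, l) \<longleftrightarrow> u < int (r (nat (Y + l)))" if "(\<kappa>, l) \<in> I" for l
      using that i by (auto simp: w_def W_def u Y_def k_def)
    have inI: "(\<kappa>, l) \<in> I" "(\<kappa>, l - 1) \<in> I" if "l \<in> L" for l
      using that \<kappa> by (auto simp: I_def L_def)
    have code: "code n a b = (c n a b, (\<lambda>\<kappa>. if \<kappa> \<in> {..<N} then best \<kappa> n a b else undefined), s, w)"
      by (simp add: code_def s_def w_def)
    show "\<chi>' n a (code n a b) i \<in> insert None (Some ` ({..<N} \<times> L))"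
      using \<kappa> lA[of s \<kappa> i] by (auto simp: \<chi>'_def code \<kappa>_def[symmetric] Let_def)
    have via_s: "cnt u = nat (X + lA s \<kappa> i)" if "okA s \<kappa> i"
      using lA[OF that] s_iff inI by (intro cnt_eq_from_bounds) auto
    have via_w: "cnt u = nat (Y + lA w \<kappa> i)" if "okA w \<kappa> i"
      using lA[OF that] w_iff inI by (intro cnt_eq_from_bounds) auto
    have none: "cnt u = 0" if "\<not> okA s \<kappa> i" "\<not> okA w \<kappa> i"
    proof (rule ccontr)
      assume e: "cnt u \<noteq> 0"
      have "u \<ge> 0" using e less_cnt_iff[of 0 u] by simp
      have "\<bar>int (cnt u) - X\<bar> \<le> int K \<or> \<bar>int (cnt u) - Y\<bar> \<le> int K"
        unfolding X_def Y_def
        by (rule K) (use \<open>u \<ge> 0\<close> k(2) k_eq u in \<open>auto simp: A_def B_def k_def[symmetric]\<close>)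
      then show False
      proof
        assume "\<bar>int (cnt u) - X\<bar> \<le> int K"
        then have l: "int (cnt u) - X \<in> L" by (auto simp: L_def)
        with e cnt_eq_iff[of "int (cnt u) - X" "cnt u" X u] s_iff inI[OF l] have "okA s \<kappa> i"
          unfolding okA_def by (intro exI[of _ "int (cnt u) - X"]) auto
        with that show False by simp
      next
        assume "\<bar>int (cnt u) - Y\<bar> \<le> int K"
        then have l: "int (cnt u) - Y \<in> L" by (auto simp: L_def)
        with e cnt_eq_iff[of "int (cnt u) - Y" "cnt u" Y u] w_iff inI[OF l] have "okA w \<kappa> i"
          unfolding okA_def by (intro exI[of _ "int (cnt u) - Y"]) auto
        with that show False by simp
      qed
    qed
    show "shift j (f n a i b) = g' n a (code n a b) i + h' n a (\<chi>' n a (code n a b) i) b"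
      using via_s via_w none \<kappa>
      by (simp add: u_def[symmetric] g'_def h'_def \<chi>'_def code \<kappa>_def[symmetric] Let_def shift_def X_def Y_def k_def)
  qed
qed

lemma splits_qval: "splits (\<lambda>n a i b. qval (\<lambda>v. if v \<in> X then a i v else b v) t)"
proof (induction t)
  case (QVar v)
  then show ?case using splits_left[of "\<lambda>n a i. a i v"] splits_right[of "\<lambda>n a b. b v"] by (cases "v \<in> X") simp_all
next
  case (QConst k)
  then show ?case using splits_left[of "\<lambda>n a i. k"] by simp
next
  case (QAdd s t)
  then show ?case by (simp add: splits_add)
next
  case (QScale k t)
  then show ?case by (simp add: splits_scale)
next
  case (QShift j t)
  then show ?case by (simp add: splits_shift)
qed

lemma few_determined:
  assumes "determined Q"
  shows "few (\<lambda>n a b. {i. i < n \<and> Q (\<lambda>v. if v \<in> X then a i v else b v)})"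
proof -
  from assms obtain \<Phi> where \<Phi>: "finite \<Phi>" "\<And>e e'. agree \<Phi> e e' \<Longrightarrow> Q e \<longleftrightarrow> Q e'"
    unfolding determined_def by blast
  let ?mix = "\<lambda>a b v. if v \<in> X then a v else b v"
  define c where "c p n a b = ({i. i < n \<and> 0 < qval (?mix (a i) b) (fst p)}, 
     \<lambda>i. if i < n then qval (?mix (a i) b) (fst p) mod int (Suc (snd p)) else undefined)"
    for p :: "qterm \<times> nat" and n :: nat and a :: "nat \<Rightarrow> nat \<Rightarrow> int" and b
  have "few (\<lambda>n a b p. if p \<in> \<Phi> then c p n a b else undefined)"
    unfolding c_def by (intro few_fun \<Phi>(1) few_pair few_positive few_mod splits_qval) simp
  then show ?thesis
  proof (rule few_factor)
    fix n and a :: "nat \<Rightarrow> nat \<Rightarrow> int" and b b'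
    assume eq: "(\<lambda>p. if p \<in> \<Phi> then c p n a b else undefined) = (\<lambda>p. if p \<in> \<Phi> then c p n a b' else undefined)"
    have c: "c p n a b = c p n a b'" if "p \<in> \<Phi>" for p
      using fun_cong[OF eq, of p] that by simp
    have "agree \<Phi> (?mix (a i) b) (?mix (a i) b')" if i: "i < n" for i
      unfolding agree_def
    proof (clarify, intro conjI)
      fix t k assume p: "(t, k) \<in> \<Phi>"
      have *: "{i. i < n \<and> 0 < qval (?mix (a i) b) t} = {i. i < n \<and> 0 < qval (?mix (a i) b') t} \<and>
         (\<lambda>i. if i < n then qval (?mix (a i) b) t mod int (Suc k) else undefined) =
         (\<lambda>i. if i < n then qval (?mix (a i) b') t mod int (Suc k) else undefined)"
        using c[OF p] by (simp only: c_def prod.inject fst_conv snd_conv)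
      from conjunct1[OF *] i show "0 < qval (?mix (a i) b) t \<longleftrightarrow> 0 < qval (?mix (a i) b') t" by blast
      from fun_cong[OF conjunct2[OF *], of i] i
      show "int (Suc k) dvd qval (?mix (a i) b) t - qval (?mix (a i) b') t"
        by (simp add: mod_eq_dvd_iff del: of_nat_Suc)
    qed
    then show "{i. i < n \<and> Q (?mix (a i) b)} = {i. i < n \<and> Q (?mix (a i) b')}" using \<Phi>(2) by blast
  qed
qed

text \<open>The witness is \<open>n = 2 ^ (2 * j) - 2\<close>, for which \<open>n + 2\<close> is a power of two.\<close>

lemma poly_less_exp: "\<exists>n. (n + 2) ^ d < (2::nat) ^ n"
proof -
  define j where "j = 2 * d + 1"
  have "j + 1 \<le> 2 ^ j" using less_exp[of j] by (simp add: Suc_le_eq)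
  then have "(j + 1) * (j + 1) \<le> 2 ^ j * 2 ^ j" by (intro mult_mono) auto
  then have "(j + 1) * (j + 1) \<le> 2 ^ (2 * j)" by (simp add: power_add[symmetric] mult_2)
  then have "2 * j * d + 2 < 2 ^ (2 * j)" by (auto simp: j_def algebra_simps)
  then have k: "2 * j * d < 2 ^ (2 * j) - 2" "(2::nat) ^ (2 * j) \<ge> 2" by auto
  have "(2 ^ (2 * j) - 2 + 2) ^ d = (2::nat) ^ (2 * j * d)" using k(2) by (simp only: le_add_diff_inverse2 power_mult)
  also have "\<dots> < 2 ^ (2 ^ (2 * j) - 2)" using k(1) by (intro power_strict_increasing) auto
  finally show ?thesis by blast
qed

theorem no_IP: "\<not> has_IP (int_struc (range r)) X \<phi>"
proof
  assume IP: "has_IP (int_struc (range r)) X \<phi>"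
  let ?sat = "\<lambda>e. sat (int_struc (range r)) e \<phi>"
  let ?c = "\<lambda>(n::nat) (a :: nat \<Rightarrow> nat \<Rightarrow> int) b. {i. i < n \<and> ?sat (\<lambda>v. if v \<in> X then a i v else b v)}"
  have "few ?c" by (rule few_determined[OF determined_sat])
  then obtain d where d: "\<And>n a. finite (range (?c n a))" "\<And>n a. card (range (?c n a)) \<le> (n + 2) ^ d"
    unfolding few_def by blast
  obtain n where n: "(n + 2) ^ d < (2::nat) ^ n" using poly_less_exp by blast
  obtain a b where ab: "\<forall>i<n. \<forall>J\<subseteq>{..<n}. ?sat (\<lambda>v. if v \<in> X then a i v else b J v) \<longleftrightarrow> i \<in> J"
    using IP[unfolded has_IP_def, THEN spec, of n] by (elim exE conjE)
  have "J \<in> range (?c n a)" if "J \<subseteq> {..<n}" for J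
    using ab that by (intro image_eqI[of _ _ "b J"]) auto
  then have "Pow {..<n} \<subseteq> range (?c n a)" by blast
  then have "card (Pow {..<n}) \<le> card (range (?c n a))" using d(1) by (intro card_mono)
  then have "2 ^ n \<le> card (range (?c n a))" by (simp add: card_Pow)
  also have "\<dots> \<le> (n + 2) ^ d" by (rule d(2))
  finally show False using n by simp
qed

end

section \<open>Transfer to arbitrary models\<close>

primrec rename_tm :: "(nat \<Rightarrow> nat) \<Rightarrow> tm \<Rightarrow> tm" where
  "rename_tm f (Var v) = Var (f v)"
| "rename_tm f Zero = Zero"
| "rename_tm f (Add s t) = Add (rename_tm f s) (rename_tm f t)"

primrec rename :: "(nat \<Rightarrow> nat) \<Rightarrow> fm \<Rightarrow> fm" where
  "rename f (Eq s t) = Eq (rename_tm f s) (rename_tm f t)"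
| "rename f (Less s t) = Less (rename_tm f s) (rename_tm f t)"
| "rename f (Rel t) = Rel (rename_tm f t)"
| "rename f (Neg \<phi>) = Neg (rename f \<phi>)"
| "rename f (Conj \<phi> \<psi>) = Conj (rename f \<phi>) (rename f \<psi>)"
| "rename f (Exi v \<phi>) = Exi (f v) (rename f \<phi>)"

lemma val_rename_tm: "val M e (rename_tm f t) = val M (e \<circ> f) t"
  by (induction t) auto

text \<open>Injectivity excludes capture by the renamed quantifiers.\<close>

lemma sat_rename:
  assumes "inj f"
  shows "sat M e (rename f \<phi>) \<longleftrightarrow> sat M (e \<circ> f) \<phi>"
proof (induction \<phi> arbitrary: e)
  case (Exi v \<phi>)
  have "(e(f v := x)) \<circ> f = (e \<circ> f)(v := x)" for x
    using assms by (auto simp: fun_eq_iff inj_def)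
  then show ?case by (simp only: rename.simps sat.simps Exi.IH)
qed (auto simp: val_rename_tm)

lemma val_cong: "(\<And>v. v \<in> fv_tm t \<Longrightarrow> e v = e' v) \<Longrightarrow> val M e t = val M e' t"
  by (induction t) auto

lemma sat_cong: "(\<And>v. v \<in> fv \<phi> \<Longrightarrow> e v = e' v) \<Longrightarrow> sat M e \<phi> \<longleftrightarrow> sat M e' \<phi>"
proof (induction \<phi> arbitrary: e e')
  case (Eq s t)
  then show ?case using val_cong[of s e e' M] val_cong[of t e e' M] by simp
next
  case (Less s t)
  then show ?case using val_cong[of s e e' M] val_cong[of t e e' M] by simp
next
  case (Rel t)
  then show ?case using val_cong[of t e e' M] by simp
next
  case (Neg \<phi>)
  have "sat M e \<phi> \<longleftrightarrow> sat M e' \<phi>"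
    by (rule Neg.IH) (use Neg.prems in auto)
  then show ?case by simp
next
  case (Conj \<phi> \<psi>)
  have "sat M e \<phi> \<longleftrightarrow> sat M e' \<phi>" "sat M e \<psi> \<longleftrightarrow> sat M e' \<psi>"
    by (rule Conj.IH; use Conj.prems in auto)+
  then show ?case by simp
next
  case (Exi v \<phi>)
  have "sat M (e(v := x)) \<phi> \<longleftrightarrow> sat M (e'(v := x)) \<phi>" for x
    by (rule Exi.IH) (use Exi.prems in auto)
  then show ?case by simp
qed

lemma finite_fv_tm: "finite (fv_tm t)"
  by (induction t) auto

lemma finite_fv: "finite (fv \<phi>)"
  by (induction \<phi>) (auto simp: finite_fv_tm)

primrec conjs :: "fm list \<Rightarrow> fm" where
  "conjs [] = Eq Zero Zero"
| "conjs (\<phi> # \<phi>s) = Conj \<phi> (conjs \<phi>s)"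

lemma sat_conjs: "sat M e (conjs \<phi>s) \<longleftrightarrow> (\<forall>\<phi>\<in>set \<phi>s. sat M e \<phi>)"
  by (induction \<phi>s) auto

lemma fv_exis: "fv (foldr Exi vs \<phi>) = fv \<phi> - set vs"
  by (induction vs) auto

lemma sat_exis:
  "sat M e (foldr Exi vs \<phi>) \<longleftrightarrow>
     (\<exists>e'. (\<forall>v\<in>set vs. e' v \<in> universe M) \<and> (\<forall>v. v \<notin> set vs \<longrightarrow> e' v = e v) \<and> sat M e' \<phi>)"
proof (induction vs arbitrary: e)
  case Nil
  have "(\<forall>v. e' v = e v) \<longleftrightarrow> e' = e" for e' by auto
  then show ?case by simp
next
  case (Cons w vs)
  show ?case
  proof
    assume "sat M e (foldr Exi (w # vs) \<phi>)"
    then obtain x e' where "x \<in> universe M" "\<forall>v\<in>set vs. e' v \<in> universe M"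
      "\<forall>v. v \<notin> set vs \<longrightarrow> e' v = (e(w := x)) v" "sat M e' \<phi>"
      using Cons.IH by auto
    then show "\<exists>e'. (\<forall>v\<in>set (w # vs). e' v \<in> universe M) \<and> (\<forall>v. v \<notin> set (w # vs) \<longrightarrow> e' v = e v) \<and> sat M e' \<phi>"
      by (intro exI[of _ e']) (auto split: if_splits)
  next
    assume "\<exists>e'. (\<forall>v\<in>set (w # vs). e' v \<in> universe M) \<and> (\<forall>v. v \<notin> set (w # vs) \<longrightarrow> e' v = e v) \<and> sat M e' \<phi>"
    then obtain e' where e': "\<forall>v\<in>set (w # vs). e' v \<in> universe M"
      "\<forall>v. v \<notin> set (w # vs) \<longrightarrow> e' v = e v" "sat M e' \<phi>" by blast
    then have "sat M (e(w := e' w)) (foldr Exi vs \<phi>)"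
      unfolding Cons.IH by (intro exI[of _ e']) auto
    with e' show "sat M e (foldr Exi (w # vs) \<phi>)" by auto
  qed
qed

definition closure :: "fm \<Rightarrow> fm" where
  "closure \<phi> = foldr Exi (sorted_list_of_set (fv \<phi>)) \<phi>"

lemma fv_closure: "fv (closure \<phi>) = {}"
  by (simp add: closure_def fv_exis finite_fv)

lemma sat_closure:
  assumes "valuation M e"
  shows "sat M e (closure \<phi>) \<longleftrightarrow> (\<exists>e'. valuation M e' \<and> sat M e' \<phi>)"
proof
  assume "sat M e (closure \<phi>)"
  then obtain e' where e': "\<forall>v\<in>fv \<phi>. e' v \<in> universe M" "\<forall>v. v \<notin> fv \<phi> \<longrightarrow> e' v = e v" "sat M e' \<phi>"
    by (auto simp: closure_def sat_exis finite_fv)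
  then have "valuation M e'" using assms unfolding valuation_def by metis
  with e' show "\<exists>e'. valuation M e' \<and> sat M e' \<phi>" by blast
next
  assume "\<exists>e'. valuation M e' \<and> sat M e' \<phi>"
  then obtain e' where e': "valuation M e'" "sat M e' \<phi>" by blast
  define e'' where "e'' v = (if v \<in> fv \<phi> then e' v else e v)" for v
  have "sat M e'' \<phi>" using e'(2) sat_cong[of \<phi> e'' e' M] by (simp add: e''_def)
  then show "sat M e (closure \<phi>)"
    using e'(1) by (auto simp: closure_def sat_exis finite_fv e''_def valuation_def intro!: exI[of _ e''])
qed

text \<open>Separate copies of the variables for each left tuple \<open>i\<close> and each right tuple \<open>J\<close>, told apart by parity.\<close>

definition index_var :: "nat set \<Rightarrow> nat \<Rightarrow> nat set \<Rightarrow> nat \<Rightarrow> nat" where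
  "index_var X i J v = (if v \<in> X then prod_encode (2 * i, v) else prod_encode (2 * set_encode J + 1, v))"

lemma inj_index_var: "inj (index_var X i J)"
  by (rule injI) (auto simp: index_var_def prod_encode_eq split: if_splits)

definition shattering :: "nat set \<Rightarrow> fm \<Rightarrow> nat \<Rightarrow> fm" where
  "shattering X \<phi> n = conjs (concat (map (\<lambda>i. map (\<lambda>J.
      let \<psi> = rename (index_var X i J) \<phi> in if i \<in> J then \<psi> else Neg \<psi>)
      (map set (subseqs [0..<n]))) [0..<n]))"

lemma sat_shattering:
  "sat M e (shattering X \<phi> n) \<longleftrightarrow>
     (\<forall>i<n. \<forall>J\<subseteq>{..<n}. sat M (e \<circ> index_var X i J) \<phi> \<longleftrightarrow> i \<in> J)"
proof -
  have "sat M e (shattering X \<phi> n) \<longleftrightarrow> (\<forall>i\<in>{..<n}. \<forall>J\<in>set ` set (subseqs [0..<n]).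
      sat M e (let \<psi> = rename (index_var X i J) \<phi> in if i \<in> J then \<psi> else Neg \<psi>))"
    by (auto simp: shattering_def sat_conjs)
  also have "set ` set (subseqs [0..<n]) = Pow {..<n}"
    by (simp add: subseqs_powset atLeast0LessThan)
  finally show ?thesis
    by (auto simp: Let_def sat_rename[OF inj_index_var] split: if_splits)
qed

lemma has_IP_iff_shattering:
  assumes "is_struc M"
  shows "has_IP M X \<phi> \<longleftrightarrow> (\<forall>n. \<exists>e. valuation M e \<and> sat M e (shattering X \<phi> n))"
proof
  assume IP: "has_IP M X \<phi>"
  show "\<forall>n. \<exists>e. valuation M e \<and> sat M e (shattering X \<phi> n)"
  proof
    fix n :: nat
    obtain a b where a: "\<forall>i<n. valuation M (a i)" and b: "\<forall>J\<subseteq>{..<n}. valuation M (b J)"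
      and ab: "\<forall>i<n. \<forall>J\<subseteq>{..<n}. sat M (\<lambda>v. if v \<in> X then a i v else b J v) \<phi> \<longleftrightarrow> i \<in> J"
      using IP[unfolded has_IP_def, THEN spec, of n] by (elim exE conjE)
    \<comment> \<open>variables that belong to no tuple still need a value in the universe\<close>
    define e where "e w = (case prod_decode w of (k, v) \<Rightarrow>
       if even k then (if k div 2 < n then a (k div 2) v else zero_of M)
       else (if set_decode (k div 2) \<subseteq> {..<n} then b (set_decode (k div 2)) v else zero_of M))" for w
    have "valuation M e"
      using a b assms by (auto simp: valuation_def e_def is_struc_def split: prod.splits)
    moreover have "e \<circ> index_var X i J = (\<lambda>v. if v \<in> X then a i v else b J v)" if "i < n" "J \<subseteq> {..<n}" for i J
    proof -
      have "finite J" using that(2) by (rule finite_subset) simp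
      then show ?thesis using that by (auto simp: fun_eq_iff index_var_def e_def)
    qed
    ultimately show "\<exists>e. valuation M e \<and> sat M e (shattering X \<phi> n)"
      using ab by (auto simp: sat_shattering)
  qed
next
  assume sh: "\<forall>n. \<exists>e. valuation M e \<and> sat M e (shattering X \<phi> n)"
  show "has_IP M X \<phi>"
    unfolding has_IP_def
  proof
    fix n :: nat
    from sh obtain e where e: "valuation M e" "sat M e (shattering X \<phi> n)" by blast
    have eq: "e \<circ> index_var X i J = (\<lambda>v. if v \<in> X then e (prod_encode (2 * i, v)) else e (prod_encode (2 * set_encode J + 1, v)))" for i J
      by (auto simp: index_var_def)
    show "\<exists>(a :: nat \<Rightarrow> nat \<Rightarrow> _) (b :: nat set \<Rightarrow> nat \<Rightarrow> _).
        (\<forall>i<n. valuation M (a i)) \<and> (\<forall>J\<subseteq>{..<n}. valuation M (b J)) \<and>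
        (\<forall>i<n. \<forall>J\<subseteq>{..<n}. sat M (\<lambda>v. if v \<in> X then a i v else b J v) \<phi> \<longleftrightarrow> i \<in> J)"
      by (intro exI[of _ "\<lambda>i v. e (prod_encode (2 * i, v))"] exI[of _ "\<lambda>J v. e (prod_encode (2 * set_encode J + 1, v))"])
         (use e in \<open>simp add: valuation_def sat_shattering eq\<close>)
  qed
qed

text \<open>
  The existential closure of \<open>shattering X \<phi> n\<close> is a sentence. If it failed in \<open>N\<close>, its negation would
  belong to the theory and hold in \<open>M\<close>.
\<close>

lemma has_IP_transfer:
  assumes "is_model M (Th N)" "is_struc N" "has_IP M X \<phi>"
  shows "has_IP N X \<phi>"
proof -
  have M: "is_struc M" using assms(1) by (simp add: is_model_def)
  then have val0: "valuation M (\<lambda>_. zero_of M)" by (simp add: valuation_def is_struc_def)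
  have "\<exists>e. valuation N e \<and> sat N e (shattering X \<phi> n)" for n
  proof (rule ccontr)
    assume "\<not> ?thesis"
    then have "Neg (closure (shattering X \<phi> n)) \<in> Th N"
      by (auto simp: Th_def fv_closure sat_closure)
    then have "\<not> sat M (\<lambda>_. zero_of M) (closure (shattering X \<phi> n))"
      using assms(1) val0 by (auto simp: is_model_def)
    then show False
      using assms(3) has_IP_iff_shattering[OF M] sat_closure[OF val0] by blast
  qed
  then show ?thesis using has_IP_iff_shattering[OF assms(2)] by blast
qed

theorem theoremB:
  fixes r :: "nat \<Rightarrow> nat" and R :: "nat set"
  assumes "regular_seq r"
    and "congruence_periodic r"
    and "R = range r"
  shows "NIP TYPE('m) (Th (int_struc R))"
  unfolding NIP_def
proof (intro allI impI notI)
  fix M :: "'m struc" and X \<phi>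
  assume M: "is_model M (Th (int_struc R))" and IP: "has_IP M X \<phi>"
  have "is_struc (int_struc R)" by (simp add: is_struc_def int_struc_def)
  from has_IP_transfer[OF M this IP] have "has_IP (int_struc R) X \<phi>" .
  then show False
    using sparse_sequence.no_IP[OF sparse_sequence_if_regular[OF assms(1,2)]] assms(3) by blast
qed

end
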